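(* Let $Y$ be an integer homology sphere such that $HF^-(Y)\cong\mathbb H^-(M)$ as graded $\mathbb F[U]$-modules for some symmetric graded root $M$, by an isomorphism carrying the involution $\iota_*$ on $HF^-(Y)$ to the involution $J_0$ of $\mathbb H^-(M)$. Let $M'$ be the monotone graded subroot of $M$. Then $HF_{\mathrm{conn}}(Y)$ is the $U$-torsion submodule of $\mathbb H^-(M')$, shifted upward in degree by $1$.
   Context: $\mathbb F=\mathbb Z/2\mathbb Z$, and $U$ has degree $-2$. Graded roots. A graded root $M$ is an infinite tree with a function $\chi:\mathrm{Vert}(M)\to\mathbb Q$ such that: $\chi(u)-\chi(v)=\pm1$ for any edge $(u,v)$; $\chi(u)\le\max\{\chi(v),\chi(w)\}$ for any edges $(u,v),(u,w)$ with $v\ne w$; $\chi$ is bounded above; $\chi^{-1}(k)$ is finite for every $k$; $\#\chi^{-1}(k)=1$ for all $k\ll0$ (in the coset of $\mathbb Z$ where $\chi$ takes values). $\mathbb H^-(M)$ is the $\mathbb F[U]$-module with $\mathbb F$-basis $\mathrm{Vert}(M)$ and $U\cdot v=w$ when $(v,w)$ is an edge with $\chi(v)-\chi(w)=1$; relative degree is twice the relative $\chi$-grading (so $\deg U=-2$), with an overall normalization of the absolute grading allowed. Below, "degree" or "grading" of a vertex refers to this grading. A symmetric graded root is a graded root with a $\chi$-preserving involution $J_0$ of $\mathrm{Vert}(M)$ such that $J_0$ fixes at most one vertex in each $\chi^{-1}(k)$ and $(v,w)$ is an edge iff $(J_0v,J_0w)$ is; $J_0$ induces an involution of $\mathbb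 H^-(M)$. Monotone subroot. The $J_0$-invariant vertices of $M$ form an infinite downward stem. For a vertex $v$, let $\gamma(v)$ be the infinite downward path from $v$, and let the base $b(v)$ be the degree of the first vertex of $\gamma(v)$ on the stem. The cluster $C_b$ is the set of vertices with base $b$; it is nontrivial if it has more than one vertex. In each nontrivial cluster choose a pair of vertices interchanged by $J_0$ of maximal grading in the cluster, called its tips. Construct a set $S$ of vertices: let $r$ be the maximal degree of a $J_0$-invariant vertex $v$; if $C_r$ is trivial put $v$ in $S$, otherwise put the tips of $C_r$ in $S$. Then go through the numbers $b<r$ for which $C_b$ is nontrivial, in decreasing order; add the tips of $C_b$ to $S$ if their grading is greater than the degree of every vertex currently in $S$, and otherwise do not. The monotone graded subroot $M'$ is the smallest graded subroot of $M$ containing $S$; $\mathbb H^-(M')$ is the $\mathbb F[U]$-span in $\mathbb H^-(M)$ of the generators corresponding to $S$. Floer theory. For an integer homology sphere $Y$, $CF^-(Y)$ is the minus Heegaard Floer complex, a finitely generated free graded chain complex over $\mathbb F[U]$, normalized so that $HF^-(S^3)=\mathbb F[U]$ with $\mathrm{gr}(1)=-2$. The conjugation involution $\iota$ on $CF^-(Y)$: for a pointed Heegaard diagram $(\Sigma,\boldsymbol\alpha,\boldsymbol\beta,z)$ (with almost complex structures), $\iota=\Phi\circ\eta$, where $\eta$ is the canonical isomorphism to the complex of the conjugate diagram $(-\Sigma,\boldsymbol\beta,\boldsymbol\alpha,z)$ and $\Phi$ is the homotopy equivalence induced by Heegaard moves and changes of almost complex structure back to the original. It is a grading-preserving chain map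 with $\iota^2\simeq\mathrm{id}$ (homotopies over $\mathbb F[U]$); $\iota_*$ is the induced map on $HF^-(Y)$. Connected homology. For $C=CF^-(Y)$, a self-local equivalence is a grading-preserving chain map $f:C\to C$ over $\mathbb F[U]$ with $f\circ\iota\simeq\iota\circ f$ inducing an isomorphism on $U^{-1}H_*(C)$. Preorder: $f\lesssim g$ if $\ker f\subseteq\ker g$; $f$ is maximal if $g\gtrsim f$ implies $g\lesssim f$ for every self-local equivalence $g$. $HF_{\mathrm{conn}}(Y)$ is the $U$-torsion submodule of $H_*(\operatorname{im} f)$, with gradings raised by $1$, for any maximal $f$ (well defined up to graded isomorphism). *)

theory Defs
  imports
    "HOL-Algebra.AbelCoset"
    "HOL-Algebra.Module"
    "HOL-Computational_Algebra.Polynomial"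
    "HOL-Library.Poly_Mapping"
    "HOL-Library.Z2"
begin

section \<open>Graded modules over \<open>\<F>[U]\<close>, with \<open>U\<close> of degree \<open>-2\<close>\<close>

definition FU :: "bit poly ring" where
  "FU = \<lparr>carrier = UNIV, monoid.mult = (*), one = 1, zero = 0, add = (+)\<rparr>"

abbreviation U :: "bit poly" where
  "U \<equiv> [:0, 1:]"

text \<open>\<open>hpart N k\<close> is the set of homogeneous elements of degree \<open>k\<close>, including zero.
  The fields \<open>mult\<close> and \<open>one\<close> inherited from the ring record play no role.\<close>

record 'a graded_module = "(bit poly, 'a) module" +
  hpart :: "int \<Rightarrow> 'a set"

locale graded_FU_module = Module.module FU N
  for N :: "('a, 'm) graded_module_scheme" (structure) +
  assumes hpart_subgroup: "subgroup (hpart N k) (add_monoid N)"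
    and hpart_U: "x \<in> hpart N k \<Longrightarrow> U \<odot> x \<in> hpart N (k - 2)"
    and hpart_decomposition: "x \<in> carrier N \<Longrightarrow>
      \<exists>!d. (\<forall>k. d k \<in> hpart N k) \<and> finite {k. d k \<noteq> \<zero>} \<and> x = (\<Oplus>k \<in> {k. d k \<noteq> \<zero>}. d k)"

definition finitely_generated_free :: "('a, 'm) graded_module_scheme \<Rightarrow> bool" where
  "finitely_generated_free N \<longleftrightarrow>
    (\<exists>B. finite B \<and> B \<subseteq> (\<Union>k. hpart N k) \<and>
      (\<forall>x \<in> carrier N. \<exists>!a. a \<in> extensional B \<and> x = (\<Oplus>\<^bsub>N\<^esub> b \<in> B. a b \<odot>\<^bsub>N\<^esub> b)))"

definition graded_linear ::
  "int \<Rightarrow> ('a, 'm) graded_module_scheme \<Rightarrow> ('b, 'n) graded_module_scheme \<Rightarrow> ('a \<Rightarrow> 'b) \<Rightarrow> bool" where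
  "graded_linear d N N' f \<longleftrightarrow>
    f \<in> carrier N \<rightarrow> carrier N' \<and>
    (\<forall>x \<in> carrier N. \<forall>y \<in> carrier N. f (x \<oplus>\<^bsub>N\<^esub> y) = f x \<oplus>\<^bsub>N'\<^esub> f y) \<and>
    (\<forall>p. \<forall>x \<in> carrier N. f (p \<odot>\<^bsub>N\<^esub> x) = p \<odot>\<^bsub>N'\<^esub> f x) \<and>
    (\<forall>k. \<forall>x \<in> hpart N k. f x \<in> hpart N' (k + d))"

definition graded_iso ::
  "('a, 'm) graded_module_scheme \<Rightarrow> ('b, 'n) graded_module_scheme \<Rightarrow> ('a \<Rightarrow> 'b) \<Rightarrow> bool" where
  "graded_iso N N' f \<longleftrightarrow>
    graded_linear 0 N N' f \<and> bij_betw f (carrier N) (carrier N') \<and>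
    (\<forall>k. f ` hpart N k = hpart N' k)"

definition graded_isomorphic ::
  "('a, 'm) graded_module_scheme \<Rightarrow> ('b, 'n) graded_module_scheme \<Rightarrow> bool" where
  "graded_isomorphic N N' \<longleftrightarrow> (\<exists>f. graded_iso N N' f)"

definition submod ::
  "('a, 'm) graded_module_scheme \<Rightarrow> 'a set \<Rightarrow> ('a, 'm) graded_module_scheme" where
  "submod N W = N\<lparr>carrier := W, hpart := (\<lambda>k. hpart N k \<inter> W)\<rparr>"

text \<open>In the quotient by \<open>B\<close>, the set of multiples \<open>p \<odot> x\<close> with \<open>x\<close> in a coset need not be a
  full coset (take \<open>p = 0\<close>), so \<open>B\<close> is added to it.\<close>

definition quotient_mod ::
  "('a, 'm) graded_module_scheme \<Rightarrow> 'a set \<Rightarrow> 'a set graded_module" where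
  "quotient_mod N B = \<lparr>
     carrier = a_rcosets\<^bsub>N\<^esub> B,
     monoid.mult = undefined,
     one = undefined,
     zero = B,
     add = (\<lambda>X Y. X <+>\<^bsub>N\<^esub> Y),
     module.smult = (\<lambda>p X. B <+>\<^bsub>N\<^esub> ((\<lambda>x. p \<odot>\<^bsub>N\<^esub> x) ` X)),
     hpart = (\<lambda>k. (\<lambda>x. B +>\<^bsub>N\<^esub> x) ` hpart N k)\<rparr>"

definition U_torsion ::
  "('a, 'm) graded_module_scheme \<Rightarrow> ('a, 'm) graded_module_scheme" where
  "U_torsion N = submod N {x \<in> carrier N. \<exists>n. (U ^ n) \<odot>\<^bsub>N\<^esub> x = \<zero>\<^bsub>N\<^esub>}"

definition shift_up ::
  "int \<Rightarrow> ('a, 'm) graded_module_scheme \<Rightarrow> ('a, 'm) graded_module_scheme" where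
  "shift_up d N = N\<lparr>hpart := (\<lambda>k. hpart N (k - d))\<rparr>"

text \<open>The localization \<open>U\<^sup>-\<^sup>1 N\<close>: the pair \<open>(x, m)\<close> stands for the fraction \<open>x / U\<^sup>m\<close>.\<close>

definition loc_rel :: "('a, 'm) graded_module_scheme \<Rightarrow> ('a \<times> nat) rel" where
  "loc_rel N = {((x, m), (y, n)). x \<in> carrier N \<and> y \<in> carrier N \<and>
     (\<exists>k. (U ^ (k + n)) \<odot>\<^bsub>N\<^esub> x = (U ^ (k + m)) \<odot>\<^bsub>N\<^esub> y)}"

definition localization :: "('a, 'm) graded_module_scheme \<Rightarrow> ('a \<times> nat) set set" where
  "localization N = (carrier N \<times> UNIV) // loc_rel N"

definition loc_map ::
  "('b, 'n) graded_module_scheme \<Rightarrow> ('a \<Rightarrow> 'b) \<Rightarrow> ('a \<times> nat) set \<Rightarrow> ('b \<times> nat) set" where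
  "loc_map N' f c = loc_rel N' `` (map_prod f id ` c)"


section \<open>Chain complexes with involution\<close>

record 'a chain_cx = "'a graded_module" +
  diff :: "'a \<Rightarrow> 'a"

definition chain_complex :: "('a, 'm) chain_cx_scheme \<Rightarrow> bool" where
  "chain_complex C \<longleftrightarrow>
    graded_FU_module C \<and> graded_linear (-1) C C (diff C) \<and>
    (\<forall>x \<in> carrier C. diff C (diff C x) = \<zero>\<^bsub>C\<^esub>)"

definition cycles :: "('a, 'm) chain_cx_scheme \<Rightarrow> 'a set" where
  "cycles C = {x \<in> carrier C. diff C x = \<zero>\<^bsub>C\<^esub>}"

definition boundaries :: "('a, 'm) chain_cx_scheme \<Rightarrow> 'a set" where
  "boundaries C = diff C ` carrier C"

definition homology :: "('a, 'm) chain_cx_scheme \<Rightarrow> 'a set graded_module" where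
  "homology C = quotient_mod (submod C (cycles C)) (boundaries C)"

definition chain_map :: "('a, 'm) chain_cx_scheme \<Rightarrow> ('a \<Rightarrow> 'a) \<Rightarrow> bool" where
  "chain_map C f \<longleftrightarrow>
    graded_linear 0 C C f \<and> (\<forall>x \<in> carrier C. f (diff C x) = diff C (f x))"

definition homotopic :: "('a, 'm) chain_cx_scheme \<Rightarrow> ('a \<Rightarrow> 'a) \<Rightarrow> ('a \<Rightarrow> 'a) \<Rightarrow> bool" where
  "homotopic C f g \<longleftrightarrow>
    (\<exists>h. graded_linear 1 C C h \<and>
      (\<forall>x \<in> carrier C. f x \<ominus>\<^bsub>C\<^esub> g x = diff C (h x) \<oplus>\<^bsub>C\<^esub> h (diff C x)))"

definition homology_map ::
  "('a, 'm) chain_cx_scheme \<Rightarrow> ('a \<Rightarrow> 'a) \<Rightarrow> 'a set \<Rightarrow> 'a set" where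
  "homology_map C f X = boundaries C <+>\<^bsub>C\<^esub> (f ` X)"

text \<open>The algebraic structure carried by \<open>(CF\<^sup>-(Y), \<iota>)\<close> for an integer homology sphere \<open>Y\<close>.
  The condition that \<open>U\<^sup>-\<^sup>1 H\<^sub>*(C)\<close> is a copy of \<open>\<F>[U, U\<^sup>-\<^sup>1]\<close>, often made part of the notion,
  is not imposed here: it holds whenever \<open>H\<^sub>*(C)\<close> is the module of a graded root.\<close>

definition iota_complex :: "'a chain_cx \<Rightarrow> ('a \<Rightarrow> 'a) \<Rightarrow> bool" where
  "iota_complex C \<iota> \<longleftrightarrow>
    chain_complex C \<and> finitely_generated_free C \<and>
    chain_map C \<iota> \<and> homotopic C (\<iota> \<circ> \<iota>) id"


section \<open>Connected homology\<close>

definition self_local_equivalence :: "'a chain_cx \<Rightarrow> ('a \<Rightarrow> 'a) \<Rightarrow> ('a \<Rightarrow> 'a) \<Rightarrow> bool" where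
  "self_local_equivalence C \<iota> f \<longleftrightarrow>
    chain_map C f \<and> homotopic C (f \<circ> \<iota>) (\<iota> \<circ> f) \<and>
    bij_betw (loc_map (homology C) (homology_map C f))
      (localization (homology C)) (localization (homology C))"

definition kernel_le :: "'a chain_cx \<Rightarrow> ('a \<Rightarrow> 'a) \<Rightarrow> ('a \<Rightarrow> 'a) \<Rightarrow> bool" where
  "kernel_le C f g \<longleftrightarrow> a_kernel C C f \<subseteq> a_kernel C C g"

definition maximal_self_local_equivalence ::
  "'a chain_cx \<Rightarrow> ('a \<Rightarrow> 'a) \<Rightarrow> ('a \<Rightarrow> 'a) \<Rightarrow> bool" where
  "maximal_self_local_equivalence C \<iota> f \<longleftrightarrow>
    self_local_equivalence C \<iota> f \<and>
    (\<forall>g. self_local_equivalence C \<iota> g \<longrightarrow> kernel_le C f g \<longrightarrow> kernel_le C g f)"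

text \<open>Connected homology as computed from a maximal self-local equivalence \<open>f\<close>; it is
  independent of \<open>f\<close> only up to graded isomorphism, so \<open>f\<close> is kept as an argument.\<close>

definition HF_conn :: "'a chain_cx \<Rightarrow> ('a \<Rightarrow> 'a) \<Rightarrow> 'a set graded_module" where
  "HF_conn C f = shift_up 1 (U_torsion (homology (submod C (f ` carrier C))))"


section \<open>Graded roots\<close>

text \<open>Edges are undirected: \<open>edges\<close> is a symmetric relation.\<close>

record 'v root_graph =
  verts :: "'v set"
  edges :: "'v rel"
  chi :: "'v \<Rightarrow> rat"

locale graded_root =
  fixes M :: "'v root_graph"
  assumes edges_verts: "edges M \<subseteq> verts M \<times> verts M"
    and edges_sym: "sym (edges M)"
    and edges_irrefl: "irrefl (edges M)"
    and infinite_verts: "infinite (verts M)"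
    and connected: "\<lbrakk>u \<in> verts M; v \<in> verts M\<rbrakk> \<Longrightarrow> (u, v) \<in> (edges M)\<^sup>*"
    and no_cycle: "\<nexists>p. length p \<ge> 3 \<and> distinct p \<and>
      successively (\<lambda>u v. (u, v) \<in> edges M) p \<and> (last p, hd p) \<in> edges M"
    and chi_edge: "(u, v) \<in> edges M \<Longrightarrow> chi M u - chi M v = 1 \<or> chi M u - chi M v = -1"
    and chi_le_max: "\<lbrakk>(u, v) \<in> edges M; (u, w) \<in> edges M; v \<noteq> w\<rbrakk> \<Longrightarrow>
      chi M u \<le> max (chi M v) (chi M w)"
    and chi_bdd_above: "bdd_above (chi M ` verts M)"
    and finite_level: "finite {v \<in> verts M. chi M v = k}"
    and level_single: "\<exists>K. \<forall>k \<le> K. (\<exists>v \<in> verts M. k - chi M v \<in> \<int>) \<longrightarrow>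
      card {v \<in> verts M. chi M v = k} = 1"

locale symmetric_graded_root = graded_root M
  for M :: "'v root_graph" +
  fixes J\<^sub>0 :: "'v \<Rightarrow> 'v"
  assumes J_verts: "v \<in> verts M \<Longrightarrow> J\<^sub>0 v \<in> verts M"
    and J_involution: "v \<in> verts M \<Longrightarrow> J\<^sub>0 (J\<^sub>0 v) = v"
    and J_chi: "v \<in> verts M \<Longrightarrow> chi M (J\<^sub>0 v) = chi M v"
    and J_fixed_unique: "\<lbrakk>u \<in> verts M; v \<in> verts M; J\<^sub>0 u = u; J\<^sub>0 v = v; chi M u = chi M v\<rbrakk>
      \<Longrightarrow> u = v"
    and J_edges: "\<lbrakk>v \<in> verts M; w \<in> verts M\<rbrakk> \<Longrightarrow>
      (v, w) \<in> edges M \<longleftrightarrow> (J\<^sub>0 v, J\<^sub>0 w) \<in> edges M"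

text \<open>The neighbour one level below; in a graded root it exists and is unique.\<close>

definition down :: "'v root_graph \<Rightarrow> 'v \<Rightarrow> 'v" where
  "down M v = (THE w. (v, w) \<in> edges M \<and> chi M v - chi M w = 1)"

text \<open>A degree function is twice \<open>chi\<close> up to an overall constant. The constant is arbitrary
  except that degrees are integers, as they are for integer homology spheres.\<close>

definition degree_function :: "'v root_graph \<Rightarrow> ('v \<Rightarrow> int) \<Rightarrow> bool" where
  "degree_function M gr \<longleftrightarrow>
    (\<forall>v \<in> verts M. \<forall>w \<in> verts M. of_int (gr v - gr w) = 2 * (chi M v - chi M w))"

definition Hminus :: "'v root_graph \<Rightarrow> ('v \<Rightarrow> int) \<Rightarrow> ('v \<Rightarrow>\<^sub>0 bit) graded_module" where
  "Hminus M gr = \<lparr>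
     carrier = {x. Poly_Mapping.keys x \<subseteq> verts M},
     monoid.mult = undefined,
     one = undefined,
     zero = 0,
     add = (+),
     module.smult = (\<lambda>p x. \<Sum>v \<in> Poly_Mapping.keys x. \<Sum>n \<le> degree p.
       Poly_Mapping.single ((down M ^^ n) v) (coeff p n * Poly_Mapping.lookup x v)),
     hpart = (\<lambda>k. {x. Poly_Mapping.keys x \<subseteq> {v \<in> verts M. gr v = k}})\<rparr>"

definition vertex_map :: "('v \<Rightarrow> 'v) \<Rightarrow> ('v \<Rightarrow>\<^sub>0 bit) \<Rightarrow> ('v \<Rightarrow>\<^sub>0 bit)" where
  "vertex_map J x = (\<Sum>v \<in> Poly_Mapping.keys x. Poly_Mapping.single (J v) (Poly_Mapping.lookup x v))"


section \<open>The monotone subroot\<close>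

definition base :: "'v root_graph \<Rightarrow> ('v \<Rightarrow> 'v) \<Rightarrow> ('v \<Rightarrow> int) \<Rightarrow> 'v \<Rightarrow> int" where
  "base M J gr v =
    gr ((down M ^^ (LEAST n. J ((down M ^^ n) v) = (down M ^^ n) v)) v)"

definition cluster :: "'v root_graph \<Rightarrow> ('v \<Rightarrow> 'v) \<Rightarrow> ('v \<Rightarrow> int) \<Rightarrow> int \<Rightarrow> 'v set" where
  "cluster M J gr b = {v \<in> verts M. base M J gr v = b}"

definition nontrivial_cluster ::
  "'v root_graph \<Rightarrow> ('v \<Rightarrow> 'v) \<Rightarrow> ('v \<Rightarrow> int) \<Rightarrow> int \<Rightarrow> bool" where
  "nontrivial_cluster M J gr b \<longleftrightarrow>
    (\<exists>v \<in> cluster M J gr b. \<exists>w \<in> cluster M J gr b. v \<noteq> w)"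

text \<open>The function \<open>tip\<close> picks one of the two tips in each nontrivial cluster; the other one is
  its image under the involution.\<close>

definition tip_choice ::
  "'v root_graph \<Rightarrow> ('v \<Rightarrow> 'v) \<Rightarrow> ('v \<Rightarrow> int) \<Rightarrow> (int \<Rightarrow> 'v) \<Rightarrow> bool" where
  "tip_choice M J gr tip \<longleftrightarrow>
    (\<forall>b. nontrivial_cluster M J gr b \<longrightarrow>
      tip b \<in> cluster M J gr b \<and> J (tip b) \<noteq> tip b \<and>
      (\<forall>w \<in> cluster M J gr b. gr w \<le> gr (tip b)))"

definition stem_top :: "'v root_graph \<Rightarrow> ('v \<Rightarrow> 'v) \<Rightarrow> ('v \<Rightarrow> int) \<Rightarrow> int" where
  "stem_top M J gr = (GREATEST r. \<exists>v \<in> verts M. J v = v \<and> gr v = r)"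

text \<open>\<open>monotone_gens_upto M J gr tip n\<close> is the set \<open>S\<close> after all numbers \<open>b \<ge> r - n\<close> have been
  treated, where \<open>r = stem_top M J gr\<close>.\<close>

primrec monotone_gens_upto ::
  "'v root_graph \<Rightarrow> ('v \<Rightarrow> 'v) \<Rightarrow> ('v \<Rightarrow> int) \<Rightarrow> (int \<Rightarrow> 'v) \<Rightarrow> nat \<Rightarrow> 'v set" where
  "monotone_gens_upto M J gr tip 0 =
    (let r = stem_top M J gr in
     if nontrivial_cluster M J gr r then {tip r, J (tip r)}
     else {v \<in> verts M. J v = v \<and> gr v = r})"
| "monotone_gens_upto M J gr tip (Suc n) =
    (let b = stem_top M J gr - int (Suc n); S = monotone_gens_upto M J gr tip n in
     if nontrivial_cluster M J gr b \<and> (\<forall>s \<in> S. gr s < gr (tip b))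
     then S \<union> {tip b, J (tip b)}
     else S)"

definition monotone_gens ::
  "'v root_graph \<Rightarrow> ('v \<Rightarrow> 'v) \<Rightarrow> ('v \<Rightarrow> int) \<Rightarrow> (int \<Rightarrow> 'v) \<Rightarrow> 'v set" where
  "monotone_gens M J gr tip = (\<Union>n. monotone_gens_upto M J gr tip n)"

definition restrict_root :: "'v root_graph \<Rightarrow> 'v set \<Rightarrow> 'v root_graph" where
  "restrict_root M W = \<lparr>verts = W, edges = edges M \<inter> (W \<times> W), chi = chi M\<rparr>"

definition graded_subroot :: "'v root_graph \<Rightarrow> 'v set \<Rightarrow> bool" where
  "graded_subroot M W \<longleftrightarrow> W \<subseteq> verts M \<and> graded_root (restrict_root M W)"

text \<open>The smallest graded subroot containing \<open>S\<close> is the intersection of all of them. Connected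
  subgraphs of a tree are induced, so subroots are given by their vertex sets.\<close>

definition monotone_subroot ::
  "'v root_graph \<Rightarrow> ('v \<Rightarrow> 'v) \<Rightarrow> ('v \<Rightarrow> int) \<Rightarrow> (int \<Rightarrow> 'v) \<Rightarrow> 'v root_graph" where
  "monotone_subroot M J gr tip =
    restrict_root M (\<Inter>{W. graded_subroot M W \<and> monotone_gens M J gr tip \<subseteq> W})"

end

theory Submission
  imports Defs
begin

text \<open>
  Since \<open>H\<^sub>*(C)\<close> is concentrated in one parity and \<open>\<F>[U]\<close> is a principal ideal domain, chain
  maps of \<open>C\<close> up to homotopy are the same as graded endomorphisms of \<open>H\<^sub>*(C) = \<H>\<^sup>-(M)\<close>, so
  self-local equivalences correspond to endomorphisms that commute with \<open>J\<^sub>0\<close> and become the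
  identity after applying a high power of \<open>U\<close>.

  Two facts about roots enter. The root \<open>M\<close> folds \<open>J\<^sub>0\<close>-equivariantly onto \<open>M'\<close>, which lifts
  to a self-local equivalence \<open>p\<close> with values in \<open>\<H>\<^sup>-(M')\<close> on homology. And on the monotone root
  \<open>M'\<close> every equivariant local endomorphism is injective, because it is triangular with respect to
  the base, up to exchanging \<open>v\<close> and \<open>J\<^sub>0 v\<close>.

  If \<open>f\<close> is maximal, then \<open>ker (f p f) = ker f\<close>, so \<open>f p\<close> is injective on \<open>im f\<close>, hence an
  automorphism of \<open>im f\<close> by finiteness in each degree. Thus \<open>p\<^sub>*\<close> embeds \<open>H\<^sub>*(im f)\<close> into
  \<open>\<H>\<^sup>-(M')\<close>, and it is onto since already \<open>p\<^sub>* f\<^sub>*\<close> is bijective on \<open>\<H>\<^sup>-(M')\<close>.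
  A maximal \<open>f\<close> exists because kernels are determined by a finite window of low degrees.
\<close>

section \<open>Graded modules over \<open>\<F>[U]\<close>\<close>

text \<open>No structure theorem over the principal ideal domain is used. The field has two
  elements, so a homogeneous part of a finitely generated free module is a finite set, and this
  finiteness replaces bases: sections are found as maximal partial maps, and injective endomorphisms
  are onto degree by degree.

  On a root the localization becomes concrete. Far enough down, all vertices of one degree merge, so
  inverting \<open>U\<close> retains from a homogeneous element only the parity of its number of
  vertices. A local map therefore sends a vertex to a sum of an odd number of vertices, and this
  oddness is what makes the triangular matrices on the monotone root invertible.

  In the last step the composite f p f, and not merely p f, is compared with f, because f p maps im
  f to itself. Being injective there, it is onto, and this allows an equation p x = d y, with y
  anywhere in the complex, to be pulled back to a boundary inside im f.\<close>

lemma FU_simps [simp]: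
  "carrier FU = UNIV" "p \<otimes>\<^bsub>FU\<^esub> q = p * q" "\<one>\<^bsub>FU\<^esub> = 1" "\<zero>\<^bsub>FU\<^esub> = 0" "p \<oplus>\<^bsub>FU\<^esub> q = p + q"
  by (simp_all add: FU_def)

lemma bit_add_self: "(a :: bit) + a = 0"
  by (cases a) simp_all

lemma bit_poly_add_self [simp]: "(p :: bit poly) + p = 0"
  by (rule poly_eqI) (simp only: coeff_add coeff_0 bit_add_self)

context graded_FU_module
begin

lemma smult_simps:
  "x \<in> carrier N \<Longrightarrow> p \<odot> x \<in> carrier N"
  "x \<in> carrier N \<Longrightarrow> (p + q) \<odot> x = p \<odot> x \<oplus> q \<odot> x"
  "x \<in> carrier N \<Longrightarrow> y \<in> carrier N \<Longrightarrow> p \<odot> (x \<oplus> y) = p \<odot> x \<oplus> p \<odot> y"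
  "x \<in> carrier N \<Longrightarrow> (p * q) \<odot> x = p \<odot> (q \<odot> x)"
  "x \<in> carrier N \<Longrightarrow> 1 \<odot> x = x"
  "x \<in> carrier N \<Longrightarrow> 0 \<odot> x = \<zero>"
  "p \<odot> \<zero> = \<zero>"
  using smult_closed[of p x] smult_l_distr[of p q x] smult_r_distr[of p x y]
    smult_assoc1[of p q x] smult_one[of x] smult_l_null[of x] smult_r_null[of p]
  by simp_all

lemma smult_carrier [simp, intro]: "x \<in> carrier N \<Longrightarrow> p \<odot> x \<in> carrier N"
  by (rule smult_simps)

lemma add_self [simp]: "x \<in> carrier N \<Longrightarrow> x \<oplus> x = \<zero>"
  using smult_simps(2)[of x 1 1] smult_simps(5,6)[of x] by simp

lemma add_self_left [simp]: "x \<in> carrier N \<Longrightarrow> y \<in> carrier N \<Longrightarrow> x \<oplus> (x \<oplus> y) = y"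
  by (simp add: M.a_assoc[symmetric])

lemma uminus_eq [simp]: "x \<in> carrier N \<Longrightarrow> \<ominus> x = x"
  using M.minus_equality[of x x] by simp

lemma minus_eq_add: "x \<in> carrier N \<Longrightarrow> y \<in> carrier N \<Longrightarrow> x \<ominus> y = x \<oplus> y"
  by (simp add: a_minus_def)

lemma add_eq_zero_iff: "x \<in> carrier N \<Longrightarrow> y \<in> carrier N \<Longrightarrow> x \<oplus> y = \<zero> \<longleftrightarrow> x = y"
  using M.minus_equality[of x y] by auto

lemma pow_Suc_smult: "x \<in> carrier N \<Longrightarrow> (U ^ Suc n) \<odot> x = U \<odot> ((U ^ n) \<odot> x)"
  by (simp only: power_Suc smult_simps)

lemma hpart_closed:
  "x \<in> hpart N k \<Longrightarrow> x \<in> carrier N" "\<zero> \<in> hpart N k"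
  "x \<in> hpart N k \<Longrightarrow> y \<in> hpart N k \<Longrightarrow> x \<oplus> y \<in> hpart N k"
  using subgroup.mem_carrier[OF hpart_subgroup] subgroup.one_closed[OF hpart_subgroup]
    subgroup.m_closed[OF hpart_subgroup]
  by auto

lemma hpart_U_pow: "x \<in> hpart N k \<Longrightarrow> (U ^ n) \<odot> x \<in> hpart N (k - 2 * int n)"
proof (induction n)
  case 0 then show ?case using smult_simps(5)[OF hpart_closed(1)[OF 0]] by simp
next
  case (Suc n)
  have "(U ^ Suc n) \<odot> x = U \<odot> ((U ^ n) \<odot> x)"
    using hpart_closed(1)[OF Suc.prems] by (rule pow_Suc_smult)
  moreover have "k - 2 * int (Suc n) = k - 2 * int n - 2" by simp
  ultimately show ?case using hpart_U[OF Suc.IH[OF Suc.prems]] by metis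
qed

text \<open>Horner's rule. With only two scalars it shows that an additive map commuting with
  \<open>U\<close> commutes with every polynomial, by induction along \<open>pCons\<close>.\<close>

lemma pCons_smult:
  assumes "x \<in> carrier N"
  shows "pCons a p \<odot> x = (if a = 0 then \<zero> else x) \<oplus> U \<odot> (p \<odot> x)"
proof -
  have "pCons a p = [:a:] + U * p" by simp
  then have "pCons a p \<odot> x = [:a:] \<odot> x \<oplus> U \<odot> (p \<odot> x)"
    by (metis assms smult_simps(2,4))
  moreover have "[:a:] \<odot> x = (if a = 0 then \<zero> else x)"
  proof (cases "a = 0")
    case False
    then have "[:a:] = 1" by (simp add: one_pCons)
    then show ?thesis using False assms smult_simps(5) by metis
  qed (simp add: assms smult_simps)
  ultimately show ?thesis by simp
qed

section \<open>Homogeneous components and maps defined by them\<close>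

definition hcomp :: "'a \<Rightarrow> int \<Rightarrow> 'a" where
  "hcomp x = (THE d. (\<forall>k. d k \<in> hpart N k) \<and> finite {k. d k \<noteq> \<zero>} \<and> x = (\<Oplus>k \<in> {k. d k \<noteq> \<zero>}. d k))"

lemma hcomp_props:
  assumes "x \<in> carrier N"
  shows "hcomp x k \<in> hpart N k" "finite {k. hcomp x k \<noteq> \<zero>}" "x = (\<Oplus>k \<in> {k. hcomp x k \<noteq> \<zero>}. hcomp x k)"
  using theI'[OF hpart_decomposition[OF assms]] unfolding hcomp_def by blast+

lemma hcomp_carrier [simp]: "x \<in> carrier N \<Longrightarrow> hcomp x k \<in> carrier N"
  using hcomp_props hpart_closed by blast

lemma finsum_support:
  assumes "finite S" "{k. d k \<noteq> \<zero>} \<subseteq> S" "\<And>k. d k \<in> carrier N"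
  shows "(\<Oplus>k \<in> {k. d k \<noteq> \<zero>}. d k) = (\<Oplus>k \<in> S. d k)"
  using assms by (intro M.add.finprod_mono_neutral_cong_left) auto

lemma hcomp_finsum:
  assumes "x \<in> carrier N" "finite S" "{k. hcomp x k \<noteq> \<zero>} \<subseteq> S"
  shows "x = (\<Oplus>k \<in> S. hcomp x k)"
  by (rule trans[OF hcomp_props(3)[OF assms(1)] finsum_support[OF assms(2,3)]]) (simp add: assms(1))

lemma hcomp_unique:
  assumes "\<And>k. d k \<in> hpart N k" "finite S" "\<And>k. k \<notin> S \<Longrightarrow> d k = \<zero>" "x = (\<Oplus>k \<in> S. d k)"
  shows "hcomp x = d"
proof -
  have c: "d k \<in> carrier N" for k using assms(1) hpart_closed by blast
  have fin: "{k. d k \<noteq> \<zero>} \<subseteq> S" using assms(3) by auto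
  have x: "x \<in> carrier N" using assms(4) c by auto
  have "(\<forall>k. d k \<in> hpart N k) \<and> finite {k. d k \<noteq> \<zero>} \<and> x = (\<Oplus>k \<in> {k. d k \<noteq> \<zero>}. d k)"
    using assms c finsum_support[OF assms(2) fin] finite_subset[OF fin] by auto
  then show ?thesis unfolding hcomp_def by (rule the1_equality[OF hpart_decomposition[OF x]])
qed

lemma hcomp_hom:
  assumes "x \<in> hpart N k" shows "hcomp x j = (if j = k then x else \<zero>)"
proof -
  have "hcomp x = (\<lambda>j. if j = k then x else \<zero>)"
    using assms hpart_closed by (intro hcomp_unique[where S = "{k}"]) auto
  then show ?thesis by simp
qed

lemma hcomp_add:
  assumes "x \<in> carrier N" "y \<in> carrier N"
  shows "hcomp (x \<oplus> y) k = hcomp x k \<oplus> hcomp y k"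
proof -
  let ?S = "{k. hcomp x k \<noteq> \<zero>} \<union> {k. hcomp y k \<noteq> \<zero>}"
  have fin: "finite ?S" using hcomp_props(2) assms by blast
  have "x \<oplus> y = (\<Oplus>k \<in> ?S. hcomp x k) \<oplus> (\<Oplus>k \<in> ?S. hcomp y k)"
    by (rule arg_cong2[OF hcomp_finsum[OF assms(1) fin] hcomp_finsum[OF assms(2) fin]]) auto
  also have "\<dots> = (\<Oplus>k \<in> ?S. hcomp x k \<oplus> hcomp y k)"
    using assms by (intro M.finsum_addf[symmetric]) auto
  finally have "x \<oplus> y = (\<Oplus>k \<in> ?S. hcomp x k \<oplus> hcomp y k)" .
  then have "hcomp (x \<oplus> y) = (\<lambda>k. hcomp x k \<oplus> hcomp y k)"
    using assms fin hcomp_props hpart_closed(3)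
    by (intro hcomp_unique[where S = ?S]) auto
  then show ?thesis by simp
qed

lemma hcomp_U:
  assumes "x \<in> carrier N"
  shows "hcomp (U \<odot> x) k = U \<odot> hcomp x (k + 2)"
proof -
  let ?S = "{k. hcomp x k \<noteq> \<zero>}"
  have fin: "finite ?S" using hcomp_props(2) assms by blast
  have "U \<odot> x = U \<odot> (\<Oplus>k \<in> ?S. hcomp x k)"
    by (rule arg_cong[OF hcomp_props(3)[OF assms]])
  also have "\<dots> = (\<Oplus>k \<in> ?S. U \<odot> hcomp x k)"
    using finsum_smult_ldistr[OF fin, of U "hcomp x"] assms by auto
  also have "\<dots> = (\<Oplus>k \<in> (\<lambda>j. j - 2) ` ?S. U \<odot> hcomp x (k + 2))"
    using assms by (subst M.finsum_reindex) (auto simp: inj_on_def)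
  finally have "hcomp (U \<odot> x) = (\<lambda>k. U \<odot> hcomp x (k + 2))"
  proof (intro hcomp_unique[where S = "(\<lambda>j. j - 2) ` ?S"])
    show "U \<odot> hcomp x (k + 2) \<in> hpart N k" for k
      using hpart_U[OF hcomp_props(1)[OF assms, of "k + 2"]] by simp
    fix k assume "k \<notin> (\<lambda>j. j - 2) ` ?S"
    then have "hcomp x (k + 2) = \<zero>" by (metis (mono_tags, lifting) add_diff_cancel_right' image_eqI mem_Collect_eq)
    then show "U \<odot> hcomp x (k + 2) = \<zero>" by (simp add: smult_simps)
  qed (use fin in auto)
  then show ?thesis by simp
qed

lemma homogeneous_induct [consumes 1, case_names homogeneous add]:
  assumes "x \<in> carrier N" and "\<And>k y. y \<in> hpart N k \<Longrightarrow> Q y"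
    and "\<And>y z. y \<in> carrier N \<Longrightarrow> z \<in> carrier N \<Longrightarrow> Q y \<Longrightarrow> Q z \<Longrightarrow> Q (y \<oplus> z)"
  shows "Q x"
proof -
  have "finite S \<Longrightarrow> Q (\<Oplus>k \<in> S. hcomp x k)" for S :: "int set"
  proof (induction set: finite)
    case empty then show ?case using assms(2)[OF hpart_closed(2)] by simp
  next
    case (insert k S)
    have "(\<Oplus>k \<in> insert k S. hcomp x k) = hcomp x k \<oplus> (\<Oplus>k \<in> S. hcomp x k)"
      using insert assms(1) by (intro M.finsum_insert) auto
    moreover have "(\<Oplus>k \<in> S. hcomp x k) \<in> carrier N"
      using assms(1) by (intro M.finsum_closed) auto
    ultimately show ?case
      using insert assms(1) assms(2)[OF hcomp_props(1)[OF assms(1)]]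
        assms(3)[OF hcomp_carrier[OF assms(1)]] by metis
  qed
  then show ?thesis by (subst hcomp_props(3)[OF assms(1)]) (use hcomp_props(2)[OF assms(1)] in blast)
qed

text \<open>The values on components are summed; compatibility with \<open>U\<close> spreads to all
  polynomials by \<open>pCons_smult\<close>. The degree is an argument of \<open>h\<close> because
  the maps needed later are built one degree at a time.\<close>

lemma graded_linear_extension:
  assumes hpart: "\<And>k x. x \<in> hpart N k \<Longrightarrow> h k x \<in> hpart N (k + e)"
    and add: "\<And>k x y. x \<in> hpart N k \<Longrightarrow> y \<in> hpart N k \<Longrightarrow> h k (x \<oplus> y) = h k x \<oplus> h k y"
    and U: "\<And>k x. x \<in> hpart N k \<Longrightarrow> h (k - 2) (U \<odot> x) = U \<odot> h k x"
  shows "\<exists>f. graded_linear e N N f \<and> (\<forall>k. \<forall>x \<in> hpart N k. f x = h k x)"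
proof -
  have hc: "h k x \<in> carrier N" if "x \<in> hpart N k" for k x
    using hpart[OF that] hpart_closed by blast
  have h0: "h k \<zero> = \<zero>" for k
    using add[OF hpart_closed(2) hpart_closed(2), of k] hc[OF hpart_closed(2)] by simp
  define f where "f = (\<lambda>x. \<Oplus>k \<in> {k. hcomp x k \<noteq> \<zero>}. h k (hcomp x k))"
  have f_eq: "f x = (\<Oplus>k \<in> S. h k (hcomp x k))"
    if "finite S" "{k. hcomp x k \<noteq> \<zero>} \<subseteq> S" "x \<in> carrier N" for x S
    unfolding f_def using that h0 hc hcomp_props(1)
    by (intro M.add.finprod_mono_neutral_cong_left) auto
  have fc: "f x \<in> carrier N" if "x \<in> carrier N" for x
    unfolding f_def using that hc hcomp_props(1) by (intro M.finsum_closed) auto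
  have fh: "f x = h k x" if "x \<in> hpart N k" for k x
  proof -
    have "f x = (\<Oplus>k \<in> {k}. h k (hcomp x k))"
      using that hpart_closed by (intro f_eq) (auto simp: hcomp_hom[OF that])
    then show ?thesis using hc[OF that] by (simp add: hcomp_hom[OF that])
  qed
  have fadd: "f (x \<oplus> y) = f x \<oplus> f y" if "x \<in> carrier N" "y \<in> carrier N" for x y
  proof -
    let ?S = "{k. hcomp x k \<noteq> \<zero>} \<union> {k. hcomp y k \<noteq> \<zero>}"
    have fin: "finite ?S" using hcomp_props(2) that by blast
    have "f (x \<oplus> y) = (\<Oplus>k \<in> ?S. h k (hcomp (x \<oplus> y) k))"
      using that fin by (intro f_eq) (auto simp: hcomp_add)
    also have "\<dots> = (\<Oplus>k \<in> ?S. h k (hcomp x k) \<oplus> h k (hcomp y k))"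
      using that hcomp_props(1) by (simp add: hcomp_add add)
    also have "\<dots> = (\<Oplus>k \<in> ?S. h k (hcomp x k)) \<oplus> (\<Oplus>k \<in> ?S. h k (hcomp y k))"
      using that hcomp_props(1) hc by (intro M.finsum_addf) auto
    finally show ?thesis using f_eq[OF fin] that by simp
  qed
  have fU: "f (U \<odot> x) = U \<odot> f x" if "x \<in> carrier N" for x
    using that
  proof (induction rule: homogeneous_induct)
    case (homogeneous k y)
    then show ?case using fh[OF hpart_U[OF homogeneous]] fh[OF homogeneous] U by simp
  next
    case (add y z) then show ?case using fadd fc by (simp add: smult_simps)
  qed
  have "f (p \<odot> x) = p \<odot> f x" if "x \<in> carrier N" for p x
  proof (induction p)
    case 0 then show ?case using that fc fh[OF hpart_closed(2)] h0 by (simp add: smult_simps)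
  next
    case (pCons a p)
    show ?case
      using pCons that fadd fc fU fh[OF hpart_closed(2)] h0
      by (simp add: pCons_smult[OF that, of a p] pCons_smult[OF fc[OF that], of a p])
  qed
  then have "graded_linear e N N f"
    unfolding graded_linear_def using fc fadd fh hpart by auto
  then show ?thesis using fh by blast
qed

end

text \<open>The consequences of freeness used from here on. Finiteness is where the two-element
  field enters; vanishing in high degrees starts the recursion in \<open>graded_section\<close>, and
  surjectivity of \<open>U\<close> in low degrees gives \<open>low_window\<close>.\<close>

locale finite_type_module = graded_FU_module +
  assumes finite_hpart: "finite (hpart N k)"
    and U_inj: "x \<in> carrier N \<Longrightarrow> U \<odot> x = \<zero> \<Longrightarrow> x = \<zero>"
    and hpart_bounded: "\<exists>K. \<forall>k > K. hpart N k = {\<zero>}"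
    and U_onto_low: "\<exists>K. \<forall>k \<le> K. \<forall>x \<in> hpart N (k - 2). \<exists>y \<in> hpart N k. x = U \<odot> y"

lemma ex1_unique: "\<exists>!a. P a \<Longrightarrow> P r \<Longrightarrow> P s \<Longrightarrow> r = s"
  by blast

text \<open>A basis element \<open>b\<close> of degree \<open>\<delta> b\<close> contributes to
  degree \<open>k\<close> at most one nonzero element \<open>t k b\<close>, its multiple by the
  appropriate power of \<open>U\<close>. Hence a homogeneous element of degree \<open>k\<close> is a
  subset sum of these, an element of \<open>Sp k\<close>, and all the claims can be read off from
  the \<open>t k b\<close>.\<close>

lemma (in graded_FU_module) finite_type_if_free:
  assumes "finitely_generated_free N"
  shows "finite_type_module N"
proof -
  obtain B where finB: "finite B" and homB: "B \<subseteq> (\<Union>k. hpart N k)"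
    and free': "\<forall>x \<in> carrier N. \<exists>!a. a \<in> extensional B \<and> x = (\<Oplus>b \<in> B. a b \<odot> b)"
    using assms unfolding finitely_generated_free_def by (elim exE conjE) (rule that)
  note free = bspec[OF free']
  have Bc: "b \<in> carrier N" if "b \<in> B" for b using that homB hpart_closed(1) by blast
  obtain \<delta> where \<delta>: "\<And>b. b \<in> B \<Longrightarrow> b \<in> hpart N (\<delta> b)" using homB by (metis UN_iff subsetD)
  have U_inj: "x = \<zero>" if x: "x \<in> carrier N" "U \<odot> x = \<zero>" for x
  proof -
    obtain a where a: "a \<in> extensional B" "x = (\<Oplus>b \<in> B. a b \<odot> b)" using ex1_implies_ex[OF free[OF x(1)]] by (elim exE conjE) (rule that)
    have "U \<odot> x = (\<Oplus>b \<in> B. U \<odot> (a b \<odot> b))"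
      unfolding a(2) using finsum_smult_ldistr[OF finB, of U "\<lambda>b. a b \<odot> b"] Bc by auto
    also have "\<dots> = (\<Oplus>b \<in> B. restrict (\<lambda>b. U * a b) B b \<odot> b)"
      using Bc by (intro M.finsum_cong') (auto simp: smult_simps(4) simp del: mult_pCons_left)
    finally have "\<zero> = (\<Oplus>b \<in> B. restrict (\<lambda>b. U * a b) B b \<odot> b)" using x(2) by simp
    moreover have "\<zero> = (\<Oplus>b \<in> B. restrict (\<lambda>b. 0) B b \<odot> b)"
      using Bc by (intro M.add.finprod_one_eqI[symmetric]) (auto simp: smult_simps)
    ultimately have "restrict (\<lambda>b. U * a b) B = restrict (\<lambda>b. 0) B"
      by (intro ex1_unique[OF free[OF M.zero_closed]] conjI restrict_extensional)
    from fun_cong[OF this] have a0: "a b = 0" if "b \<in> B" for b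
      using that by (metis (mono_tags, lifting) restrict_apply' mult_eq_0_iff pCons_eq_0_iff zero_neq_one)
    show ?thesis unfolding a(2)
      by (intro M.add.finprod_one_eqI) (simp add: Bc a0 smult_simps)
  qed
  define t where "t = (\<lambda>k b. if \<delta> b \<ge> k \<and> even (\<delta> b - k) then U ^ nat ((\<delta> b - k) div 2) \<odot> b else \<zero>)"
  define Sp where "Sp = (\<lambda>k. (\<lambda>c. \<Oplus>b \<in> B. c b) ` (\<Pi>\<^sub>E b \<in> B. {\<zero>, t k b}))"
  have tc: "t k b \<in> carrier N" if "b \<in> B" for k b using Bc[OF that] by (auto simp: t_def)
  have PiE_c: "c \<in> B \<rightarrow> carrier N" if "c \<in> (\<Pi>\<^sub>E b \<in> B. {\<zero>, t k b})" for c k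
  proof (rule Pi_I)
    fix b assume b: "b \<in> B"
    show "c b \<in> carrier N" using PiE_mem[OF that b] tc[OF b, of k] by auto
  qed
  have SpI: "(\<Oplus>b \<in> B. c b) \<in> Sp k" if "\<And>b. b \<in> B \<Longrightarrow> c b = \<zero> \<or> c b = t k b" for c k
  proof -
    have "(\<Oplus>b \<in> B. c b) = (\<Oplus>b \<in> B. restrict c B b)"
      using that tc by (intro M.finsum_cong') (auto, metis M.zero_closed)
    moreover have "restrict c B \<in> (\<Pi>\<^sub>E b \<in> B. {\<zero>, t k b})" using that by auto
    ultimately show ?thesis unfolding Sp_def by blast
  qed
  have SpE: "\<exists>c. x = (\<Oplus>b \<in> B. c b) \<and> (\<forall>b \<in> B. c b = \<zero> \<or> c b = t k b)" if "x \<in> Sp k" for x k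
    using that unfolding Sp_def by (auto simp: PiE_iff)
  have finSp: "finite (Sp k)" for k
    unfolding Sp_def using finB by (intro finite_imageI finite_PiE) auto
  have Sp_zero: "\<zero> \<in> Sp k" for k
    using SpI[of "\<lambda>b. \<zero>" k] by simp
  have coeff_c: "c \<in> B \<rightarrow> carrier N" if "\<forall>b \<in> B. c b = \<zero> \<or> c b = t k b" for c k
  proof (rule Pi_I)
    fix b assume b: "b \<in> B"
    show "c b \<in> carrier N" using bspec[OF that b] tc[OF b, of k] by auto
  qed
  have Sp_add: "x \<oplus> y \<in> Sp k" if xy: "x \<in> Sp k" "y \<in> Sp k" for x y k
  proof -
    obtain c where c: "x = (\<Oplus>b \<in> B. c b)" "\<forall>b \<in> B. c b = \<zero> \<or> c b = t k b"
      using SpE[OF xy(1)] by (elim exE conjE) (rule that)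
    obtain d where d: "y = (\<Oplus>b \<in> B. d b)" "\<forall>b \<in> B. d b = \<zero> \<or> d b = t k b"
      using SpE[OF xy(2)] by (elim exE conjE) (rule that)
    have "x \<oplus> y = (\<Oplus>b \<in> B. c b \<oplus> d b)"
      unfolding c(1) d(1) by (intro M.finsum_addf[symmetric] coeff_c[OF c(2)] coeff_c[OF d(2)])
    also have "\<dots> \<in> Sp k"
    proof (rule SpI)
      fix b assume b: "b \<in> B"
      then show "c b \<oplus> d b = \<zero> \<or> c b \<oplus> d b = t k b"
        using bspec[OF c(2) b] bspec[OF d(2) b] tc[OF b, of k] by auto
    qed
    finally show ?thesis .
  qed
  \<comment> \<open>The hypothesis excludes in particular \<open>\<delta> b = k - 2\<close>, where
    \<open>t (k - 2) b\<close> is \<open>b\<close> itself while \<open>t k b\<close> is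
    zero.\<close>
  have t_U: "t (k - 2) b = U \<odot> t k b" if b: "b \<in> B" and "\<delta> b \<ge> k \<or> odd (\<delta> b - k)" for k b
  proof (cases "even (\<delta> b - k)")
    case True
    then have "nat ((\<delta> b - (k - 2)) div 2) = Suc (nat ((\<delta> b - k) div 2))" "\<delta> b \<ge> k"
      using that(2) by (auto elim!: evenE)
    then show ?thesis
      using True pow_Suc_smult[OF Bc[OF b]] by (simp add: t_def del: power_Suc)
  next
    case False then show ?thesis by (simp add: t_def smult_simps)
  qed
  have U_sum: "U \<odot> (\<Oplus>b \<in> B. c b) = (\<Oplus>b \<in> B. U \<odot> c b)" if "c \<in> B \<rightarrow> carrier N" for c
    using finsum_smult_ldistr[OF finB, of U c] that by auto
  have Sp_U: "U \<odot> x \<in> Sp (k - 2)" if x: "x \<in> Sp k" for x k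
  proof -
    obtain c where c: "x = (\<Oplus>b \<in> B. c b)" "\<forall>b \<in> B. c b = \<zero> \<or> c b = t k b"
      using SpE[OF x] by (elim exE conjE) (rule that)
    have cc: "c \<in> B \<rightarrow> carrier N" by (rule coeff_c[OF c(2)])
    have "U \<odot> c b = \<zero> \<or> U \<odot> c b = t (k - 2) b" if b: "b \<in> B" for b
    proof (cases "\<delta> b \<ge> k \<or> odd (\<delta> b - k)")
      case True then show ?thesis using bspec[OF c(2) b] t_U[OF b] by (auto simp: smult_simps)
    next
      case False
      then have "t k b = \<zero>" by (auto simp: t_def)
      then show ?thesis using bspec[OF c(2) b] by (auto simp: smult_simps)
    qed
    then show ?thesis unfolding c(1) U_sum[OF cc] by (intro SpI) auto
  qed
  have Sp_B: "b \<in> Sp (\<delta> b)" if b: "b \<in> B" for b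
  proof -
    have "t (\<delta> b) b = b" using Bc[OF b] by (simp add: t_def smult_simps)
    then have "(\<Oplus>b' \<in> B. if b = b' then b' else \<zero>) \<in> Sp (\<delta> b)" by (intro SpI) auto
    then show ?thesis using M.finsum_singleton[OF b finB, of "\<lambda>b. b"] Bc by auto
  qed
  \<comment> \<open>The coefficients in a basis expansion are not known to be homogeneous, so the
    claim is proved for every component of every element; a homogeneous element is then its own
    component.\<close>
  have comp_Sp: "\<forall>k. hcomp x k \<in> Sp k" if "x \<in> carrier N" for x
  proof -
    have zero: "hcomp \<zero> k = \<zero>" for k using hcomp_hom[OF hpart_closed(2)[of 0]] by simp
    have gen: "\<forall>k. hcomp (p \<odot> b) k \<in> Sp k" if b: "b \<in> B" for p b
    proof (induction p)
      case 0 then show ?case by (simp add: smult_simps Bc[OF b] zero Sp_zero)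
    next
      case (pCons a p)
      have 1: "hcomp (U \<odot> (p \<odot> b)) k \<in> Sp k" for k
        using Sp_U[of "hcomp (p \<odot> b) (k + 2)" "k + 2"] pCons Bc[OF b] by (simp add: hcomp_U)
      have "hcomp b k \<in> Sp k" for k using hcomp_hom[OF \<delta>[OF b]] Sp_B[OF b] Sp_zero by simp
      then show ?case using 1 Bc[OF b] by (simp add: pCons_smult[OF Bc[OF b], of a p] hcomp_add Sp_add zero Sp_zero)
    qed
    obtain a where a: "x = (\<Oplus>b \<in> B. a b \<odot> b)"
      using ex1_implies_ex[OF free[OF \<open>x \<in> carrier N\<close>]] by (elim exE conjE) (rule that)
    have "\<forall>k. hcomp (\<Oplus>b \<in> F. a b \<odot> b) k \<in> Sp k" if "finite F" "F \<subseteq> B" for F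
      using that
    proof (induction set: finite)
      case empty then show ?case by (simp add: zero Sp_zero)
    next
      case (insert b F)
      have "(\<Oplus>b \<in> insert b F. a b \<odot> b) = a b \<odot> b \<oplus> (\<Oplus>b \<in> F. a b \<odot> b)"
        using insert Bc by (intro M.finsum_insert) auto
      moreover have "(\<Oplus>b \<in> F. a b \<odot> b) \<in> carrier N" "a b \<odot> b \<in> carrier N"
        using insert Bc by (auto intro!: M.finsum_closed)
      moreover have "\<forall>k. hcomp (\<Oplus>b \<in> F. a b \<odot> b) k \<in> Sp k" "\<forall>k. hcomp (a b \<odot> b) k \<in> Sp k"
        using insert gen by auto
      ultimately show ?case by (auto simp: hcomp_add intro!: Sp_add)
    qed
    then show ?thesis using a finB by blast
  qed
  have hpart_Sp: "x \<in> Sp k" if "x \<in> hpart N k" for x k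
    using comp_Sp[OF hpart_closed(1)[OF that]] hcomp_hom[OF that] by (metis (full_types))
  show ?thesis
  proof
    show "finite (hpart N k)" for k using finSp hpart_Sp finite_subset by (metis subsetI)
    show "x \<in> carrier N \<Longrightarrow> U \<odot> x = \<zero> \<Longrightarrow> x = \<zero>" for x by (rule U_inj)
    show "\<exists>K. \<forall>k > K. hpart N k = {\<zero>}"
    proof (intro exI allI impI)
      \<comment> \<open>The inserted \<open>0\<close> keeps the set nonempty when the basis is
        empty.\<close>
      fix k assume k: "k > Max (insert 0 (\<delta> ` B))"
      have "\<delta> b < k" if "b \<in> B" for b
        using k that finB Max_ge[of "insert 0 (\<delta> ` B)" "\<delta> b"] by fastforce
      then have t: "t k b = \<zero>" if "b \<in> B" for b using that by (force simp: t_def)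
      have "x = \<zero>" if x: "x \<in> Sp k" for x
      proof -
        obtain c where c: "x = (\<Oplus>b \<in> B. c b)" "\<forall>b \<in> B. c b = \<zero> \<or> c b = t k b"
      using SpE[OF x] by (elim exE conjE) (rule that)
        then show ?thesis using t by (auto intro!: M.add.finprod_one_eqI)
      qed
      then show "hpart N k = {\<zero>}" using hpart_Sp hpart_closed(2) by blast
    qed
    show "\<exists>K. \<forall>k \<le> K. \<forall>x \<in> hpart N (k - 2). \<exists>y \<in> hpart N k. x = U \<odot> y"
    proof (intro exI allI impI ballI)
      fix k x assume k: "k \<le> Min (insert 0 (\<delta> ` B))" and x: "x \<in> hpart N (k - 2)"
      have \<delta>k: "\<delta> b \<ge> k" if "b \<in> B" for b
        using k that finB Min_le[of "insert 0 (\<delta> ` B)" "\<delta> b"] by fastforce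
      obtain c where c: "x = (\<Oplus>b \<in> B. c b)" "\<forall>b \<in> B. c b = \<zero> \<or> c b = t (k - 2) b"
        using SpE[OF hpart_Sp[OF x]] by (elim exE conjE) (rule that)
      define d where "d = (\<lambda>b. if c b = \<zero> then \<zero> else t k b)"
      have dc: "d \<in> B \<rightarrow> carrier N" using tc by (auto simp: d_def)
      have "U \<odot> d b = c b" if b: "b \<in> B" for b
        using bspec[OF c(2) b] t_U[OF b] \<delta>k[OF b] by (auto simp: d_def smult_simps)
      then have "x = U \<odot> (\<Oplus>b \<in> B. d b)"
        unfolding U_sum[OF dc] c(1) using dc by (intro M.finsum_cong') auto
      moreover have dh: "d b \<in> hpart N k" if b: "b \<in> B" for b
        using hpart_U_pow[OF \<delta>[OF b], of "nat ((\<delta> b - k) div 2)"] \<delta>k[OF b] hpart_closed(2)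
        by (auto simp: d_def t_def)
      have "(\<Oplus>b \<in> F. d b) \<in> hpart N k" if "F \<subseteq> B" for F
        using finite_subset[OF that finB] that
      proof (induction set: finite)
        case empty then show ?case using hpart_closed(2) by simp
      next
        case (insert b F)
        have "(\<Oplus>b \<in> insert b F. d b) = d b \<oplus> (\<Oplus>b \<in> F. d b)"
          using insert dc by (intro M.finsum_insert) auto
        then show ?case using insert hpart_closed(3) dh by auto
      qed
      ultimately show "\<exists>y \<in> hpart N k. x = U \<odot> y" by blast
    qed
  qed
qed

lemma graded_linearD:
  assumes "graded_linear e N N' f"
  shows "x \<in> carrier N \<Longrightarrow> f x \<in> carrier N'"
    and "x \<in> carrier N \<Longrightarrow> y \<in> carrier N \<Longrightarrow> f (x \<oplus>\<^bsub>N\<^esub> y) = f x \<oplus>\<^bsub>N'\<^esub> f y"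
    and "x \<in> carrier N \<Longrightarrow> f (p \<odot>\<^bsub>N\<^esub> x) = p \<odot>\<^bsub>N'\<^esub> f x"
    and "x \<in> hpart N k \<Longrightarrow> f x \<in> hpart N' (k + e)"
  using assms unfolding graded_linear_def by auto

context graded_FU_module
begin

lemma graded_linear_zero:
  assumes "graded_linear e N N f" shows "f \<zero> = \<zero>"
proof -
  have "f (0 \<odot> \<zero>) = 0 \<odot> f \<zero>" using graded_linearD(3)[OF assms M.zero_closed] .
  then show ?thesis using graded_linearD(1)[OF assms M.zero_closed] by (simp add: smult_simps)
qed

lemma hcomp_graded_linear:
  assumes f: "graded_linear e N N f" and "x \<in> carrier N"
  shows "hcomp (f x) (k + e) = f (hcomp x k)"
  using assms(2)
proof (induction rule: homogeneous_induct)
  case (homogeneous j y)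
  then show ?case
    using hcomp_hom[OF homogeneous] hcomp_hom[OF graded_linearD(4)[OF f homogeneous]]
      graded_linear_zero[OF f] by simp
next
  case (add y z)
  then show ?case by (simp add: graded_linearD[OF f] hcomp_add)
qed

text \<open>A linear map of degree \<open>e\<close> on a graded submodule that is given only by its
  homogeneous parts \<open>D k\<close>. Sections and lifts are needed on cycles and on boundaries,
  and this form avoids making those into modules of their own.\<close>

definition graded_family :: "(int \<Rightarrow> 'a set) \<Rightarrow> int \<Rightarrow> (int \<Rightarrow> 'a \<Rightarrow> 'a) \<Rightarrow> bool" where
  "graded_family D e h \<longleftrightarrow>
    (\<forall>k. \<forall>x \<in> D k. h k x \<in> hpart N (k + e)) \<and>
    (\<forall>k. \<forall>x \<in> D k. \<forall>y \<in> D k. h k (x \<oplus> y) = h k x \<oplus> h k y) \<and>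
    (\<forall>k. \<forall>x \<in> D k. h (k - 2) (U \<odot> x) = U \<odot> h k x)"

lemma graded_familyD:
  assumes "graded_family D e h"
  shows "x \<in> D k \<Longrightarrow> h k x \<in> hpart N (k + e)"
    and "x \<in> D k \<Longrightarrow> h k x \<in> carrier N"
    and "x \<in> D k \<Longrightarrow> y \<in> D k \<Longrightarrow> h k (x \<oplus> y) = h k x \<oplus> h k y"
    and "x \<in> D k \<Longrightarrow> h (k - 2) (U \<odot> x) = U \<odot> h k x"
    and "\<zero> \<in> D k \<Longrightarrow> h k \<zero> = \<zero>"
proof -
  show 1: "x \<in> D k \<Longrightarrow> h k x \<in> hpart N (k + e)" and 3: "x \<in> D k \<Longrightarrow> y \<in> D k \<Longrightarrow> h k (x \<oplus> y) = h k x \<oplus> h k y"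
    and "x \<in> D k \<Longrightarrow> h (k - 2) (U \<odot> x) = U \<odot> h k x" for x y k
    using assms unfolding graded_family_def by simp_all
  show 2: "x \<in> D k \<Longrightarrow> h k x \<in> carrier N" for x k using 1 hpart_closed(1) by blast
  show "\<zero> \<in> D k \<Longrightarrow> h k \<zero> = \<zero>" using 3[of \<zero> k \<zero>] 2[of \<zero> k] by simp
qed

lemma graded_family_mono:
  assumes "graded_family D e h" "\<And>k. D' k \<subseteq> D k" shows "graded_family D' e h"
  using assms unfolding graded_family_def by (meson subsetD)

lemma graded_family_linear:
  assumes f: "graded_linear 0 N N f" and s: "graded_family D e s"
  shows "graded_family D e (\<lambda>k x. f (s k x))"
  unfolding graded_family_def
  using graded_linearD[OF f] graded_familyD[OF s] by (metis add.right_neutral)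

lemma graded_family_add:
  assumes g: "graded_family D e g" and h: "graded_family D e h"
  shows "graded_family D e (\<lambda>k x. g k x \<oplus> h k x)"
  unfolding graded_family_def
  using graded_familyD[OF g] graded_familyD[OF h] hpart_closed(3)
  by (simp add: smult_simps(3) M.a_ac)

definition graded_subgroup :: "(int \<Rightarrow> 'a set) \<Rightarrow> bool" where
  "graded_subgroup D \<longleftrightarrow> (\<forall>k. D k \<subseteq> hpart N k \<and> \<zero> \<in> D k \<and>
    (\<forall>x \<in> D k. \<forall>y \<in> D k. x \<oplus> y \<in> D k) \<and> (\<forall>x \<in> D k. U \<odot> x \<in> D (k - 2)))"

end

section \<open>Sections of surjections onto graded submodules\<close>

context finite_type_module
begin

text \<open>Partial additive maps are kept as graphs, so that extending a map means enlarging a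
  subset of a finite relation.\<close>

definition additive_graph :: "('a \<times> 'a) set \<Rightarrow> bool" where
  "additive_graph \<Gamma> \<longleftrightarrow> (\<zero>, \<zero>) \<in> \<Gamma> \<and> single_valued \<Gamma> \<and>
    (\<forall>x y x' y'. (x, y) \<in> \<Gamma> \<longrightarrow> (x', y') \<in> \<Gamma> \<longrightarrow> (x \<oplus> x', y \<oplus> y') \<in> \<Gamma>)"

text \<open>\<open>R\<close> is finite, so there is a maximal additive graph between \<Gamma>0 and
  \<open>R\<close>. If it missed a point \<open>x\<close> of the domain of \<open>R\<close>, it
  could be enlarged by any pair \<open>(x, y)\<close> of \<open>R\<close>.\<close>

lemma additive_graph_extend:
  assumes R: "R \<subseteq> hpart N k \<times> hpart N l"
    and R_add: "\<And>x y x' y'. (x, y) \<in> R \<Longrightarrow> (x', y') \<in> R \<Longrightarrow> (x \<oplus> x', y \<oplus> y') \<in> R"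
    and \<Gamma>0: "additive_graph \<Gamma>0" "\<Gamma>0 \<subseteq> R"
  shows "\<exists>\<Gamma>. additive_graph \<Gamma> \<and> \<Gamma>0 \<subseteq> \<Gamma> \<and> \<Gamma> \<subseteq> R \<and> Domain \<Gamma> = Domain R"
proof -
  let ?X = "{\<Gamma>. additive_graph \<Gamma> \<and> \<Gamma> \<subseteq> R}"
  have "finite R" using finite_subset[OF R] finite_hpart by blast
  then have "finite ?X" by simp
  moreover have "\<Gamma>0 \<in> ?X" using \<Gamma>0 by simp
  ultimately have "\<exists>\<Gamma> \<in> ?X. \<Gamma>0 \<subseteq> \<Gamma> \<and> (\<forall>\<Gamma>' \<in> ?X. \<Gamma> \<subseteq> \<Gamma>' \<longrightarrow> \<Gamma> = \<Gamma>')"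
    by (rule finite_has_maximal2)
  then obtain \<Gamma> where \<Gamma>: "\<Gamma> \<in> ?X" "\<Gamma>0 \<subseteq> \<Gamma>" and max: "\<forall>\<Gamma>' \<in> ?X. \<Gamma> \<subseteq> \<Gamma>' \<longrightarrow> \<Gamma> = \<Gamma>'"
    by (elim bexE conjE) (rule that)
  have c: "x \<in> carrier N \<and> y \<in> carrier N" if "(x, y) \<in> R" for x y
    using subsetD[OF R that] by (auto intro: hpart_closed(1))
  have g0: "(\<zero>, \<zero>) \<in> \<Gamma>" and gR: "\<And>p. p \<in> \<Gamma> \<Longrightarrow> p \<in> R"
    and gsv: "\<And>x y z. (x, y) \<in> \<Gamma> \<Longrightarrow> (x, z) \<in> \<Gamma> \<Longrightarrow> y = z"
    and gadd: "\<And>x y x' y'. (x, y) \<in> \<Gamma> \<Longrightarrow> (x', y') \<in> \<Gamma> \<Longrightarrow> (x \<oplus> x', y \<oplus> y') \<in> \<Gamma>"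
    using \<Gamma> unfolding additive_graph_def single_valued_def by blast+
  have "x \<in> Domain \<Gamma>" if xy: "(x, y) \<in> R" for x y
  proof (rule ccontr)
    assume nx: "x \<notin> Domain \<Gamma>"
    \<comment> \<open>In characteristic two the domain and \<open>x\<close> generate a group made of
      just two cosets, so a single translate suffices. The fact \<open>notin\<close> below says that
      the two cosets are disjoint.\<close>
    define \<Gamma>' where "\<Gamma>' = \<Gamma> \<union> (\<lambda>(v, w). (v \<oplus> x, w \<oplus> y)) ` \<Gamma>"
    have xc: "x \<in> carrier N" "y \<in> carrier N" using c xy by auto
    have gc: "v \<in> carrier N" "w \<in> carrier N" if "(v, w) \<in> \<Gamma>" for v w using c gR that by blast+
    have mem: "(v, w) \<in> \<Gamma>' \<longleftrightarrow> (v, w) \<in> \<Gamma> \<or> (\<exists>v' w'. (v', w') \<in> \<Gamma> \<and> v = v' \<oplus> x \<and> w = w' \<oplus> y)" for v w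
      unfolding \<Gamma>'_def by force
    have notin: "(v \<oplus> x, u) \<notin> \<Gamma>" if v: "(v, w) \<in> \<Gamma>" for v w u
    proof
      assume u: "(v \<oplus> x, u) \<in> \<Gamma>"
      have "(v \<oplus> (v \<oplus> x), w \<oplus> u) \<in> \<Gamma>" using gadd v u by blast
      then show False using nx gc(1)[OF v] xc by auto
    qed
    have "\<Gamma>' \<in> ?X"
    proof (intro CollectI conjI)
      show "\<Gamma>' \<subseteq> R" using gR R_add xy unfolding \<Gamma>'_def by auto
      show "additive_graph \<Gamma>'"
        unfolding additive_graph_def
      proof (intro conjI allI impI)
        show "(\<zero>, \<zero>) \<in> \<Gamma>'" using g0 mem by blast
        show "single_valued \<Gamma>'"
        proof (rule single_valuedI)
          fix v w w' assume "(v, w) \<in> \<Gamma>'" "(v, w') \<in> \<Gamma>'"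
          then consider "(v, w) \<in> \<Gamma>" "(v, w') \<in> \<Gamma>"
            | a b where "(v, w) \<in> \<Gamma>" "(a, b) \<in> \<Gamma>" "v = a \<oplus> x"
            | a b where "(v, w') \<in> \<Gamma>" "(a, b) \<in> \<Gamma>" "v = a \<oplus> x"
            | a b a' b' where "(a, b) \<in> \<Gamma>" "(a', b') \<in> \<Gamma>" "v = a \<oplus> x" "v = a' \<oplus> x"
              "w = b \<oplus> y" "w' = b' \<oplus> y"
            unfolding mem by blast
          then show "w = w'"
          proof cases
            case 4
            then have "a = a'" using gc xc by auto
            then show ?thesis using 4 gsv by blast
          qed (use gsv notin in blast)+
        qed
        fix v w v' w' assume "(v, w) \<in> \<Gamma>'" "(v', w') \<in> \<Gamma>'"
        then consider "(v, w) \<in> \<Gamma>" "(v', w') \<in> \<Gamma>"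
          | a b where "(v, w) \<in> \<Gamma>" "(a, b) \<in> \<Gamma>" "v' = a \<oplus> x" "w' = b \<oplus> y"
          | a b where "(v', w') \<in> \<Gamma>" "(a, b) \<in> \<Gamma>" "v = a \<oplus> x" "w = b \<oplus> y"
          | a b a' b' where "(a, b) \<in> \<Gamma>" "(a', b') \<in> \<Gamma>" "v = a \<oplus> x" "w = b \<oplus> y"
              "v' = a' \<oplus> x" "w' = b' \<oplus> y"
          unfolding mem by blast
        then show "(v \<oplus> v', w \<oplus> w') \<in> \<Gamma>'"
        proof cases
          case 1 then show ?thesis using gadd mem by blast
        next
          case 2
          then have "(v \<oplus> a, w \<oplus> b) \<in> \<Gamma>" using gadd by blast
          moreover have "v \<oplus> v' = (v \<oplus> a) \<oplus> x" "w \<oplus> w' = (w \<oplus> b) \<oplus> y"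
            using 2 gc xc by (simp_all add: M.a_assoc)
          ultimately show ?thesis unfolding mem by blast
        next
          case 3
          then have "(v' \<oplus> a, w' \<oplus> b) \<in> \<Gamma>" using gadd by blast
          moreover have "v \<oplus> v' = (v' \<oplus> a) \<oplus> x" "w \<oplus> w' = (w' \<oplus> b) \<oplus> y"
            using 3 gc xc by (simp_all add: M.a_ac)
          ultimately show ?thesis unfolding mem by blast
        next
          case 4
          then have "(a \<oplus> a', b \<oplus> b') \<in> \<Gamma>" using gadd by blast
          moreover have "v \<oplus> v' = a \<oplus> a'" "w \<oplus> w' = b \<oplus> b'"
            using 4 gc xc by (simp_all add: M.a_ac)
          ultimately show ?thesis unfolding mem by simp
        qed
      qed
    qed
    moreover have "\<Gamma> \<subseteq> \<Gamma>'" unfolding \<Gamma>'_def by blast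
    ultimately have "\<Gamma> = \<Gamma>'" using max by (metis (no_types, lifting))
    moreover have "(x, y) \<in> \<Gamma>'"
      unfolding mem using g0 xc by (intro disjI2 exI[of _ \<zero>]) auto
    ultimately show False using nx by blast
  qed
  then have "Domain \<Gamma> = Domain R" using gR by blast
  then show ?thesis using \<Gamma> by blast
qed

text \<open>Projectivity of graded submodules of \<open>N\<close>: a surjection onto such a submodule, encoded as a
  relation, has a graded linear section. It is built downwards in the degree, where injectivity
  of \<open>U\<close> makes the values on \<open>U\<close>-multiples consistent.\<close>

lemma graded_section:
  fixes R :: "int \<Rightarrow> ('a \<times> 'a) set"
  assumes R: "\<And>k. R k \<subseteq> hpart N k \<times> hpart N (k + e)"
    and R_zero: "\<And>k. (\<zero>, \<zero>) \<in> R k"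
    and R_add: "\<And>k x y x' y'. (x, y) \<in> R k \<Longrightarrow> (x', y') \<in> R k \<Longrightarrow> (x \<oplus> x', y \<oplus> y') \<in> R k"
    and R_U: "\<And>k x y. (x, y) \<in> R k \<Longrightarrow> (U \<odot> x, U \<odot> y) \<in> R (k - 2)"
  shows "\<exists>h. graded_family (\<lambda>k. Domain (R k)) e h \<and> (\<forall>k. \<forall>x \<in> Domain (R k). (x, h k x) \<in> R k)"
proof -
  obtain K where K: "\<And>k. k > K \<Longrightarrow> hpart N k = {\<zero>}" using hpart_bounded by blast
  define good where "good = (\<lambda>k \<Gamma>. additive_graph \<Gamma> \<and> \<Gamma> \<subseteq> R k \<and> Domain \<Gamma> = Domain (R k))"
  define UU where "UU = (\<lambda>\<Gamma>. map_prod (module.smult N U) (module.smult N U) ` (\<Gamma> :: ('a \<times> 'a) set))"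
  have Rc: "x \<in> carrier N \<and> y \<in> carrier N" if "(x, y) \<in> R k" for x y k
    using subsetD[OF R that] by (auto intro: hpart_closed(1))
  have triv: "additive_graph {(\<zero>, \<zero>)}" by (auto simp: additive_graph_def single_valued_def)
  have ex_good: "\<exists>\<Gamma>. good k \<Gamma>" for k
    using additive_graph_extend[OF R[of k] R_add[of _ _ k] triv] R_zero unfolding good_def by blast
  have ex_good_UU: "\<exists>\<Gamma>. good (k - 2) \<Gamma> \<and> UU \<Delta> \<subseteq> \<Gamma>" if \<Delta>: "good k \<Delta>" for k \<Delta>
  proof -
    have dR: "p \<in> R k" if "p \<in> \<Delta>" for p using that \<Delta> unfolding good_def by blast
    have ag: "additive_graph \<Delta>" using \<Delta> unfolding good_def by blast
    have mem: "p \<in> UU \<Delta> \<longleftrightarrow> (\<exists>x y. (x, y) \<in> \<Delta> \<and> p = (U \<odot> x, U \<odot> y))" for p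
      unfolding UU_def by (auto simp: image_iff Bex_def)
    have "additive_graph (UU \<Delta>)"
      unfolding additive_graph_def
    proof (intro conjI allI impI)
      show "(\<zero>, \<zero>) \<in> UU \<Delta>"
        unfolding mem using ag smult_simps(7) unfolding additive_graph_def by (metis)
      show "single_valued (UU \<Delta>)"
      proof (rule single_valuedI)
        fix a b b' assume "(a, b) \<in> UU \<Delta>" "(a, b') \<in> UU \<Delta>"
        then obtain x y x' y' where *: "(x, y) \<in> \<Delta>" "(x', y') \<in> \<Delta>"
          "a = U \<odot> x" "b = U \<odot> y" "a = U \<odot> x'" "b' = U \<odot> y'"
          unfolding mem by blast
        have xc: "x \<in> carrier N" "x' \<in> carrier N" using Rc dR * by blast+
        have "U \<odot> (x \<oplus> x') = \<zero>" using * xc smult_simps(3)[OF xc, of U] by simp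
        then have "x = x'" using U_inj[of "x \<oplus> x'"] xc add_eq_zero_iff[OF xc] by simp
        then show "b = b'" using * ag unfolding additive_graph_def single_valued_def by blast
      qed
      fix a b a' b' assume "(a, b) \<in> UU \<Delta>" "(a', b') \<in> UU \<Delta>"
      then obtain x y x' y' where *: "(x, y) \<in> \<Delta>" "(x', y') \<in> \<Delta>"
        "a = U \<odot> x" "b = U \<odot> y" "a' = U \<odot> x'" "b' = U \<odot> y'"
        unfolding mem by blast
      have "(x \<oplus> x', y \<oplus> y') \<in> \<Delta>" using * ag unfolding additive_graph_def by blast
      moreover have "a \<oplus> a' = U \<odot> (x \<oplus> x')" "b \<oplus> b' = U \<odot> (y \<oplus> y')"
        using * Rc[OF dR[OF *(1)]] Rc[OF dR[OF *(2)]] smult_simps(3) by auto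
      ultimately show "(a \<oplus> a', b \<oplus> b') \<in> UU \<Delta>" unfolding mem by blast
    qed
    moreover have "UU \<Delta> \<subseteq> R (k - 2)" using dR R_U unfolding UU_def by auto
    ultimately show ?thesis
      using additive_graph_extend[OF R[of "k - 2"] R_add[of _ _ "k - 2"], of "UU \<Delta>"]
      unfolding good_def by blast
  qed
  \<comment> \<open>The recursion descends by one degree but \<open>U\<close> lowers degrees by two,
    so the state consists of the graphs in two consecutive degrees. The new graph has to extend the
    \<open>U\<close>-image of the older one.\<close>
  have "\<exists>F. \<forall>n. (case F n of (\<Gamma>, \<Gamma>') \<Rightarrow> good (K - int n) \<Gamma> \<and> good (K - int n - 1) \<Gamma>') \<and>
      snd (F n) = fst (F (Suc n)) \<and> UU (fst (F n)) \<subseteq> snd (F (Suc n))"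
  proof (intro dependent_nat_choice)
    show "\<exists>p. case p of (\<Gamma>, \<Gamma>') \<Rightarrow> good (K - int 0) \<Gamma> \<and> good (K - int 0 - 1) \<Gamma>'"
      using ex_good by auto
    fix p n assume "case p of (\<Gamma>, \<Gamma>') \<Rightarrow> good (K - int n) \<Gamma> \<and> good (K - int n - 1) \<Gamma>'"
    then obtain \<Gamma> \<Gamma>' where p: "p = (\<Gamma>, \<Gamma>')" "good (K - int n) \<Gamma>" "good (K - int n - 1) \<Gamma>'" by auto
    obtain \<Gamma>'' where \<Gamma>'': "good (K - int n - 2) \<Gamma>''" "UU \<Gamma> \<subseteq> \<Gamma>''"
      using ex_good_UU[OF p(2)] by (elim exE conjE) (rule that)
    have eq: "K - int n - 2 = K - int (Suc n) - 1" "K - int n - 1 = K - int (Suc n)" by auto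
    show "\<exists>q. (case q of (\<Gamma>, \<Gamma>') \<Rightarrow> good (K - int (Suc n)) \<Gamma> \<and> good (K - int (Suc n) - 1) \<Gamma>') \<and>
      snd p = fst q \<and> UU (fst p) \<subseteq> snd q"
      using \<Gamma>'' p(3) unfolding eq p(1)
      by (intro exI[of _ "(\<Gamma>', \<Gamma>'')"]) (simp only: prod.case fst_conv snd_conv simp_thms)
  qed
  then obtain F where F': "\<forall>n. (case F n of (\<Gamma>, \<Gamma>') \<Rightarrow> good (K - int n) \<Gamma> \<and> good (K - int n - 1) \<Gamma>') \<and>
      snd (F n) = fst (F (Suc n)) \<and> UU (fst (F n)) \<subseteq> snd (F (Suc n))"
    by (elim exE) (rule that)
  have F: "good (K - int n) (fst (F n))" "snd (F n) = fst (F (Suc n))"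
    "UU (fst (F n)) \<subseteq> snd (F (Suc n))" for n
    using spec[OF F', of n] by (simp_all add: case_prod_beta)
  define G where "G = (\<lambda>k. if k > K then {(\<zero>, \<zero>)} else fst (F (nat (K - k))))"
  have goodG: "good k (G k)" for k
  proof (cases "k > K")
    case True
    then have "R k \<subseteq> {\<zero>} \<times> hpart N (k + e)" using R K by metis
    then have "Domain (R k) = {\<zero>}" using R_zero[of k] by auto
    then show ?thesis using True triv R_zero by (auto simp: good_def G_def)
  next
    case False
    then show ?thesis using F(1)[of "nat (K - k)"] by (simp add: G_def)
  qed
  have GU: "UU (G k) \<subseteq> G (k - 2)" for k
  proof (cases "k > K")
    case True
    have "(\<zero>, \<zero>) \<in> G (k - 2)" using goodG[of "k - 2"] by (simp add: good_def additive_graph_def)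
    then show ?thesis using True by (simp add: UU_def G_def smult_simps)
  next
    case False
    then have "nat (K - (k - 2)) = Suc (Suc (nat (K - k)))" by auto
    then show ?thesis using False F(2)[of "Suc (nat (K - k))"] F(3)[of "nat (K - k)"]
      by (simp add: G_def)
  qed
  define h where "h = (\<lambda>k x. THE y. (x, y) \<in> G k)"
  have sv: "h k x = y" if "(x, y) \<in> G k" for k x y
  proof -
    have "single_valued (G k)" using goodG[of k] by (simp add: good_def additive_graph_def)
    then show ?thesis unfolding h_def using that by (auto intro!: the_equality dest: single_valuedD)
  qed
  have hG: "(x, h k x) \<in> G k" if "x \<in> Domain (R k)" for k x
  proof -
    have "x \<in> Domain (G k)" using that goodG[of k] by (simp add: good_def)
    then obtain y where y: "(x, y) \<in> G k" by (rule DomainE)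
    show ?thesis using y unfolding sv[OF y] .
  qed
  have G_sub: "G k \<subseteq> R k" and G_add: "(x, y) \<in> G k \<Longrightarrow> (x', y') \<in> G k \<Longrightarrow> (x \<oplus> x', y \<oplus> y') \<in> G k"
    for k x y x' y'
    using goodG[of k] unfolding good_def additive_graph_def by simp_all
  have hR: "(x, h k x) \<in> R k" if "x \<in> Domain (R k)" for k x
    by (rule subsetD[OF G_sub hG[OF that]])
  have "graded_family (\<lambda>k. Domain (R k)) e h"
    unfolding graded_family_def
  proof (intro conjI allI ballI)
    fix k x assume x: "x \<in> Domain (R k)"
    show "h k x \<in> hpart N (k + e)" using subsetD[OF R hR[OF x]] by simp
    show "h k (x \<oplus> y) = h k x \<oplus> h k y" if "y \<in> Domain (R k)" for y
      by (rule sv[OF G_add[OF hG[OF x] hG[OF that]]])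
    have "(U \<odot> x, U \<odot> h k x) \<in> UU (G k)" unfolding UU_def using hG[OF x] by force
    then show "h (k - 2) (U \<odot> x) = U \<odot> h k x" by (intro sv subsetD[OF GU])
  qed
  then show ?thesis using hR by blast
qed

end

section \<open>Chain complexes\<close>

locale free_complex =
  fixes C :: "'a chain_cx" (structure)
  assumes complex: "chain_complex C" and free: "finitely_generated_free C"
begin

sublocale finite_type_module C
  using complex free graded_FU_module.finite_type_if_free unfolding chain_complex_def by blast

abbreviation "d \<equiv> diff C"

lemma d_linear: "graded_linear (-1) C C d"
  using complex unfolding chain_complex_def by blast

lemma d_simps:
  "x \<in> carrier C \<Longrightarrow> d x \<in> carrier C"
  "x \<in> carrier C \<Longrightarrow> y \<in> carrier C \<Longrightarrow> d (x \<oplus> y) = d x \<oplus> d y"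
  "x \<in> carrier C \<Longrightarrow> d (p \<odot> x) = p \<odot> d x"
  "d \<zero> = \<zero>"
  "x \<in> carrier C \<Longrightarrow> d (d x) = \<zero>"
  using graded_linearD[OF d_linear] graded_linear_zero[OF d_linear] complex
  unfolding chain_complex_def by simp_all

lemma d_hpart: "x \<in> hpart C k \<Longrightarrow> d x \<in> hpart C (k - 1)"
  using graded_linearD(4)[OF d_linear, of x k] by simp

definition Zh :: "int \<Rightarrow> 'a set" where "Zh k = {z \<in> hpart C k. d z = \<zero>}"
definition Bh :: "int \<Rightarrow> 'a set" where "Bh k = d ` hpart C (k + 1)"

lemma ZhI: "z \<in> hpart C k \<Longrightarrow> d z = \<zero> \<Longrightarrow> z \<in> Zh k"
  by (simp add: Zh_def)

lemma ZhD: assumes "z \<in> Zh k" shows "z \<in> hpart C k" "z \<in> carrier C" "d z = \<zero>" "z \<in> cycles C"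
  using assms hpart_closed(1)[of z k] by (auto simp: Zh_def cycles_def)

lemma BhI: "x \<in> hpart C (k + 1) \<Longrightarrow> d x \<in> Bh k"
  by (simp add: Bh_def)

lemma Bh_d: "x \<in> hpart C k \<Longrightarrow> d x \<in> Bh (k - 1)"
  by (simp add: Bh_def)

lemma Bh_Zh: assumes "b \<in> Bh k" shows "b \<in> Zh k"
proof -
  obtain x where "x \<in> hpart C (k + 1)" "b = d x" using assms by (auto simp: Bh_def)
  then show ?thesis using d_hpart[of x "k + 1"] d_simps(5)[OF hpart_closed(1)] by (auto intro!: ZhI)
qed

lemma Zh_closed:
  "\<zero> \<in> Zh k" "z \<in> Zh k \<Longrightarrow> z' \<in> Zh k \<Longrightarrow> z \<oplus> z' \<in> Zh k" "z \<in> Zh k \<Longrightarrow> U \<odot> z \<in> Zh (k - 2)"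
  using hpart_closed(2,3) hpart_U ZhD by (auto simp: d_simps smult_simps intro!: ZhI)

lemma Bh_closed:
  "\<zero> \<in> Bh k" "z \<in> Bh k \<Longrightarrow> z' \<in> Bh k \<Longrightarrow> z \<oplus> z' \<in> Bh k" "z \<in> Bh k \<Longrightarrow> U \<odot> z \<in> Bh (k - 2)"
proof -
  show "\<zero> \<in> Bh k" using BhI[OF hpart_closed(2), of k] by (simp add: d_simps)
  show "z \<oplus> z' \<in> Bh k" if z: "z \<in> Bh k" "z' \<in> Bh k"
  proof -
    obtain x where x: "x \<in> hpart C (k + 1)" "z = d x" using z(1) by (auto simp: Bh_def)
    obtain x' where x': "x' \<in> hpart C (k + 1)" "z' = d x'" using z(2) by (auto simp: Bh_def)
    have "z \<oplus> z' = d (x \<oplus> x')"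
      using d_simps(2)[OF hpart_closed(1)[OF x(1)] hpart_closed(1)[OF x'(1)]] x x' by simp
    then show ?thesis using BhI[OF hpart_closed(3)[OF x(1) x'(1)]] by simp
  qed
  show "U \<odot> z \<in> Bh (k - 2)" if z: "z \<in> Bh k"
  proof -
    obtain x where x: "x \<in> hpart C (k + 1)" "z = d x" using z by (auto simp: Bh_def)
    have "U \<odot> z = d (U \<odot> x)" using d_simps(3)[OF hpart_closed(1)[OF x(1)]] x by simp
    moreover have "k + 1 - 2 = k - 2 + 1" by simp
    ultimately show ?thesis using BhI hpart_U[OF x(1)] by metis
  qed
qed

text \<open>If \<open>x\<close> bounds a homogeneous cycle, so does its component of degree
  \<open>k + 1\<close>.\<close>

lemma boundaries_Bh: "Zh k \<inter> boundaries C = Bh k"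
proof (intro equalityI subsetI)
  fix z assume "z \<in> Bh k"
  then show "z \<in> Zh k \<inter> boundaries C"
    using Bh_Zh hpart_closed(1) by (auto simp: boundaries_def Bh_def)
next
  fix z assume z: "z \<in> Zh k \<inter> boundaries C"
  then obtain x where x: "x \<in> carrier C" "z = d x" by (auto simp: boundaries_def)
  have "z = hcomp z k" using hcomp_hom[OF ZhD(1), of z k k] z by simp
  also have "\<dots> = d (hcomp x (k + 1))" using hcomp_graded_linear[OF d_linear x(1), of "k + 1"] x by simp
  finally show "z \<in> Bh k" using BhI[OF hcomp_props(1)[OF x(1)]] by simp
qed

lemma graded_subgroup_Zh: "graded_subgroup Zh"
  unfolding graded_subgroup_def using Zh_closed by (auto simp: Zh_def)

lemma graded_subgroup_Bh: "graded_subgroup Bh"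
  unfolding graded_subgroup_def using Bh_closed ZhD(1)[OF Bh_Zh] by blast

text \<open>\<open>graded_section\<close> applied to the relation between \<open>x\<close> and all
  chains bounding \<open>g k x\<close>. It is the common source of the sections, lifts and
  homotopies below.\<close>

lemma lift_boundaries:
  assumes D: "graded_subgroup D" and g: "graded_family D e g"
    and gB: "\<And>k x. x \<in> D k \<Longrightarrow> g k x \<in> Bh (k + e)"
  shows "\<exists>h. graded_family D (e + 1) h \<and> (\<forall>k. \<forall>x \<in> D k. d (h k x) = g k x)"
proof -
  define R where "R = (\<lambda>k. {(x, y). x \<in> D k \<and> y \<in> hpart C (k + (e + 1)) \<and> d y = g k x})"
  have dom: "Domain (R k) = D k" for k
  proof (intro equalityI subsetI)
    fix x assume x: "x \<in> D k"
    obtain y where "y \<in> hpart C (k + e + 1)" "g k x = d y" using gB[OF x] by (auto simp: Bh_def)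
    then show "x \<in> Domain (R k)" using x by (auto simp: R_def add.assoc)
  qed (auto simp: R_def)
  have Dp: "\<zero> \<in> D k" "x \<in> D k \<Longrightarrow> x \<in> hpart C k" "x \<in> D k \<Longrightarrow> y \<in> D k \<Longrightarrow> x \<oplus> y \<in> D k"
    "x \<in> D k \<Longrightarrow> U \<odot> x \<in> D (k - 2)" for k x y
    using D unfolding graded_subgroup_def by auto
  have "\<exists>h. graded_family (\<lambda>k. Domain (R k)) (e + 1) h \<and> (\<forall>k. \<forall>x \<in> Domain (R k). (x, h k x) \<in> R k)"
  proof (rule graded_section)
    show "R k \<subseteq> hpart C k \<times> hpart C (k + (e + 1))" for k using Dp(2) by (auto simp: R_def)
    show "(\<zero>, \<zero>) \<in> R k" for k
      using Dp(1) hpart_closed(2) graded_familyD(5)[OF g Dp(1)] by (simp add: R_def d_simps)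
    show "(x \<oplus> x', y \<oplus> y') \<in> R k" if "(x, y) \<in> R k" "(x', y') \<in> R k" for k x y x' y'
    proof -
      have *: "x \<in> D k" "x' \<in> D k" "y \<in> hpart C (k + (e + 1))" "y' \<in> hpart C (k + (e + 1))"
        "d y = g k x" "d y' = g k x'" using that by (auto simp: R_def)
      show ?thesis
        using Dp(3)[OF *(1,2)] hpart_closed(3)[OF *(3,4)] *(5,6) graded_familyD(3)[OF g *(1,2)]
          hpart_closed(1)[OF *(3)] hpart_closed(1)[OF *(4)]
        by (simp add: R_def d_simps)
    qed
    show "(U \<odot> x, U \<odot> y) \<in> R (k - 2)" if "(x, y) \<in> R k" for k x y
    proof -
      have *: "x \<in> D k" "y \<in> hpart C (k + (e + 1))" "d y = g k x" using that by (auto simp: R_def)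
      have eq: "k - 2 + (e + 1) = k + (e + 1) - 2" by simp
      show ?thesis
        using Dp(4)[OF *(1)] hpart_U[OF *(2)] *(3) graded_familyD(4)[OF g *(1)] hpart_closed(1)[OF *(2)]
        unfolding R_def eq by (simp add: d_simps)
    qed
  qed
  then show ?thesis unfolding dom by (auto simp: R_def)
qed

lemma d_section: "\<exists>s. graded_family Bh 1 s \<and> (\<forall>k. \<forall>b \<in> Bh k. d (s k b) = b)"
proof -
  have "graded_family Bh 0 (\<lambda>k b. b)"
    using ZhD(1)[OF Bh_Zh] by (simp add: graded_family_def)
  from lift_boundaries[OF graded_subgroup_Bh this] show ?thesis by simp
qed

text \<open>A section \<open>s\<close> of \<open>d\<close> splits the complex as cycles plus a copy of the boundaries, so maps
  can be prescribed on cycles and boundaries separately.\<close>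

lemma glue:
  assumes s: "graded_family Bh 1 s" "\<And>k b. b \<in> Bh k \<Longrightarrow> d (s k b) = b"
    and kk: "graded_family Zh e kk" and l: "graded_family Bh (e + 1) l"
  obtains f where "graded_linear e C C f"
    and "\<And>k x. x \<in> hpart C k \<Longrightarrow> x \<oplus> s (k - 1) (d x) \<in> Zh k \<and>
      f x = kk k (x \<oplus> s (k - 1) (d x)) \<oplus> l (k - 1) (d x)"
    and "\<And>k z. z \<in> Zh k \<Longrightarrow> f z = kk k z"
proof -
  \<comment> \<open>In characteristic two this is \<open>x\<close> minus \<open>s (d x)\<close>, the
    projection onto the cycles along the image of \<open>s\<close>.\<close>
  define \<pi> where "\<pi> = (\<lambda>k x. x \<oplus> s (k - 1) (d x))"
  define g where "g = (\<lambda>k x. kk k (\<pi> k x) \<oplus> l (k - 1) (d x))"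
  have sh: "s (k - 1) (d x) \<in> hpart C k" if "x \<in> hpart C k" for k x
    using graded_familyD(1)[OF s(1) Bh_d[OF that]] by simp
  have \<pi>Z: "\<pi> k x \<in> Zh k" if x: "x \<in> hpart C k" for k x
  proof (rule ZhI)
    show "\<pi> k x \<in> hpart C k" unfolding \<pi>_def using hpart_closed(3)[OF x sh[OF x]] .
    show "d (\<pi> k x) = \<zero>" unfolding \<pi>_def
      using hpart_closed(1)[OF x] hpart_closed(1)[OF sh[OF x]] s(2)[OF Bh_d[OF x]] by (simp add: d_simps)
  qed
  have \<pi>_add: "\<pi> k (x \<oplus> y) = \<pi> k x \<oplus> \<pi> k y" if xy: "x \<in> hpart C k" "y \<in> hpart C k" for k x y
    using graded_familyD(3)[OF s(1) Bh_d[OF xy(1)] Bh_d[OF xy(2)]]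
      hpart_closed(1)[OF xy(1)] hpart_closed(1)[OF xy(2)] hpart_closed(1)[OF sh[OF xy(1)]] hpart_closed(1)[OF sh[OF xy(2)]]
    by (simp add: \<pi>_def d_simps M.a_ac)
  have eq: "k - 2 - 1 = k - 1 - 2" for k :: int by simp
  have \<pi>_U: "\<pi> (k - 2) (U \<odot> x) = U \<odot> \<pi> k x" if x: "x \<in> hpart C k" for k x
    using graded_familyD(4)[OF s(1) Bh_d[OF x]] hpart_closed(1)[OF x] hpart_closed(1)[OF sh[OF x]]
    unfolding \<pi>_def eq by (simp add: d_simps smult_simps)
  have lh: "l (k - 1) (d x) \<in> hpart C (k + e)" if "x \<in> hpart C k" for k x
    using graded_familyD(1)[OF l Bh_d[OF that]] by (simp add: algebra_simps)
  obtain f where f: "graded_linear e C C f" "\<forall>k. \<forall>x \<in> hpart C k. f x = g k x"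
  proof -
    have "\<exists>f. graded_linear e C C f \<and> (\<forall>k. \<forall>x \<in> hpart C k. f x = g k x)"
    proof (rule graded_linear_extension)
      show "g k x \<in> hpart C (k + e)" if x: "x \<in> hpart C k" for k x
        unfolding g_def by (rule hpart_closed(3)[OF graded_familyD(1)[OF kk \<pi>Z[OF x]] lh[OF x]])
      show "g k (x \<oplus> y) = g k x \<oplus> g k y" if xy: "x \<in> hpart C k" "y \<in> hpart C k" for k x y
        using graded_familyD(3)[OF kk \<pi>Z[OF xy(1)] \<pi>Z[OF xy(2)]] graded_familyD(3)[OF l Bh_d[OF xy(1)] Bh_d[OF xy(2)]]
          hpart_closed(1)[OF xy(1)] hpart_closed(1)[OF xy(2)] graded_familyD(2)[OF kk \<pi>Z[OF xy(1)]]
          graded_familyD(2)[OF kk \<pi>Z[OF xy(2)]] hpart_closed(1)[OF lh[OF xy(1)]] hpart_closed(1)[OF lh[OF xy(2)]]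
        by (simp add: g_def \<pi>_add[OF xy] d_simps M.a_ac)
      show "g (k - 2) (U \<odot> x) = U \<odot> g k x" if x: "x \<in> hpart C k" for k x
        using graded_familyD(4)[OF kk \<pi>Z[OF x]] graded_familyD(4)[OF l Bh_d[OF x]] hpart_closed(1)[OF x]
          graded_familyD(2)[OF kk \<pi>Z[OF x]] hpart_closed(1)[OF lh[OF x]]
        unfolding g_def \<pi>_U[OF x] eq by (simp add: d_simps smult_simps)
    qed
    then show thesis by (elim exE conjE) (rule that)
  qed
  show thesis
  proof (rule that[OF f(1)])
    show "x \<oplus> s (k - 1) (d x) \<in> Zh k \<and> f x = kk k (x \<oplus> s (k - 1) (d x)) \<oplus> l (k - 1) (d x)"
      if x: "x \<in> hpart C k" for k x
      using f(2) x \<pi>Z[OF x] by (simp add: g_def \<pi>_def)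
    show "f z = kk k z" if z: "z \<in> Zh k" for k z
      using f(2) ZhD[OF z] graded_familyD(5)[OF s(1) Bh_closed(1)] graded_familyD(5)[OF l Bh_closed(1)]
        graded_familyD(2)[OF kk z]
      by (simp add: g_def \<pi>_def)
  qed
qed

end

section \<open>Lifting maps of homology to the complex; null homotopies\<close>

context free_complex
begin

text \<open>The relation \<open>Q\<close> encodes a map of homology by its pairs of representing
  cycles, and \<open>Q_B\<close> is its well-definedness. A section over the cycles sends boundaries
  to boundaries; lifting that restriction through \<open>d\<close> gives the values on the
  complement of the cycles.\<close>

lemma chain_map_lift:
  fixes Q :: "int \<Rightarrow> ('a \<times> 'a) set"
  assumes Q: "\<And>k. Q k \<subseteq> Zh k \<times> Zh k"
    and Q_zero: "\<And>k. (\<zero>, \<zero>) \<in> Q k"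
    and Q_add: "\<And>k x y x' y'. (x, y) \<in> Q k \<Longrightarrow> (x', y') \<in> Q k \<Longrightarrow> (x \<oplus> x', y \<oplus> y') \<in> Q k"
    and Q_U: "\<And>k x y. (x, y) \<in> Q k \<Longrightarrow> (U \<odot> x, U \<odot> y) \<in> Q (k - 2)"
    and Q_total: "\<And>k. Zh k = Domain (Q k)"
    and Q_B: "\<And>k b z. (b, z) \<in> Q k \<Longrightarrow> b \<in> Bh k \<Longrightarrow> z \<in> Bh k"
  shows "\<exists>f. chain_map C f \<and> (\<forall>k. \<forall>z \<in> Zh k. (z, f z) \<in> Q k)"
proof -
  have Q': "Q k \<subseteq> hpart C k \<times> hpart C (k + 0)" for k using Q[of k] by (auto simp: Zh_def)
  have "\<exists>kk. graded_family Zh 0 kk \<and> (\<forall>k. \<forall>x \<in> Zh k. (x, kk k x) \<in> Q k)"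
    unfolding Q_total using Q_zero Q_add Q_U by (intro graded_section[OF Q']) blast+
  then obtain kk where kk: "graded_family Zh 0 kk" and kkQ: "\<And>k z. z \<in> Zh k \<Longrightarrow> (z, kk k z) \<in> Q k" by blast
  have kkB: "kk k b \<in> Bh k" if "b \<in> Bh k" for k b
    by (rule Q_B[OF kkQ[OF Bh_Zh[OF that]] that])
  have kkZ: "kk k z \<in> Zh k" if "z \<in> Zh k" for k z using subsetD[OF Q kkQ[OF that]] by simp
  have "graded_family Bh 0 kk" using kk by (rule graded_family_mono) (use Bh_Zh in blast)
  from lift_boundaries[OF graded_subgroup_Bh this] kkB
  obtain l where l: "graded_family Bh (0 + 1) l" and dl: "\<And>k b. b \<in> Bh k \<Longrightarrow> d (l k b) = kk k b" by auto
  obtain s where s: "graded_family Bh 1 s" "\<And>k b. b \<in> Bh k \<Longrightarrow> d (s k b) = b" using d_section by blast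
  show ?thesis
  proof (rule glue[OF s kk l], assumption)
    fix f assume f: "graded_linear 0 C C f"
      "\<And>k x. x \<in> hpart C k \<Longrightarrow> x \<oplus> s (k - 1) (d x) \<in> Zh k \<and>
        f x = kk k (x \<oplus> s (k - 1) (d x)) \<oplus> l (k - 1) (d x)"
      "\<And>k z. z \<in> Zh k \<Longrightarrow> f z = kk k z"
    have "f (d x) = d (f x)" if "x \<in> carrier C" for x
      using that
    proof (induction rule: homogeneous_induct)
      case (homogeneous k x)
      note \<pi> = conjunct1[OF f(2)[OF homogeneous]]
      have B: "d x \<in> Bh (k - 1)" by (rule Bh_d[OF homogeneous])
      have "d (f x) = d (kk k (x \<oplus> s (k - 1) (d x))) \<oplus> d (l (k - 1) (d x))"
        using conjunct2[OF f(2)[OF homogeneous]] graded_familyD(2)[OF kk \<pi>] graded_familyD(2)[OF l B]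
        by (simp add: d_simps)
      also have "\<dots> = kk (k - 1) (d x)"
        using ZhD(3)[OF kkZ[OF \<pi>]] dl[OF B] graded_familyD(2)[OF kk Bh_Zh[OF B]] by simp
      finally show ?case using f(3)[OF Bh_Zh[OF B]] by simp
    next
      case (add y z)
      then show ?case by (simp add: d_simps graded_linearD[OF f(1)])
    qed
    then have "chain_map C f" using f(1) by (simp add: chain_map_def)
    moreover have "(z, f z) \<in> Q k" if "z \<in> Zh k" for k z
      using kkQ[OF that] f(3)[OF that] by simp
    ultimately show ?thesis by blast
  qed
qed

text \<open>When the homology is concentrated in one parity, the obstruction to a homotopy, a map
  \<open>H\<^sub>* \<rightarrow> H\<^sub>*\<close> of odd degree, vanishes.\<close>

lemma null_homotopy:
  assumes f: "chain_map C f"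
    and fB: "\<And>k z. z \<in> Zh k \<Longrightarrow> f z \<in> Bh k"
    and parity: "\<And>k. odd (k - p) \<Longrightarrow> Zh k \<subseteq> Bh k"
  shows "\<exists>h. graded_linear 1 C C h \<and> (\<forall>x \<in> carrier C. f x = d (h x) \<oplus> h (d x))"
proof -
  obtain s where s: "graded_family Bh 1 s" "\<And>k b. b \<in> Bh k \<Longrightarrow> d (s k b) = b" using d_section by blast
  have f_lin: "graded_linear 0 C C f" and fd: "\<And>x. x \<in> carrier C \<Longrightarrow> f (d x) = d (f x)"
    using f by (auto simp: chain_map_def)
  note fl = graded_linearD[OF f_lin]
  have sc: "s k b \<in> carrier C" if "b \<in> Bh k" for k b by (rule graded_familyD(2)[OF s(1) that])
  have "graded_family Zh 0 (\<lambda>k z. z)"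
    using ZhD(1) by (simp add: graded_family_def)
  from lift_boundaries[OF graded_subgroup_Zh graded_family_linear[OF f_lin this]] fB
  obtain h0 where h0: "graded_family Zh 1 h0" "\<And>k z. z \<in> Zh k \<Longrightarrow> d (h0 k z) = f z" by auto
  have fs: "graded_family Bh 1 (\<lambda>k b. f (s k b))" by (rule graded_family_linear[OF f_lin s(1)])
  \<comment> \<open>In degrees of the parity without homology every cycle bounds, and the choice
    \<open>f (s k z)\<close> makes the obstruction below vanish identically. In the other degrees
    any lift works, because its obstruction is a cycle of the parity without homology.\<close>
  define kk where "kk = (\<lambda>k z. if odd (k - p) then f (s k z) else h0 k z)"
  have ZB: "z \<in> Bh k" if "z \<in> Zh k" "odd (k - p)" for k z using parity that by blast
  have kk: "graded_family Zh 1 kk"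
    unfolding graded_family_def
  proof (intro conjI allI ballI)
    fix k z assume z: "z \<in> Zh k"
    have odd: "odd (k - 2 - p) = odd (k - p)" by simp
    show "kk k z \<in> hpart C (k + 1)"
      using graded_familyD(1)[OF fs ZB[OF z]] graded_familyD(1)[OF h0(1) z] by (simp only: kk_def split: if_split) blast
    show "kk k (z \<oplus> z') = kk k z \<oplus> kk k z'" if z': "z' \<in> Zh k" for z'
      using graded_familyD(3)[OF fs ZB[OF z] ZB[OF z']] graded_familyD(3)[OF h0(1) z z']
      by (simp only: kk_def split: if_split) blast
    show "kk (k - 2) (U \<odot> z) = U \<odot> kk k z"
      using graded_familyD(4)[OF fs ZB[OF z]] graded_familyD(4)[OF h0(1) z]
      by (simp only: kk_def odd split: if_split) blast
  qed
  have dkk: "d (kk k z) = f z" if z: "z \<in> Zh k" for k z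
    using h0(2)[OF z] s(2)[OF ZB[OF z]] fd[OF sc[OF ZB[OF z]]] by (auto simp: kk_def)
  have kkc: "kk k z \<in> carrier C" if "z \<in> Zh k" for k z by (rule graded_familyD(2)[OF kk that])
  have fsc: "f (s k b) \<in> carrier C" if "b \<in> Bh k" for k b by (rule fl(1)[OF sc[OF that]])
  have kkB: "graded_family Bh 1 kk" using kk by (rule graded_family_mono) (use Bh_Zh in blast)
  \<comment> \<open>The obstruction: evaluating the homotopy formula on \<open>s k b\<close>
    requires a chain \<open>l k b\<close> whose differential is this sum.\<close>
  have "f (s k b) \<oplus> kk k b \<in> Bh (k + 1)" if b: "b \<in> Bh k" for k b
  proof (cases "odd (k - p)")
    case True
    then show ?thesis using fsc[OF b] Bh_closed(1) by (simp add: kk_def)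
  next
    case False
    have "f (s k b) \<oplus> kk k b \<in> Zh (k + 1)"
      using hpart_closed(3)[OF graded_familyD(1)[OF fs b] graded_familyD(1)[OF kkB b]]
        kkc[OF Bh_Zh[OF b]] fsc[OF b] fd[OF sc[OF b]] dkk[OF Bh_Zh[OF b]] s(2)[OF b]
        fl(1)[OF ZhD(2)[OF Bh_Zh[OF b]]]
      by (intro ZhI) (simp_all add: d_simps)
    moreover have "odd (k + 1 - p)" using False by simp
    ultimately show ?thesis using parity by blast
  qed
  from lift_boundaries[OF graded_subgroup_Bh graded_family_add[OF fs kkB] this]
  obtain l where l: "graded_family Bh (1 + 1) l"
    and dl: "\<And>k b. b \<in> Bh k \<Longrightarrow> d (l k b) = f (s k b) \<oplus> kk k b" by blast
  show ?thesis
  proof (rule glue[OF s kk l], assumption)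
    fix h assume h: "graded_linear 1 C C h"
      "\<And>k x. x \<in> hpart C k \<Longrightarrow> x \<oplus> s (k - 1) (d x) \<in> Zh k \<and>
        h x = kk k (x \<oplus> s (k - 1) (d x)) \<oplus> l (k - 1) (d x)"
      "\<And>k z. z \<in> Zh k \<Longrightarrow> h z = kk k z"
    have "f x = d (h x) \<oplus> h (d x)" if "x \<in> carrier C" for x
      using that
    proof (induction rule: homogeneous_induct)
      case (homogeneous k x)
      note \<pi> = conjunct1[OF h(2)[OF homogeneous]]
      have B: "d x \<in> Bh (k - 1)" by (rule Bh_d[OF homogeneous])
      note c = hpart_closed(1)[OF homogeneous] kkc[OF \<pi>] graded_familyD(2)[OF l B]
        kkc[OF Bh_Zh[OF B]] fsc[OF B] sc[OF B]
      have "d (h x) = d (kk k (x \<oplus> s (k - 1) (d x))) \<oplus> d (l (k - 1) (d x))"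
        using conjunct2[OF h(2)[OF homogeneous]] c by (simp add: d_simps)
      also have "\<dots> = (f x \<oplus> f (s (k - 1) (d x))) \<oplus> (f (s (k - 1) (d x)) \<oplus> kk (k - 1) (d x))"
        using dkk[OF \<pi>] dl[OF B] fl(2)[OF c(1) c(6)] by simp
      finally show ?case using h(3)[OF Bh_Zh[OF B]] c fl(1)[OF c(1)] by (simp add: M.a_ac)
    next
      case (add y z)
      then show ?case using graded_linearD[OF h(1)] by (simp add: d_simps fl M.a_ac)
    qed
    then show ?thesis using h(1) by blast
  qed
qed

end

section \<open>Cosets and homology classes\<close>

lemma submod_simps [simp]:
  "carrier (submod N W) = W" "hpart (submod N W) = (\<lambda>k. hpart N k \<inter> W)"
  "x \<oplus>\<^bsub>submod N W\<^esub> y = x \<oplus>\<^bsub>N\<^esub> y" "p \<odot>\<^bsub>submod N W\<^esub> x = p \<odot>\<^bsub>N\<^esub> x" "\<zero>\<^bsub>submod N W\<^esub> = \<zero>\<^bsub>N\<^esub>"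
  by (simp_all add: submod_def)

lemma diff_submod [simp]: "diff (submod C W) = diff C"
  by (simp add: submod_def)

lemma a_r_coset_submod [simp]: "B +>\<^bsub>submod N W\<^esub> x = B +>\<^bsub>N\<^esub> x"
  unfolding a_r_coset_def' by simp

lemma set_add_submod [simp]: "X <+>\<^bsub>submod N W\<^esub> Y = X <+>\<^bsub>N\<^esub> Y"
  unfolding set_add_def' by simp

lemma homology_simps:
  "carrier (homology C) = (\<lambda>z. boundaries C +>\<^bsub>C\<^esub> z) ` cycles C"
  "X \<oplus>\<^bsub>homology C\<^esub> Y = X <+>\<^bsub>C\<^esub> Y"
  "p \<odot>\<^bsub>homology C\<^esub> X = boundaries C <+>\<^bsub>C\<^esub> ((\<lambda>x. p \<odot>\<^bsub>C\<^esub> x) ` X)"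
  "\<zero>\<^bsub>homology C\<^esub> = boundaries C"
  "hpart (homology C) k = (\<lambda>z. boundaries C +>\<^bsub>C\<^esub> z) ` (hpart C k \<inter> cycles C)"
  by (auto simp: homology_def quotient_mod_def A_RCOSETS_def')

lemma homology_submod_simps:
  fixes C (structure) and W
  defines "B \<equiv> diff C ` W" and "Z \<equiv> {x \<in> W. diff C x = \<zero>\<^bsub>C\<^esub>}"
  shows "carrier (homology (submod C W)) = (\<lambda>z. B +>\<^bsub>C\<^esub> z) ` Z"
    "X \<oplus>\<^bsub>homology (submod C W)\<^esub> Y = X <+>\<^bsub>C\<^esub> Y"
    "p \<odot>\<^bsub>homology (submod C W)\<^esub> X = B <+>\<^bsub>C\<^esub> ((\<lambda>x. p \<odot>\<^bsub>C\<^esub> x) ` X)"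
    "\<zero>\<^bsub>homology (submod C W)\<^esub> = B"
    "hpart (homology (submod C W)) k = (\<lambda>z. B +>\<^bsub>C\<^esub> z) ` (hpart C k \<inter> Z)"
  unfolding B_def Z_def homology_simps by (auto simp: boundaries_def cycles_def)

context graded_FU_module
begin

definition subspace :: "'a set \<Rightarrow> bool" where
  "subspace B \<longleftrightarrow> B \<subseteq> carrier N \<and> \<zero> \<in> B \<and> (\<forall>x \<in> B. \<forall>y \<in> B. x \<oplus> y \<in> B) \<and> (\<forall>p. \<forall>x \<in> B. p \<odot> x \<in> B)"

lemma coset_mem: "y \<in> B +> z \<longleftrightarrow> (\<exists>b \<in> B. y = b \<oplus> z)"
  unfolding a_r_coset_def' by blast

lemma coset_self: "subspace B \<Longrightarrow> z \<in> carrier N \<Longrightarrow> z \<in> B +> z"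
  unfolding coset_mem subspace_def using M.l_zero[of z] by metis

lemma coset_memI:
  assumes B: "subspace B" and c: "y \<in> carrier N" "z \<in> carrier N" and "y \<oplus> z \<in> B"
  shows "y \<in> B +> z"
  unfolding coset_mem using assms by (intro bexI[of _ "y \<oplus> z"]) (simp_all add: M.a_assoc)

lemma coset_memD:
  assumes B: "subspace B" and z: "z \<in> carrier N" and "y \<in> B +> z"
  shows "y \<in> carrier N" "y \<oplus> z \<in> B"
proof -
  obtain b where b: "b \<in> B" "y = b \<oplus> z" using assms(3) unfolding coset_mem by blast
  have bc: "b \<in> carrier N" using b B unfolding subspace_def by blast
  show "y \<in> carrier N" "y \<oplus> z \<in> B" using b bc z by (simp_all add: M.a_assoc)
qed

lemma coset_eq_iff:
  assumes B: "subspace B" and z: "z \<in> carrier N" "z' \<in> carrier N"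
  shows "B +> z = B +> z' \<longleftrightarrow> z \<oplus> z' \<in> B"
proof
  assume "B +> z = B +> z'"
  then have "z \<in> B +> z'" using coset_self[OF B z(1)] by simp
  then show "z \<oplus> z' \<in> B" using coset_memD(2)[OF B z(2)] by blast
next
  assume zz: "z \<oplus> z' \<in> B"
  have sub: "B +> x \<subseteq> B +> y" if xy: "x \<in> carrier N" "y \<in> carrier N" "x \<oplus> y \<in> B" for x y
  proof
    fix u assume "u \<in> B +> x"
    then have u: "u \<in> carrier N" "u \<oplus> x \<in> B" using coset_memD[OF B xy(1)] by blast+
    have "(u \<oplus> x) \<oplus> (x \<oplus> y) \<in> B" using u xy B unfolding subspace_def by blast
    then have "u \<oplus> y \<in> B" using u xy by (simp add: M.a_assoc)
    then show "u \<in> B +> y" by (rule coset_memI[OF B u(1) xy(2)])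
  qed
  have "z' \<oplus> z \<in> B" using zz z by (simp add: M.a_comm)
  then show "B +> z = B +> z'" using sub z zz by (intro equalityI) blast+
qed

lemma coset_zero: "subspace B \<Longrightarrow> B +> \<zero> = B"
proof -
  assume B: "subspace B"
  then have "\<And>b. b \<in> B \<Longrightarrow> b \<oplus> \<zero> = b" unfolding subspace_def by (meson M.r_zero subsetD)
  then show ?thesis by (intro Set.set_eqI) (auto simp: coset_mem)
qed

text \<open>Adding \<open>B\<close> completes the image to a full coset. Scalar multiplication and
  induced maps on homology are both of this shape.\<close>

lemma coset_map:
  assumes B: "subspace B" and z: "z \<in> carrier N"
    and f: "\<And>x y. x \<in> carrier N \<Longrightarrow> y \<in> carrier N \<Longrightarrow> f (x \<oplus> y) = f x \<oplus> f y"
    "\<And>x. x \<in> carrier N \<Longrightarrow> f x \<in> carrier N" "\<And>b. b \<in> B \<Longrightarrow> f b \<in> B"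
  shows "B <+>\<^bsub>N\<^esub> (f ` (B +> z)) = B +> f z"
proof (intro Set.set_eqI iffI)
  fix y assume "y \<in> B <+>\<^bsub>N\<^esub> (f ` (B +> z))"
  then obtain b b' where b: "b \<in> B" "b' \<in> B" "y = b \<oplus> f (b' \<oplus> z)"
    unfolding set_add_def' by (auto simp: coset_mem)
  have c: "b \<in> carrier N" "b' \<in> carrier N" using b B unfolding subspace_def by blast+
  have "y = (b \<oplus> f b') \<oplus> f z" using b c z f by (simp add: M.a_assoc)
  moreover have "b \<oplus> f b' \<in> B" using b f(3) B unfolding subspace_def by blast
  ultimately show "y \<in> B +> f z" unfolding coset_mem by blast
next
  fix y assume "y \<in> B +> f z"
  then obtain b where "b \<in> B" "y = b \<oplus> f z" unfolding coset_mem by blast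
  then show "y \<in> B <+>\<^bsub>N\<^esub> (f ` (B +> z))" unfolding set_add_def' using coset_self[OF B z] by blast
qed

lemma coset_smult:
  assumes "subspace B" "z \<in> carrier N"
  shows "B <+>\<^bsub>N\<^esub> ((\<lambda>x. p \<odot> x) ` (B +> z)) = B +> (p \<odot> z)"
  using assms by (intro coset_map) (auto simp: smult_simps subspace_def)

lemma coset_add:
  assumes B: "subspace B" and z: "z \<in> carrier N" "z' \<in> carrier N"
  shows "(B +> z) <+>\<^bsub>N\<^esub> (B +> z') = B +> (z \<oplus> z')"
proof (intro Set.set_eqI iffI)
  fix y assume "y \<in> (B +> z) <+>\<^bsub>N\<^esub> (B +> z')"
  then obtain b b' where b: "b \<in> B" "b' \<in> B" "y = (b \<oplus> z) \<oplus> (b' \<oplus> z')"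
    unfolding set_add_def' by (auto simp: coset_mem)
  have c: "b \<in> carrier N" "b' \<in> carrier N" using b B unfolding subspace_def by blast+
  have "y = (b \<oplus> b') \<oplus> (z \<oplus> z')" using b c z by (simp add: M.a_ac)
  moreover have "b \<oplus> b' \<in> B" using b B unfolding subspace_def by blast
  ultimately show "y \<in> B +> (z \<oplus> z')" unfolding coset_mem by blast
next
  fix y assume "y \<in> B +> (z \<oplus> z')"
  then obtain b where b: "b \<in> B" "y = b \<oplus> (z \<oplus> z')" unfolding coset_mem by blast
  have "b \<in> carrier N" using b B unfolding subspace_def by blast
  then have "y = (b \<oplus> z) \<oplus> z'" using b z by (simp add: M.a_assoc)
  moreover have "b \<oplus> z \<in> B +> z" using b unfolding coset_mem by blast
  ultimately show "y \<in> (B +> z) <+>\<^bsub>N\<^esub> (B +> z')" unfolding set_add_def' using coset_self[OF B z(2)] by blast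
qed

end

context free_complex
begin

lemma boundaries_subspace: "subspace (boundaries C)"
  unfolding subspace_def boundaries_def
proof (intro conjI ballI allI)
  show "d ` carrier C \<subseteq> carrier C" by (auto simp: d_simps)
  show "\<zero> \<in> d ` carrier C" using d_simps(4) M.zero_closed by force
  fix x assume "x \<in> d ` carrier C"
  then obtain a where a: "a \<in> carrier C" "x = d a" by blast
  show "p \<odot> x \<in> d ` carrier C" for p
  proof (rule image_eqI)
    show "p \<odot> x = d (p \<odot> a)" using a d_simps(3) by simp
    show "p \<odot> a \<in> carrier C" using a by simp
  qed
  fix y assume "y \<in> d ` carrier C"
  then obtain b where b: "b \<in> carrier C" "y = d b" by blast
  then have "x \<oplus> y = d (a \<oplus> b)" using a by (simp add: d_simps)
  then show "x \<oplus> y \<in> d ` carrier C" using a b by blast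
qed

lemma cyclesD: assumes "z \<in> cycles C" shows "z \<in> carrier C" "d z = \<zero>"
  using assms by (auto simp: cycles_def)

lemma cycles_closed:
  "\<zero> \<in> cycles C" "z \<in> cycles C \<Longrightarrow> z' \<in> cycles C \<Longrightarrow> z \<oplus> z' \<in> cycles C"
  "z \<in> cycles C \<Longrightarrow> p \<odot> z \<in> cycles C"
  by (auto simp: cycles_def d_simps smult_simps)

lemma chain_mapD:
  assumes "chain_map C f"
  shows "x \<in> carrier C \<Longrightarrow> f x \<in> carrier C"
    "x \<in> carrier C \<Longrightarrow> y \<in> carrier C \<Longrightarrow> f (x \<oplus> y) = f x \<oplus> f y"
    "x \<in> carrier C \<Longrightarrow> f (p \<odot> x) = p \<odot> f x"
    "x \<in> carrier C \<Longrightarrow> f (d x) = d (f x)"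
    "f \<zero> = \<zero>"
    "x \<in> hpart C k \<Longrightarrow> f x \<in> hpart C k"
    "z \<in> cycles C \<Longrightarrow> f z \<in> cycles C"
    "b \<in> boundaries C \<Longrightarrow> f b \<in> boundaries C"
    "z \<in> Zh k \<Longrightarrow> f z \<in> Zh k"
proof -
  have lin: "graded_linear 0 C C f" and comm: "\<And>x. x \<in> carrier C \<Longrightarrow> f (d x) = d (f x)"
    using assms unfolding chain_map_def by auto
  show 1: "x \<in> carrier C \<Longrightarrow> f x \<in> carrier C"
    and 2: "x \<in> carrier C \<Longrightarrow> y \<in> carrier C \<Longrightarrow> f (x \<oplus> y) = f x \<oplus> f y"
    and 3: "x \<in> carrier C \<Longrightarrow> f (p \<odot> x) = p \<odot> f x"
    and 4: "x \<in> carrier C \<Longrightarrow> f (d x) = d (f x)"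
    and 5: "f \<zero> = \<zero>" for x y p
    using graded_linearD[OF lin] graded_linear_zero[OF lin] comm by auto
  show 6: "x \<in> hpart C k \<Longrightarrow> f x \<in> hpart C k" for x k using graded_linearD(4)[OF lin, of x k] by simp
  show 7: "z \<in> cycles C \<Longrightarrow> f z \<in> cycles C" for z
    using 1[of z] 4[of z] 5 by (simp add: cycles_def)
  show "b \<in> boundaries C \<Longrightarrow> f b \<in> boundaries C" using 1 4 by (auto simp: boundaries_def)
  show "z \<in> Zh k \<Longrightarrow> f z \<in> Zh k" using 6[of z k] 7[of z] ZhD[of z k] cyclesD by (auto intro!: ZhI)
qed

lemma chain_map_compose: "chain_map C f \<Longrightarrow> chain_map C g \<Longrightarrow> chain_map C (\<lambda>x. f (g x))"
  using chain_mapD[of f] chain_mapD[of g] unfolding chain_map_def[of C "\<lambda>x. f (g x)"] graded_linear_def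
  by simp

lemma chain_map_add: "chain_map C f \<Longrightarrow> chain_map C g \<Longrightarrow> chain_map C (\<lambda>x. f x \<oplus> g x)"
  using chain_mapD[of f] chain_mapD[of g] hpart_closed(3)
  unfolding chain_map_def[of C "\<lambda>x. f x \<oplus> g x"] graded_linear_def
  by (simp add: d_simps smult_simps M.a_ac)

lemma chain_map_id: "chain_map C (\<lambda>x. x)"
  unfolding chain_map_def graded_linear_def by simp

abbreviation cls :: "'a \<Rightarrow> 'a set" where "cls z \<equiv> boundaries C +> z"

lemma homology_cls:
  "z \<in> cycles C \<Longrightarrow> cls z \<in> carrier (homology C)"
  "z \<in> cycles C \<Longrightarrow> z' \<in> cycles C \<Longrightarrow> cls z \<oplus>\<^bsub>homology C\<^esub> cls z' = cls (z \<oplus> z')"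
  "z \<in> cycles C \<Longrightarrow> p \<odot>\<^bsub>homology C\<^esub> cls z = cls (p \<odot> z)"
  "cls \<zero> = \<zero>\<^bsub>homology C\<^esub>"
  "z \<in> cycles C \<Longrightarrow> z' \<in> cycles C \<Longrightarrow> cls z = cls z' \<longleftrightarrow> z \<oplus> z' \<in> boundaries C"
  "chain_map C f \<Longrightarrow> z \<in> cycles C \<Longrightarrow> homology_map C f (cls z) = cls (f z)"
  using boundaries_subspace
  by (simp_all add: homology_simps cyclesD coset_add coset_smult coset_zero coset_eq_iff
      homology_map_def coset_map chain_mapD)

lemma homologyE:
  assumes "X \<in> carrier (homology C)" obtains z where "z \<in> cycles C" "X = cls z"
  using assms unfolding homology_simps by blast

lemma hpart_homology: "hpart (homology C) k = cls ` Zh k"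
proof -
  have "hpart C k \<inter> cycles C = Zh k"
    by (auto simp: Zh_def cycles_def intro: hpart_closed(1))
  then show ?thesis unfolding homology_simps by simp
qed

end

section \<open>Comparison of kernels in two degrees; existence of maximal kernels\<close>

context finite_type_module
begin

lemma U_power_inj: "x \<in> carrier N \<Longrightarrow> (U ^ n) \<odot> x = \<zero> \<Longrightarrow> x = \<zero>"
proof (induction n)
  case 0 then show ?case by (simp add: smult_simps)
next
  case (Suc n)
  have "U \<odot> ((U ^ n) \<odot> x) = \<zero>" using Suc.prems pow_Suc_smult[of x n] by metis
  then show ?case using Suc U_inj[of "(U ^ n) \<odot> x"] by blast
qed

text \<open>Below \<open>K\<close> multiplication by \<open>U\<close> is onto, so elements of low
  degree are \<open>U\<close>-multiples of elements of the window, while elements of high degree are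
  carried into it by a power of \<open>U\<close>. Two adjacent degrees are needed to meet both
  parities.\<close>

lemma low_window:
  obtains K where "\<And>j x. x \<in> hpart N j \<Longrightarrow> \<exists>n. \<exists>y \<in> hpart N K \<union> hpart N (K - 1). (U ^ n) \<odot> x = y \<or> x = (U ^ n) \<odot> y"
proof -
  obtain K where K: "\<forall>k \<le> K. \<forall>x \<in> hpart N (k - 2). \<exists>y \<in> hpart N k. x = U \<odot> y"
    using U_onto_low by blast
  have lift: "\<exists>y \<in> hpart N t. x = (U ^ m) \<odot> y" if t: "t \<le> K" and "x \<in> hpart N (t - 2 * int m)" for t m x
    using that(2)
  proof (induction m arbitrary: x)
    case 0
    then have "x = (U ^ 0) \<odot> x" using smult_simps(5)[OF hpart_closed(1)] by simp
    then show ?case using 0 by auto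
  next
    case (Suc m)
    have "t - 2 * int (Suc m) = (t - 2 * int m) - 2" "t - 2 * int m \<le> K" using t by auto
    then obtain z where z: "z \<in> hpart N (t - 2 * int m)" "x = U \<odot> z" using K Suc.prems by metis
    then obtain y where "y \<in> hpart N t" "z = (U ^ m) \<odot> y" using Suc.IH by blast
    then have "x = (U ^ Suc m) \<odot> y" using z pow_Suc_smult[OF hpart_closed(1)] by metis
    then show ?case using \<open>y \<in> hpart N t\<close> by blast
  qed
  have "\<exists>n. \<exists>y \<in> hpart N K \<union> hpart N (K - 1). (U ^ n) \<odot> x = y \<or> x = (U ^ n) \<odot> y" if x: "x \<in> hpart N j" for j x
  proof -
    define t where "t = (if even (j - K) then K else K - 1)"
    have t: "t = K \<or> t = K - 1" "even (j - t)" by (auto simp: t_def)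
    obtain m where m: "j - t = 2 * m" using t(2) by blast
    show ?thesis
    proof (cases "m \<ge> 0")
      case True
      then have "j - 2 * int (nat m) = t" using m by simp
      then have "(U ^ nat m) \<odot> x \<in> hpart N t" using hpart_U_pow[OF x, of "nat m"] by simp
      then show ?thesis using t by blast
    next
      case False
      then have "j = t - 2 * int (nat (- m))" using m by simp
      then obtain y where "y \<in> hpart N t" "x = (U ^ nat (- m)) \<odot> y" using lift[of t x "nat (- m)"] t x by auto
      then show ?thesis using t by blast
    qed
  qed
  then show thesis by (rule that)
qed

end

lemma a_kernel_iff: "x \<in> a_kernel N N' f \<longleftrightarrow> x \<in> carrier N \<and> f x = \<zero>\<^bsub>N'\<^esub>"
  by (simp add: a_kernel_def kernel_def)

context free_complex
begin

text \<open>Powers of \<open>U\<close> are injective, so a linear map kills \<open>x\<close> iff it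
  kills \<open>(U ^ n) \<odot> x\<close>. This moves the question for a homogeneous element into the
  window \<open>L\<close>; other elements are treated by components.\<close>

lemma kernel_eq_if_eq_on_window:
  assumes K: "\<And>j x. x \<in> hpart C j \<Longrightarrow> \<exists>n. \<exists>y \<in> L. (U ^ n) \<odot> x = y \<or> x = (U ^ n) \<odot> y"
    and L: "L \<subseteq> carrier C" and f: "chain_map C f" and g: "chain_map C g"
    and sub: "a_kernel C C g \<inter> L \<subseteq> a_kernel C C f"
  shows "a_kernel C C g \<subseteq> a_kernel C C f"
proof
  have hom: "f x = \<zero>" if x: "x \<in> hpart C j" "g x = \<zero>" for x j
  proof -
    have xc: "x \<in> carrier C" using hpart_closed(1)[OF x(1)] .
    obtain n y where y: "y \<in> L" "(U ^ n) \<odot> x = y \<or> x = (U ^ n) \<odot> y" using K[OF x(1)] by blast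
    have yc: "y \<in> carrier C" using y L by blast
    from y(2) show ?thesis
    proof
      assume e: "(U ^ n) \<odot> x = y"
      have "g y = \<zero>" using chain_mapD(3)[OF g xc, of "U ^ n"] e x(2) by (simp add: smult_simps)
      then have "f y = \<zero>" using sub y(1) yc by (auto simp: a_kernel_iff)
      then have "(U ^ n) \<odot> f x = \<zero>" using chain_mapD(3)[OF f xc, of "U ^ n"] e by simp
      then show ?thesis using U_power_inj chain_mapD(1)[OF f xc] by blast
    next
      assume e: "x = (U ^ n) \<odot> y"
      have "(U ^ n) \<odot> g y = \<zero>" using chain_mapD(3)[OF g yc, of "U ^ n"] e x(2) by simp
      then have "g y = \<zero>" using U_power_inj chain_mapD(1)[OF g yc] by blast
      then have "f y = \<zero>" using sub y(1) yc by (auto simp: a_kernel_iff)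
      then show ?thesis using chain_mapD(3)[OF f yc, of "U ^ n"] e by (simp add: smult_simps)
    qed
  qed
  have lf: "graded_linear 0 C C f" and lg: "graded_linear 0 C C g" using f g by (auto simp: chain_map_def)
  fix x assume "x \<in> a_kernel C C g"
  then have x: "x \<in> carrier C" "g x = \<zero>" by (auto simp: a_kernel_iff)
  have "g (hcomp x k) = \<zero>" for k
    using hcomp_graded_linear[OF lg x(1), of k] x(2) hcomp_hom[OF hpart_closed(2)[of 0], of k] by simp
  then have "f (hcomp x k) = \<zero>" for k using hom[OF hcomp_props(1)[OF x(1)]] by blast
  then have "hcomp (f x) k = \<zero>" for k using hcomp_graded_linear[OF lf x(1), of k] by simp
  then have "f x = \<zero>" using hcomp_props(3)[OF chain_mapD(1)[OF f x(1)]] by simp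
  then show "x \<in> a_kernel C C f" using x by (simp add: a_kernel_iff)
qed

text \<open>Maximize the number of kernel elements in the finite window. A larger kernel with no
  more elements there coincides with the first one in the window, hence everywhere.\<close>

lemma exists_maximal_kernel:
  assumes P: "\<And>g. P g \<Longrightarrow> chain_map C g" and "P g0"
  shows "\<exists>f. P f \<and> (\<forall>g. P g \<longrightarrow> a_kernel C C f \<subseteq> a_kernel C C g \<longrightarrow> a_kernel C C g \<subseteq> a_kernel C C f)"
proof (rule low_window)
  fix K assume K: "\<And>j x. x \<in> hpart C j \<Longrightarrow>
    \<exists>n. \<exists>y \<in> hpart C K \<union> hpart C (K - 1). (U ^ n) \<odot> x = y \<or> x = (U ^ n) \<odot> y"
  let ?L = "hpart C K \<union> hpart C (K - 1)"
  have finL: "finite ?L" using finite_hpart by simp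
  have Lc: "?L \<subseteq> carrier C" using hpart_closed(1) by blast
  have "\<forall>f. P f \<longrightarrow> card (a_kernel C C f \<inter> ?L) < Suc (card ?L)"
    using card_mono[OF finL] by (simp add: le_imp_less_Suc)
  with \<open>P g0\<close> have "\<exists>f. P f \<and> (\<forall>g. P g \<longrightarrow> card (a_kernel C C g \<inter> ?L) \<le> card (a_kernel C C f \<inter> ?L))"
    by (rule ex_has_greatest_nat)
  then obtain f where f: "P f" "\<forall>g. P g \<longrightarrow> card (a_kernel C C g \<inter> ?L) \<le> card (a_kernel C C f \<inter> ?L)" by blast
  have "a_kernel C C g \<subseteq> a_kernel C C f" if g: "P g" "a_kernel C C f \<subseteq> a_kernel C C g" for g
  proof (rule kernel_eq_if_eq_on_window[OF K Lc P[OF f(1)] P[OF g(1)]], assumption)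
    have "a_kernel C C f \<inter> ?L = a_kernel C C g \<inter> ?L"
      using f(2) g finL by (intro card_seteq) auto
    then show "a_kernel C C g \<inter> ?L \<subseteq> a_kernel C C f" by blast
  qed
  then show ?thesis using f(1) by blast
qed

lemma surj_on_image:
  assumes f: "chain_map C f" and p: "chain_map C p"
    and inj: "\<And>w. w \<in> f ` carrier C \<Longrightarrow> f (p w) = \<zero> \<Longrightarrow> w = \<zero>"
    and w: "w \<in> f ` carrier C"
  shows "\<exists>w' \<in> f ` carrier C. w = f (p w')"
proof -
  note fD = chain_mapD[OF f] and pD = chain_mapD[OF p]
  obtain c where c: "c \<in> carrier C" "w = f c" using w by blast
  have "\<exists>c' \<in> carrier C. f c = f (p (f c'))"
    using c(1)
  proof (induction rule: homogeneous_induct)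
    case (homogeneous k c)
    let ?W = "f ` hpart C k"
    have "inj_on (\<lambda>w. f (p w)) ?W"
    proof (rule inj_onI)
      fix u v assume uv: "u \<in> ?W" "v \<in> ?W" "f (p u) = f (p v)"
      then obtain a b where ab: "a \<in> carrier C" "b \<in> carrier C" "u = f a" "v = f b"
        using hpart_closed(1) by blast
      have uvc: "u \<in> carrier C" "v \<in> carrier C" using ab fD by auto
      have "f (p (u \<oplus> v)) = \<zero>" using uvc uv(3) by (simp add: fD pD)
      moreover have "u \<oplus> v \<in> f ` carrier C" using ab fD(2)[OF ab(1,2)] by (metis M.a_closed image_eqI)
      ultimately have "u \<oplus> v = \<zero>" using inj by blast
      then show "u = v" using add_eq_zero_iff uvc by blast
    qed
    moreover have "(\<lambda>w. f (p w)) ` ?W \<subseteq> ?W" using fD(6) pD(6) by blast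
    ultimately have "(\<lambda>w. f (p w)) ` ?W = ?W" using finite_hpart by (intro endo_inj_surj) auto
    then have "f c \<in> (\<lambda>w. f (p w)) ` f ` hpart C k" using homogeneous by blast
    then show ?case using hpart_closed(1) by blast
  next
    case (add y z)
    then obtain a b where ab: "a \<in> carrier C" "b \<in> carrier C" "f y = f (p (f a))" "f z = f (p (f b))" by blast
    then have "f (y \<oplus> z) = f (p (f (a \<oplus> b)))" using add by (simp add: fD pD)
    then show ?case using ab by blast
  qed
  then show ?thesis using c by blast
qed

end

section \<open>Graded roots and monotone subroots\<close>

context graded_root
begin

abbreviation "D \<equiv> down M"

lemma edge_verts: "(u, v) \<in> edges M \<Longrightarrow> u \<in> verts M \<and> v \<in> verts M"
  using edges_verts by blast

lemma lower_unique:
  assumes "(u, v) \<in> edges M" "chi M u - chi M v = 1" "(u, w) \<in> edges M" "chi M u - chi M w = 1"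
  shows "v = w"
proof (rule ccontr)
  assume "v \<noteq> w"
  from chi_le_max[OF assms(1,3) this] assms(2,4) show False by (auto simp: max_def split: if_splits)
qed

lemma chi_diff_Ints:
  assumes "u \<in> verts M" "v \<in> verts M" shows "chi M u - chi M v \<in> \<int>"
  using connected[OF assms]
proof (induction rule: rtrancl_induct)
  case (step y z)
  have "chi M y - chi M z \<in> \<int>" using chi_edge[OF step(2)] by auto
  then have "(chi M u - chi M y) + (chi M y - chi M z) \<in> \<int>" using step.IH by (rule Ints_add[rotated])
  then show ?case by simp
qed simp

lemma low_levels:
  obtains K where "\<And>k v. k \<le> K \<Longrightarrow> v \<in> verts M \<Longrightarrow> k - chi M v \<in> \<int> \<Longrightarrow>
    \<exists>w. {u \<in> verts M. chi M u = k} = {w}"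
proof -
  obtain K where K: "\<forall>k \<le> K. (\<exists>v \<in> verts M. k - chi M v \<in> \<int>) \<longrightarrow> card {v \<in> verts M. chi M v = k} = 1"
    using level_single by blast
  have "\<exists>w. {u \<in> verts M. chi M u = k} = {w}" if "k \<le> K" "v \<in> verts M" "k - chi M v \<in> \<int>" for k v
    using K that by (metis card_1_singletonE)
  then show thesis by (rule that)
qed

lemma exists_below:
  assumes "u \<in> verts M" shows "\<exists>w \<in> verts M. chi M w < chi M u"
proof (rule low_levels)
  fix K assume K: "\<And>k v. k \<le> K \<Longrightarrow> v \<in> verts M \<Longrightarrow> k - chi M v \<in> \<int> \<Longrightarrow>
    \<exists>w. {u \<in> verts M. chi M u = k} = {w}"
  \<comment> \<open>At least one, to be strictly below \<open>u\<close>; and large enough to reach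
    the levels that consist of one vertex.\<close>
  define n where "n = max 1 \<lceil>chi M u - K\<rceil>"
  have n: "of_int n \<ge> (1::rat)" "of_int n \<ge> chi M u - K"
    unfolding n_def by (simp, metis le_of_int_ceiling max.coboundedI2 of_int_max)
  have "chi M u - of_int n \<le> K" using n by linarith
  moreover have "chi M u - of_int n - chi M u \<in> \<int>" by simp
  ultimately obtain w where "{v \<in> verts M. chi M v = chi M u - of_int n} = {w}" using K assms by blast
  then have "w \<in> verts M" "chi M w = chi M u - of_int n" by auto
  then show ?thesis using n(1) by (intro bexI[of _ w]) linarith+
qed

text \<open>If \<open>u\<close> had no lower neighbour, everything reachable from \<open>u\<close> would be reached by
  ascending paths, since an ascended vertex has its predecessor as its only lower neighbour.\<close>

lemma lower_exists:
  assumes u: "u \<in> verts M" shows "\<exists>w. (u, w) \<in> edges M \<and> chi M u - chi M w = 1"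
proof (rule ccontr)
  assume no: "\<not> ?thesis"
  define R where "R = {(x, y). (x, y) \<in> edges M \<and> chi M y - chi M x = 1}"
  have ge: "chi M x \<ge> chi M u" if "(u, x) \<in> R\<^sup>*" for x
    using that by induction (auto simp: R_def)
  have "(u, x) \<in> R\<^sup>*" if "(u, x) \<in> (edges M)\<^sup>*" for x
    using that
  proof (induction rule: rtrancl_induct)
    case (step y z)
    show ?case
    proof (cases "chi M z - chi M y = 1")
      case True
      then have "(y, z) \<in> R" using step by (simp add: R_def)
      then show ?thesis using step.IH by (rule rtrancl_into_rtrancl[rotated])
    next
      case False
      then have low: "chi M y - chi M z = 1" using chi_edge[OF step(2)] by linarith
      from step.IH show ?thesis
      proof (cases rule: rtranclE)
        case base then show ?thesis using low step no by blast
      next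
        case (step x)
        then have "(y, x) \<in> edges M" "chi M y - chi M x = 1"
          using edges_sym by (auto simp: R_def sym_def)
        then have "x = z" using low \<open>(y, z) \<in> edges M\<close> lower_unique by blast
        then show ?thesis using step by simp
      qed
    qed
  qed simp
  then have "chi M x \<ge> chi M u" if "x \<in> verts M" for x using ge connected[OF u that] by blast
  then show False using exists_below[OF u] by force
qed

lemma down_eqI:
  assumes "(v, w) \<in> edges M" "chi M v - chi M w = 1" shows "D v = w"
  unfolding down_def using assms lower_unique by blast

lemma down_props:
  assumes "v \<in> verts M"
  shows "(v, D v) \<in> edges M" "chi M (D v) = chi M v - 1" "D v \<in> verts M"
proof -
  obtain w where w: "(v, w) \<in> edges M" "chi M v - chi M w = 1" using lower_exists[OF assms] by blast
  then have "D v = w" by (rule down_eqI)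
  then show "(v, D v) \<in> edges M" "chi M (D v) = chi M v - 1" "D v \<in> verts M"
    using w edge_verts[OF w(1)] by simp_all
qed

lemma down_pow_props:
  assumes "v \<in> verts M"
  shows "(D ^^ n) v \<in> verts M" "chi M ((D ^^ n) v) = chi M v - of_nat n"
  using assms by (induction n) (auto simp: down_props)

text \<open>Far enough down a level has only one vertex, so the two descending paths must
  meet.\<close>

lemma down_pow_merge:
  assumes uv: "u \<in> verts M" "v \<in> verts M" "chi M u = chi M v"
  obtains N where "\<And>n. n \<ge> N \<Longrightarrow> (D ^^ n) u = (D ^^ n) v"
proof (rule low_levels)
  fix K assume K: "\<And>k v. k \<le> K \<Longrightarrow> v \<in> verts M \<Longrightarrow> k - chi M v \<in> \<int> \<Longrightarrow>
    \<exists>w. {u \<in> verts M. chi M u = k} = {w}"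
  have "(D ^^ n) u = (D ^^ n) v" if n: "n \<ge> nat \<lceil>chi M u - K\<rceil>" for n
  proof -
    have "of_nat n \<ge> chi M u - K" using n by linarith
    then have "chi M u - of_nat n \<le> K" by linarith
    moreover have "chi M u - of_nat n - chi M u \<in> \<int>" by simp
    ultimately obtain w where w: "{x \<in> verts M. chi M x = chi M u - of_nat n} = {w}" using K uv by blast
    have "(D ^^ n) u \<in> {x \<in> verts M. chi M x = chi M u - of_nat n}"
      "(D ^^ n) v \<in> {x \<in> verts M. chi M x = chi M u - of_nat n}"
      using down_pow_props uv by auto
    then show ?thesis unfolding w by simp
  qed
  then show thesis by (rule that)
qed

end

locale degree_graded_root = graded_root +
  fixes gr :: "'a \<Rightarrow> int"
  assumes degree: "degree_function M gr"
begin

lemma gr_chi: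
  "u \<in> verts M \<Longrightarrow> v \<in> verts M \<Longrightarrow> of_int (gr u) = of_int (gr v) + 2 * (chi M u - chi M v)"
  using degree unfolding degree_function_def by fastforce

lemma gr_eq_iff: "u \<in> verts M \<Longrightarrow> v \<in> verts M \<Longrightarrow> gr u = gr v \<longleftrightarrow> chi M u = chi M v"
  using gr_chi[of u v] by (metis add_cancel_left_right diff_eq_diff_eq diff_self mult_eq_0_iff of_int_eq_iff zero_neq_numeral right_minus_eq)

lemma gr_down_pow:
  assumes "v \<in> verts M" shows "gr ((D ^^ n) v) = gr v - 2 * int n"
proof -
  have "(of_int (gr ((D ^^ n) v)) :: rat) = of_int (gr v - 2 * int n)"
    using gr_chi[OF down_pow_props(1)[OF assms] assms] down_pow_props(2)[OF assms] by simp
  then show ?thesis by (simp only: of_int_eq_iff)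
qed

lemma gr_down: "v \<in> verts M \<Longrightarrow> gr (D v) = gr v - 2"
  using gr_down_pow[of v 1] by simp

lemma gr_even_diff:
  assumes "u \<in> verts M" "v \<in> verts M" shows "even (gr u - gr v)"
proof -
  obtain n where "chi M u - chi M v = of_int n" using chi_diff_Ints[OF assms] by (auto elim: Ints_cases)
  then have "(of_int (gr u) :: rat) = of_int (gr v + 2 * n)" using gr_chi[OF assms] by simp
  then have "gr u = gr v + 2 * n" by (simp only: of_int_eq_iff)
  then show ?thesis by simp
qed

lemma finite_gr_level: "finite {v \<in> verts M. gr v = k}"
proof (cases "{v \<in> verts M. gr v = k} = {}")
  case False
  then obtain v where "v \<in> verts M" "gr v = k" by blast
  then have "{v \<in> verts M. gr v = k} = {u \<in> verts M. chi M u = chi M v}" using gr_eq_iff by auto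
  then show ?thesis using finite_level by simp
next
  case True then show ?thesis by (simp only: finite.emptyI)
qed

lemma gr_bounded: "\<exists>B. \<forall>v \<in> verts M. gr v \<le> B"
proof -
  obtain v where v: "v \<in> verts M" using infinite_verts by fastforce
  obtain b where b: "\<And>u. u \<in> verts M \<Longrightarrow> chi M u \<le> b" using chi_bdd_above by (auto simp: bdd_above_def)
  have "gr u \<le> \<lceil>of_int (gr v) + 2 * (b - chi M v)\<rceil>" if u: "u \<in> verts M" for u
  proof -
    have "(of_int (gr u) :: rat) \<le> of_int (gr v) + 2 * (b - chi M v)"
      using gr_chi[OF u v] b[OF u] by simp
    then show ?thesis by (metis ceiling_mono ceiling_of_int)
  qed
  then show ?thesis by blast
qed

lemma gr_merge:
  assumes "u \<in> verts M" "v \<in> verts M" "gr u = gr v"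
  obtains N where "\<And>n. n \<ge> N \<Longrightarrow> (D ^^ n) u = (D ^^ n) v"
  using down_pow_merge[OF assms(1,2)] assms gr_eq_iff by blast

end

section \<open>The stem and the base of a vertex\<close>

locale degree_symmetric_root = symmetric_graded_root M J\<^sub>0 + degree_graded_root M gr
  for M :: "'v root_graph" and J\<^sub>0 gr
begin

abbreviation "J \<equiv> J\<^sub>0"

lemma J_gr: "v \<in> verts M \<Longrightarrow> gr (J v) = gr v"
  using gr_eq_iff J_verts J_chi by simp

lemma J_down:
  assumes "v \<in> verts M" shows "D (J v) = J (D v)"
proof (rule down_eqI)
  show "(J v, J (D v)) \<in> edges M" using J_edges down_props assms by blast
  show "chi M (J v) - chi M (J (D v)) = 1" using J_chi down_props assms by simp
qed

lemma J_down_pow: "v \<in> verts M \<Longrightarrow> (D ^^ n) (J v) = J ((D ^^ n) v)"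
  by (induction n) (simp_all add: J_down down_pow_props)

lemma stem_down_pow: "v \<in> verts M \<Longrightarrow> J v = v \<Longrightarrow> J ((D ^^ n) v) = (D ^^ n) v"
  using J_down_pow by metis

lemma stem_unique:
  "u \<in> verts M \<Longrightarrow> v \<in> verts M \<Longrightarrow> J u = u \<Longrightarrow> J v = v \<Longrightarrow> gr u = gr v \<Longrightarrow> u = v"
  using J_fixed_unique gr_eq_iff by blast

text \<open>The paths from \<open>v\<close> and \<open>J v\<close> are interchanged by
  \<open>J\<close> and eventually merge, so from there on they are fixed.\<close>

lemma reaches_stem:
  assumes "v \<in> verts M" shows "\<exists>n. J ((D ^^ n) v) = (D ^^ n) v"
proof (rule gr_merge[OF J_verts[OF assms] assms J_gr[OF assms]])
  fix N assume "\<And>n. n \<ge> N \<Longrightarrow> (D ^^ n) (J v) = (D ^^ n) v"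
  then have "(D ^^ N) (J v) = (D ^^ N) v" by blast
  then show ?thesis using J_down_pow[OF assms] by metis
qed

abbreviation "bs \<equiv> base M J gr"

text \<open>A path that has reached the stem stays on it. This numerical criterion replaces the
  least index in the definition of the base in most of what follows.\<close>

lemma stem_iff_le_base:
  assumes v: "v \<in> verts M"
  shows "J ((D ^^ n) v) = (D ^^ n) v \<longleftrightarrow> gr v - 2 * int n \<le> bs v"
proof -
  define h where "h = (LEAST n. J ((D ^^ n) v) = (D ^^ n) v)"
  have h: "J ((D ^^ h) v) = (D ^^ h) v" unfolding h_def using LeastI_ex[OF reaches_stem[OF v]] .
  have "J ((D ^^ n) v) = (D ^^ n) v \<longleftrightarrow> h \<le> n"
  proof
    show "h \<le> n" if "J ((D ^^ n) v) = (D ^^ n) v" unfolding h_def using that by (rule Least_le)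
    assume "h \<le> n"
    then have "(D ^^ n) v = (D ^^ (n - h)) ((D ^^ h) v)" by (metis comp_apply funpow_add le_add_diff_inverse2)
    then show "J ((D ^^ n) v) = (D ^^ n) v" using stem_down_pow[OF down_pow_props(1)[OF v] h] by simp
  qed
  moreover have "bs v = gr v - 2 * int h" unfolding base_def h_def[symmetric] using gr_down_pow[OF v] .
  ultimately show ?thesis by auto
qed

lemma base_even: "v \<in> verts M \<Longrightarrow> even (gr v - bs v)"
  unfolding base_def by (simp add: gr_down_pow)

lemma base_le: "v \<in> verts M \<Longrightarrow> bs v \<le> gr v"
  unfolding base_def by (simp add: gr_down_pow)

lemma stem_iff: "v \<in> verts M \<Longrightarrow> J v = v \<longleftrightarrow> bs v = gr v"
  using stem_iff_le_base[of v 0] base_le[of v] by auto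

text \<open>The criterion tests \<open>b\<close> only against degrees of the parity of
  \<open>gr v\<close>, so it pins down \<open>b\<close> once \<open>b\<close> itself has that parity
  and is at most \<open>gr v\<close>.\<close>

lemma base_unique:
  assumes "v \<in> verts M" "b \<le> gr v" "even (gr v - b)" "\<And>n. J ((D ^^ n) v) = (D ^^ n) v \<longleftrightarrow> gr v - 2 * int n \<le> b"
  shows "bs v = b"
proof -
  have *: "gr v - 2 * int n \<le> bs v \<longleftrightarrow> gr v - 2 * int n \<le> b" for n using stem_iff_le_base assms by metis
  obtain m where m: "gr v - b = 2 * m" using assms(3) by blast
  obtain k where k: "gr v - bs v = 2 * k" using base_even[OF assms(1)] by blast
  have "b \<le> bs v" using *[of "nat m"] m assms(2) by simp
  moreover have "bs v \<le> b" using *[of "nat k"] k base_le[OF assms(1)] by simp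
  ultimately show ?thesis by simp
qed

text \<open>Along a path the base is constant until the stem is reached; from there on it is the
  degree.\<close>

lemma base_down_pow:
  assumes v: "v \<in> verts M" shows "bs ((D ^^ n) v) = min (bs v) (gr v - 2 * int n)"
proof (rule base_unique)
  show "(D ^^ n) v \<in> verts M" using down_pow_props v by blast
  show "min (bs v) (gr v - 2 * int n) \<le> gr ((D ^^ n) v)" using gr_down_pow[OF v] by simp
  show "even (gr ((D ^^ n) v) - min (bs v) (gr v - 2 * int n))"
    using gr_down_pow[OF v] base_even[OF v] by (auto simp: min_def)
  fix m
  have "(D ^^ m) ((D ^^ n) v) = (D ^^ (m + n)) v" by (simp add: funpow_add)
  then show "J ((D ^^ m) ((D ^^ n) v)) = (D ^^ m) ((D ^^ n) v) \<longleftrightarrow>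
      gr ((D ^^ n) v) - 2 * int m \<le> min (bs v) (gr v - 2 * int n)"
    using stem_iff_le_base[OF v, of "m + n"] gr_down_pow[OF v] by auto
qed

lemma base_J:
  assumes v: "v \<in> verts M" shows "bs (J v) = bs v"
proof (rule base_unique)
  show "J v \<in> verts M" using J_verts v by blast
  show "bs v \<le> gr (J v)" "even (gr (J v) - bs v)" using J_gr[OF v] base_le[OF v] base_even[OF v] by simp_all
  fix n
  have "J (J ((D ^^ n) v)) = J ((D ^^ n) v) \<longleftrightarrow> J ((D ^^ n) v) = (D ^^ n) v"
    using J_involution[OF down_pow_props(1)[OF v]] by metis
  then show "J ((D ^^ n) (J v)) = (D ^^ n) (J v) \<longleftrightarrow> gr (J v) - 2 * int n \<le> bs v"
    using stem_iff_le_base[OF v] J_down_pow[OF v] J_gr[OF v] by simp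
qed

end

section \<open>The generators of the monotone subroot\<close>

locale tipped_root = degree_symmetric_root M J\<^sub>0 gr
  for M :: "'v root_graph" and J\<^sub>0 gr +
  fixes tip :: "int \<Rightarrow> 'v"
  assumes tips: "tip_choice M J\<^sub>0 gr tip"
begin

abbreviation "top_degree \<equiv> stem_top M J gr"

lemma stem_top_props:
  shows "\<exists>v \<in> verts M. J v = v \<and> gr v = top_degree"
    and "v \<in> verts M \<Longrightarrow> J v = v \<Longrightarrow> gr v \<le> top_degree"
proof -
  obtain u where u: "u \<in> verts M" using infinite_verts by fastforce
  obtain n where n: "J ((D ^^ n) u) = (D ^^ n) u" using reaches_stem[OF u] by blast
  define v0 where "v0 = (D ^^ n) u"
  have v0: "v0 \<in> verts M" "J v0 = v0" using down_pow_props[OF u] n by (simp_all add: v0_def)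
  obtain B where B: "\<forall>v \<in> verts M. gr v \<le> B" using gr_bounded by blast
  \<comment> \<open>Degrees are measured from a fixed stem vertex \<open>v0\<close>, which turns the
    maximum into one over natural numbers.\<close>
  let ?P = "\<lambda>v. v \<in> verts M \<and> J v = v \<and> gr v \<ge> gr v0"
  have "?P v0" using v0 by simp
  moreover have "\<forall>v. ?P v \<longrightarrow> nat (gr v - gr v0) < Suc (nat (B - gr v0))" using B by fastforce
  ultimately have "\<exists>v. ?P v \<and> (\<forall>w. ?P w \<longrightarrow> nat (gr w - gr v0) \<le> nat (gr v - gr v0))"
    by (rule ex_has_greatest_nat)
  then obtain v1 where v1: "?P v1" "\<And>w. ?P w \<Longrightarrow> nat (gr w - gr v0) \<le> nat (gr v1 - gr v0)" by blast
  have max: "gr w \<le> gr v1" if "w \<in> verts M" "J w = w" for w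
    using v1(1) v1(2)[of w] that by (cases "gr w \<ge> gr v0") auto
  have "top_degree = gr v1" unfolding stem_top_def
    using v1(1) max by (intro Greatest_equality) auto
  then show "\<exists>v \<in> verts M. J v = v \<and> gr v = top_degree" "v \<in> verts M \<Longrightarrow> J v = v \<Longrightarrow> gr v \<le> top_degree"
    using v1(1) max by auto
qed

lemma base_le_top:
  assumes v: "v \<in> verts M" shows "bs v \<le> top_degree"
proof -
  obtain n where n: "J ((D ^^ n) v) = (D ^^ n) v" using reaches_stem[OF v] by blast
  have *: "bs v = gr ((D ^^ (LEAST n. J ((D ^^ n) v) = (D ^^ n) v)) v)" by (simp add: base_def)
  show ?thesis unfolding *
    using LeastI[of "\<lambda>n. J ((D ^^ n) v) = (D ^^ n) v", OF n] down_pow_props[OF v] by (intro stem_top_props(2))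
qed

lemma tip_props:
  assumes "nontrivial_cluster M J gr b"
  shows "tip b \<in> verts M" "bs (tip b) = b" "J (tip b) \<noteq> tip b"
    and "w \<in> verts M \<Longrightarrow> bs w = b \<Longrightarrow> gr w \<le> gr (tip b)"
  using tips assms unfolding tip_choice_def cluster_def by auto

text \<open>The first stem vertex below \<open>v\<close> lies in the cluster of \<open>v\<close>, so
  it can only be \<open>v\<close> itself.\<close>

lemma trivial_cluster_stem:
  assumes "\<not> nontrivial_cluster M J gr (bs v)" and v: "v \<in> verts M"
  shows "J v = v"
proof -
  define n where "n = (LEAST n. J ((D ^^ n) v) = (D ^^ n) v)"
  define w where "w = (D ^^ n) v"
  have w: "w \<in> verts M" "J w = w" "gr w = bs v"
    using LeastI_ex[OF reaches_stem[OF v]] down_pow_props[OF v] by (simp_all add: n_def w_def base_def)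
  then have "bs w = bs v" using stem_iff by simp
  then have "v = w" using assms w v unfolding nontrivial_cluster_def cluster_def by blast
  then show ?thesis using w by simp
qed

abbreviation "gens_upto \<equiv> monotone_gens_upto M J gr tip"

lemma gens_upto_cases:
  obtains "gens_upto (Suc n) = gens_upto n"
  | "nontrivial_cluster M J gr (top_degree - int (Suc n))"
    "\<forall>s \<in> gens_upto n. gr s < gr (tip (top_degree - int (Suc n)))"
    "gens_upto (Suc n) = gens_upto n \<union> {tip (top_degree - int (Suc n)), J (tip (top_degree - int (Suc n)))}"
proof (cases "nontrivial_cluster M J gr (top_degree - int (Suc n)) \<and>
    (\<forall>s \<in> gens_upto n. gr s < gr (tip (top_degree - int (Suc n))))")
  case True then show thesis by (intro that(2)) (simp_all add: Let_def)
next
  case False then show thesis by (intro that(1)) (simp only: monotone_gens_upto.simps Let_def if_False)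
qed

lemma gens_upto_mono: "m \<le> n \<Longrightarrow> gens_upto m \<subseteq> gens_upto n"
  by (rule lift_Suc_mono_le[of gens_upto]) (auto simp: Let_def)

lemma gens_upto_props:
  "(\<forall>s \<in> gens_upto n. s \<in> verts M \<and> top_degree - int n \<le> bs s \<and> J s \<in> gens_upto n) \<and>
   (\<forall>s \<in> gens_upto n. \<forall>t \<in> gens_upto n. (bs s = bs t \<longrightarrow> t = s \<or> t = J s) \<and> (bs s < bs t \<longrightarrow> gr t < gr s))"
proof (induction n)
  case 0
  show ?case
  proof (cases "nontrivial_cluster M J gr top_degree")
    case True
    then have "gens_upto 0 = {tip top_degree, J (tip top_degree)}" by (simp add: Let_def)
    then show ?thesis using tip_props[OF True] J_verts J_involution base_J by auto
  next
    case False
    then have "gens_upto 0 = {v \<in> verts M. J v = v \<and> gr v = top_degree}" by (simp add: Let_def)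
    moreover have "bs v = gr v" if "v \<in> verts M" "J v = v" for v using stem_iff that by blast
    ultimately show ?thesis using stem_unique by auto
  qed
next
  case (Suc n)
  show ?case
  proof (cases n rule: gens_upto_cases)
    case 1
    then show ?thesis using Suc.IH by fastforce
  next
    case 2
    let ?b = "top_degree - int (Suc n)"
    note tp = tip_props[OF 2(1)]
    have new: "bs s = ?b \<and> gr s = gr (tip ?b) \<and> s \<in> verts M" if "s \<in> {tip ?b, J (tip ?b)}" for s
      using that tp(1,2) J_verts base_J J_gr by auto
    have old: "bs s > ?b \<and> gr s < gr (tip ?b) \<and> s \<in> verts M \<and> J s \<in> gens_upto n" if "s \<in> gens_upto n" for s
      using Suc.IH 2(2) that by fastforce
    have 1: "\<forall>s \<in> gens_upto (Suc n). s \<in> verts M \<and> top_degree - int (Suc n) \<le> bs s \<and> J s \<in> gens_upto (Suc n)"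
      unfolding 2(3) using new old J_involution[OF tp(1)] by fastforce
    have "(bs s = bs t \<longrightarrow> t = s \<or> t = J s) \<and> (bs s < bs t \<longrightarrow> gr t < gr s)"
      if st: "s \<in> gens_upto (Suc n)" "t \<in> gens_upto (Suc n)" for s t
    proof -
      consider "s \<in> gens_upto n" "t \<in> gens_upto n" | "s \<in> {tip ?b, J (tip ?b)}" "t \<in> gens_upto n"
        | "s \<in> gens_upto n" "t \<in> {tip ?b, J (tip ?b)}"
        | "s \<in> {tip ?b, J (tip ?b)}" "t \<in> {tip ?b, J (tip ?b)}"
        using st unfolding 2(3) by blast
      then show ?thesis
      proof cases
        case 1 then show ?thesis using Suc.IH by blast
      next
        case 2 then show ?thesis using new[OF 2(1)] old[OF 2(2)] by simp
      next
        case 3 then show ?thesis using new[OF 3(2)] old[OF 3(1)] by simp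
      next
        case 4 then show ?thesis using new[OF 4(1)] new[OF 4(2)] J_involution[OF tp(1)] by auto
      qed
    qed
    then show ?thesis using 1 by blast
  qed
qed

text \<open>If the tips of the cluster of \<open>v\<close> were rejected, an earlier generator has
  at least their degree and a larger base. If the cluster is trivial, \<open>v\<close> is on the
  stem and an initial generator dominates it. Folding the root rests on this domination.\<close>

lemma gens_upto_cofinal:
  assumes v: "v \<in> verts M" and "bs v = top_degree - int n"
  shows "\<exists>s \<in> gens_upto n. bs v \<le> bs s \<and> gr v \<le> gr s"
  using assms(2)
proof (cases n)
  case 0
  then have b: "bs v = top_degree" using assms by simp
  show ?thesis
  proof (cases "nontrivial_cluster M J gr top_degree")
    case True
    then have "tip top_degree \<in> gens_upto n" unfolding 0 by (simp add: Let_def)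
    then show ?thesis using tip_props[OF True] v b by force
  next
    case False
    then have "J v = v" using trivial_cluster_stem v b by simp
    then have "v \<in> gens_upto n" unfolding 0 using False stem_iff[OF v] v b by (simp add: Let_def)
    then show ?thesis by blast
  qed
next
  case (Suc m)
  let ?b = "top_degree - int n"
  obtain s0 where s0: "s0 \<in> gens_upto 0"
    using stem_top_props(1) by (cases "nontrivial_cluster M J gr top_degree") (auto simp: Let_def)
  show ?thesis
  proof (cases "nontrivial_cluster M J gr ?b")
    case True
    then have le: "gr v \<le> gr (tip ?b)" using tip_props(4) v assms by simp
    show ?thesis
    proof (cases "\<forall>s \<in> gens_upto m. gr s < gr (tip ?b)")
      case True
      then have "tip ?b \<in> gens_upto n" unfolding Suc using \<open>nontrivial_cluster M J gr ?b\<close>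
        by (simp add: Let_def Suc)
      then show ?thesis using le tip_props(2)[OF \<open>nontrivial_cluster M J gr ?b\<close>] assms by force
    next
      case False
      then obtain s where s: "s \<in> gens_upto m" "gr (tip ?b) \<le> gr s" by force
      then have "s \<in> gens_upto n" "bs s \<ge> ?b" using gens_upto_mono[of m n] gens_upto_props[of m] Suc by force+
      then show ?thesis using s(2) le assms by force
    qed
  next
    case False
    then have "J v = v" using trivial_cluster_stem v assms by simp
    then have "gr v = bs v" using stem_iff v by simp
    moreover have s0': "s0 \<in> gens_upto n" using s0 gens_upto_mono[of 0 n] by blast
    moreover have "s0 \<in> verts M" "?b \<le> bs s0" using gens_upto_props[of n] s0' by blast+
    ultimately show ?thesis using base_le[of s0] assms by force
  qed
qed

abbreviation "gens \<equiv> monotone_gens M J gr tip"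

lemma gens_props:
  assumes "s \<in> gens" shows "s \<in> verts M" "J s \<in> gens"
  using assms gens_upto_props unfolding monotone_gens_def by blast+

lemma gens_monotone:
  assumes "s \<in> gens" "t \<in> gens"
  shows "bs s = bs t \<Longrightarrow> t = s \<or> t = J s" "bs s < bs t \<Longrightarrow> gr t < gr s"
proof -
  obtain m n where "s \<in> gens_upto m" "t \<in> gens_upto n" using assms unfolding monotone_gens_def by blast
  then have "s \<in> gens_upto (max m n)" "t \<in> gens_upto (max m n)"
    using gens_upto_mono[of m "max m n"] gens_upto_mono[of n "max m n"] by auto
  then show "bs s = bs t \<Longrightarrow> t = s \<or> t = J s" "bs s < bs t \<Longrightarrow> gr t < gr s"
    using gens_upto_props[of "max m n"] by blast+
qed

lemma gens_cofinal:
  assumes "v \<in> verts M" shows "\<exists>s \<in> gens. bs v \<le> bs s \<and> gr v \<le> gr s"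
  using gens_upto_cofinal[OF assms, of "nat (top_degree - bs v)"] base_le_top[OF assms]
  unfolding monotone_gens_def by auto

text \<open>The explicit vertex set of the smallest subroot containing the generators, identified as
  such in \<open>monotone_subroot_eq\<close>.\<close>

definition sub_verts :: "'v set" where "sub_verts = {(D ^^ n) s | n s. s \<in> gens}"

lemma sub_vertsE:
  assumes "v \<in> sub_verts" obtains n s where "s \<in> gens" "s \<in> verts M" "v = (D ^^ n) s"
  using assms gens_props unfolding sub_verts_def by blast

lemma sub_verts_closed:
  assumes "v \<in> sub_verts" shows "v \<in> verts M" "D v \<in> sub_verts" "(D ^^ n) v \<in> sub_verts" "J v \<in> sub_verts"
proof -
  obtain m s where s: "s \<in> gens" "s \<in> verts M" "v = (D ^^ m) s" using assms by (rule sub_vertsE)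
  show "v \<in> verts M" using s down_pow_props by simp
  have pow: "(D ^^ k) v \<in> sub_verts" for k unfolding sub_verts_def s(3)
    using s(1) by (metis (mono_tags, lifting) comp_apply funpow_add mem_Collect_eq)
  show "(D ^^ n) v \<in> sub_verts" by (rule pow)
  show "D v \<in> sub_verts" using pow[of 1] by simp
  have "J v = (D ^^ m) (J s)" using J_down_pow s by simp
  then show "J v \<in> sub_verts" unfolding sub_verts_def using gens_props(2)[OF s(1)] by blast
qed

lemma gens_sub_verts: "gens \<subseteq> sub_verts"
proof
  fix s assume "s \<in> gens"
  then show "s \<in> sub_verts" unfolding sub_verts_def by (intro CollectI exI[of _ 0] exI[of _ s]) simp
qed

text \<open>Off the stem a vertex has the same base as the generator above it. The base determines
  that generator up to \<open>J\<close>, and the degree then determines the position below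
  it.\<close>

lemma sub_verts_unique:
  assumes v: "v \<in> sub_verts" and w: "w \<in> sub_verts" and b: "bs v = bs w" and g: "gr v = gr w"
  shows "w = v \<or> w = J v"
proof (cases "J v = v")
  case True
  then show ?thesis using stem_unique[of v w] stem_iff[of v] stem_iff[of w] b g sub_verts_closed(1) v w by metis
next
  case False
  obtain m s where s: "s \<in> gens" "s \<in> verts M" "v = (D ^^ m) s" using v by (rule sub_vertsE)
  obtain n t where t: "t \<in> gens" "t \<in> verts M" "w = (D ^^ n) t" using w by (rule sub_vertsE)
  have "bs v \<noteq> gr v" using False stem_iff[of v] sub_verts_closed(1) v by simp
  then have "bs s = bs v" "bs t = bs w"
    using base_down_pow[OF s(2), of m] base_down_pow[OF t(2), of n] gr_down_pow[OF s(2), of m]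
      gr_down_pow[OF t(2), of n] s(3) t(3) b g by (auto simp: min_def split: if_splits)
  then have eq: "t = s \<or> t = J s" using gens_monotone(1) s t b by simp
  then have "gr t = gr s" using J_gr s by auto
  then have "n = m" using gr_down_pow[OF s(2), of m] gr_down_pow[OF t(2), of n] s(3) t(3) g by simp
  then show ?thesis using eq s t J_down_pow[OF s(2)] by auto
qed

text \<open>Take for \<open>t\<close> the generator above \<open>v\<close>. A vertex
  \<open>w\<close> of the same degree as \<open>t\<close> lies under a generator of at least that
  degree, whose base is by monotonicity no larger than that of \<open>t\<close>; equality leaves
  only the orbit of \<open>t\<close>.\<close>

lemma sub_verts_tip:
  assumes v: "v \<in> sub_verts" and "J v \<noteq> v"
  obtains n t where "t \<in> sub_verts" "v = (D ^^ n) t" "J t \<noteq> t" "bs t = bs v"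
    and "\<And>w. w \<in> sub_verts \<Longrightarrow> gr w = gr t \<Longrightarrow> bs w < bs t \<or> w = t \<or> w = J t"
proof -
  obtain m s where s: "s \<in> gens" "s \<in> verts M" "v = (D ^^ m) s" using v by (rule sub_vertsE)
  show thesis
  proof (rule that[of s m])
    show "s \<in> sub_verts" using s gens_sub_verts by blast
    show "v = (D ^^ m) s" by fact
    show "J s \<noteq> s" using stem_down_pow s assms by metis
    have "bs v \<noteq> gr v" using assms stem_iff[of v] sub_verts_closed(1) v by simp
    then show "bs s = bs v"
      using base_down_pow[OF s(2), of m] gr_down_pow[OF s(2), of m] s(3) by (auto simp: min_def split: if_splits)
    fix w assume w: "w \<in> sub_verts" "gr w = gr s"
    obtain n t where t: "t \<in> gens" "t \<in> verts M" "w = (D ^^ n) t" using w(1) by (rule sub_vertsE)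
    have gt: "gr t = gr s + 2 * int n" using gr_down_pow[OF t(2), of n] w t by simp
    have le: "bs w \<le> bs t" "bs t \<le> bs s"
      using base_down_pow[OF t(2), of n] t(3) gens_monotone(2)[OF s(1) t(1)] gt by (simp, force)
    show "bs w < bs s \<or> w = s \<or> w = J s"
    proof (cases "bs w = bs s")
      case True
      then have eq: "t = s \<or> t = J s" using gens_monotone(1)[OF s(1) t(1)] le by simp
      then have "n = 0" using gt J_gr s by auto
      then show ?thesis using eq t by simp
    qed (use le in auto)
  qed
qed

end

section \<open>Descending sets of vertices as subroots\<close>

context graded_root
begin

lemma descend_in_restriction:
  assumes "v \<in> W" "W \<subseteq> verts M" "\<And>v. v \<in> W \<Longrightarrow> D v \<in> W"
  shows "(v, (D ^^ n) v) \<in> (edges M \<inter> W \<times> W)\<^sup>* \<and> (D ^^ n) v \<in> W"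
proof (induction n)
  case (Suc n)
  then have "((D ^^ n) v, (D ^^ Suc n) v) \<in> edges M \<inter> W \<times> W"
    using assms down_props(1)[of "(D ^^ n) v"] by auto
  then show ?case using Suc by (auto intro: rtrancl_into_rtrancl)
qed (use assms in simp)

lemma common_descendant:
  assumes uv: "u \<in> verts M" "v \<in> verts M"
  obtains m n where "(D ^^ m) u = (D ^^ n) v"
proof -
  have *: "\<exists>m n. (D ^^ m) u = (D ^^ n) v"
    if uv: "u \<in> verts M" "v \<in> verts M" and ge: "chi M u \<ge> chi M v" for u v
  proof -
    obtain k where k: "chi M u - chi M v = of_int k" using chi_diff_Ints[OF uv] by (auto elim: Ints_cases)
    then have "(of_int k :: rat) \<ge> 0" using ge by linarith
    then have "k \<ge> 0" by simp
    then have "chi M ((D ^^ nat k) u) = chi M v" using k down_pow_props(2)[OF uv(1), of "nat k"] by simp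
    then obtain N where "\<And>n. n \<ge> N \<Longrightarrow> (D ^^ n) ((D ^^ nat k) u) = (D ^^ n) v"
      using down_pow_merge[OF down_pow_props(1)[OF uv(1)] uv(2)] by blast
    then have "(D ^^ (N + nat k)) u = (D ^^ N) v" by (simp add: funpow_add)
    then show ?thesis by blast
  qed
  show thesis
  proof (cases "chi M u \<ge> chi M v")
    case True then show thesis using *[OF uv] that by blast
  next
    case False
    then have "chi M v \<ge> chi M u" by simp
    then show thesis using *[OF uv(2,1)] that by metis
  qed
qed

text \<open>Two vertices of \<open>W\<close> are joined through a common descendant, and low levels
  still contain a vertex because a descending path meets them. The remaining conditions pass to
  induced subgraphs.\<close>

lemma restrict_root_graded_root:
  assumes W: "W \<subseteq> verts M" "W \<noteq> {}" "\<And>v. v \<in> W \<Longrightarrow> D v \<in> W"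
  shows "graded_root (restrict_root M W)"
proof -
  let ?E = "edges M \<inter> W \<times> W"
  have simps: "verts (restrict_root M W) = W" "edges (restrict_root M W) = ?E"
    "chi (restrict_root M W) = chi M" by (simp_all add: restrict_root_def)
  have symE: "sym ?E" using edges_sym unfolding sym_def by blast
  have desc: "(v, (D ^^ n) v) \<in> ?E\<^sup>*" "(D ^^ n) v \<in> W" if "v \<in> W" for v n
    using descend_in_restriction[OF that W(1,3)] by auto
  obtain v0 where v0: "v0 \<in> W" "v0 \<in> verts M" using W by blast
  show ?thesis
  proof (unfold_locales, unfold simps)
    show "?E \<subseteq> W \<times> W" by blast
    show "sym ?E" by fact
    show "irrefl ?E" using edges_irrefl by (auto simp: irrefl_def)
    show "infinite W"
    proof
      assume "finite W"
      moreover have "inj (\<lambda>n. (D ^^ n) v0)"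
      proof (rule injI)
        fix m n assume "(D ^^ m) v0 = (D ^^ n) v0"
        then have "chi M v0 - of_nat m = chi M v0 - of_nat n" using down_pow_props(2)[OF v0(2)] by metis
        then show "m = n" by simp
      qed
      moreover have "range (\<lambda>n. (D ^^ n) v0) \<subseteq> W" using desc v0 by blast
      ultimately show False using finite_subset range_inj_infinite by blast
    qed
    show "(u, v) \<in> ?E\<^sup>*" if uv: "u \<in> W" "v \<in> W" for u v
    proof -
      obtain m n where "(D ^^ m) u = (D ^^ n) v" using common_descendant W uv by blast
      moreover have "((D ^^ n) v, v) \<in> ?E\<^sup>*"
        using desc(1)[OF uv(2), of n] sym_rtrancl[OF symE] by (simp add: sym_def)
      ultimately show ?thesis using desc(1)[OF uv(1), of m] by (metis rtrancl_trans)
    qed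
    show "\<nexists>p. length p \<ge> 3 \<and> distinct p \<and> successively (\<lambda>u v. (u, v) \<in> ?E) p \<and> (last p, hd p) \<in> ?E"
    proof
      assume "\<exists>p. length p \<ge> 3 \<and> distinct p \<and> successively (\<lambda>u v. (u, v) \<in> ?E) p \<and> (last p, hd p) \<in> ?E"
      then obtain p where p: "length p \<ge> 3" "distinct p" "successively (\<lambda>u v. (u, v) \<in> ?E) p"
        "(last p, hd p) \<in> ?E" by blast
      have "successively (\<lambda>u v. (u, v) \<in> edges M) p"
        using p(3) by (rule successively_mono) auto
      then show False using p no_cycle by blast
    qed
    show "chi M u - chi M v = 1 \<or> chi M u - chi M v = - 1" if "(u, v) \<in> ?E" for u v
      using that chi_edge by blast
    show "chi M u \<le> max (chi M v) (chi M w)" if "(u, v) \<in> ?E" "(u, w) \<in> ?E" "v \<noteq> w" for u v w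
      using that chi_le_max by blast
    show "bdd_above (chi M ` W)" by (rule bdd_above_mono[OF chi_bdd_above image_mono[OF W(1)]])
    show "finite {v \<in> W. chi M v = k}" for k
      by (rule finite_subset[OF _ finite_level[of k]]) (use W(1) in blast)
    show "\<exists>K. \<forall>k \<le> K. (\<exists>v \<in> W. k - chi M v \<in> \<int>) \<longrightarrow> card {v \<in> W. chi M v = k} = 1"
    proof (rule low_levels)
      fix K assume K: "\<And>k v. k \<le> K \<Longrightarrow> v \<in> verts M \<Longrightarrow> k - chi M v \<in> \<int> \<Longrightarrow>
        \<exists>w. {u \<in> verts M. chi M u = k} = {w}"
      \<comment> \<open>Besides being a one-vertex level of \<open>M\<close>, the level must not lie
        above \<open>v0\<close>, so that the path from \<open>v0\<close> passes through it.\<close>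
      have "card {v \<in> W. chi M v = k} = 1" if k: "k \<le> min K (chi M v0)" "v \<in> W" "k - chi M v \<in> \<int>" for k v
      proof -
        have "v \<in> verts M" using k W by blast
        then obtain w where w: "{u \<in> verts M. chi M u = k} = {w}"
          using K[OF _ \<open>v \<in> verts M\<close> k(3)] k(1) by auto
        have "chi M v0 - k = (chi M v0 - chi M v) - (k - chi M v)" by simp
        then have "chi M v0 - k \<in> \<int>" using chi_diff_Ints[OF v0(2) \<open>v \<in> verts M\<close>] k(3) by (metis Ints_diff)
        then obtain j where j: "chi M v0 - k = of_int j" by (auto elim: Ints_cases)
        then have "(of_int j :: rat) \<ge> 0" using k(1) by simp
        then have "chi M ((D ^^ nat j) v0) = k" using j down_pow_props(2)[OF v0(2), of "nat j"] by simp
        then have "(D ^^ nat j) v0 \<in> {v \<in> W. chi M v = k}" using desc(2)[OF v0(1)] by simp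
        moreover have "{v \<in> W. chi M v = k} \<subseteq> {w}" using w W(1) by blast
        ultimately have "{v \<in> W. chi M v = k} = {w}" by blast
        then show ?thesis by simp
      qed
      then show ?thesis by blast
    qed
  qed
qed

text \<open>A subroot has lower neighbours of its own, and uniqueness in \<open>M\<close> identifies
  them with those of \<open>M\<close>. So every subroot is closed under descent.\<close>

lemma down_restrict_root:
  assumes "graded_root (restrict_root M W)" and v: "v \<in> W"
  shows "down (restrict_root M W) v = D v" "D v \<in> W"
proof -
  interpret W: graded_root "restrict_root M W" by fact
  have v': "v \<in> verts (restrict_root M W)" using v by (simp add: restrict_root_def)
  have "(v, W.D v) \<in> edges M" "W.D v \<in> W" "chi M v - chi M (W.D v) = 1"
    using W.down_props[OF v'] by (simp_all add: restrict_root_def)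
  then show "W.D v = D v" "D v \<in> W" using down_eqI by auto
qed

end

section \<open>The monotone subroot and the folding onto it\<close>

context tipped_root
begin

lemma sub_verts_graded_root: "graded_root (restrict_root M sub_verts)"
proof (rule restrict_root_graded_root)
  show "sub_verts \<subseteq> verts M" using sub_verts_closed by blast
  obtain v where "v \<in> verts M" using infinite_verts by fastforce
  then show "sub_verts \<noteq> {}" using gens_cofinal gens_sub_verts by blast
  show "D v \<in> sub_verts" if "v \<in> sub_verts" for v using sub_verts_closed(2)[OF that] .
qed

lemma monotone_subroot_eq: "monotone_subroot M J gr tip = restrict_root M sub_verts"
proof -
  have "sub_verts \<subseteq> W" if W: "graded_subroot M W" "gens \<subseteq> W" for W
  proof
    fix v assume "v \<in> sub_verts"
    then obtain n s where s: "s \<in> gens" "v = (D ^^ n) s" by (rule sub_vertsE)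
    have "(D ^^ n) s \<in> W"
    proof (induction n)
      case (Suc n) then show ?case using down_restrict_root(2) W(1) unfolding graded_subroot_def by simp
    qed (use s W in auto)
    then show "v \<in> W" using s by simp
  qed
  moreover have "graded_subroot M sub_verts"
    unfolding graded_subroot_def using sub_verts_graded_root sub_verts_closed by blast
  ultimately have "\<Inter>{W. graded_subroot M W \<and> gens \<subseteq> W} = sub_verts"
    using gens_sub_verts by blast
  then show ?thesis unfolding monotone_subroot_def by simp
qed

text \<open>A single generator has to dominate the whole cluster, because the folding must use the
  same generator, up to \<open>J\<close>, along each branch.\<close>

lemma gens_dominate_cluster:
  assumes v: "v \<in> verts M"
  shows "\<exists>s \<in> gens. bs v \<le> bs s \<and> (\<forall>w \<in> verts M. bs w = bs v \<longrightarrow> gr w \<le> gr s)"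
proof (cases "nontrivial_cluster M J gr (bs v)")
  case True
  obtain s where s: "s \<in> gens" "bs (tip (bs v)) \<le> bs s" "gr (tip (bs v)) \<le> gr s"
    using gens_cofinal[OF tip_props(1)[OF True]] by blast
  have "gr w \<le> gr s" if "w \<in> verts M" "bs w = bs v" for w
    using tip_props(4)[OF True that] s(3) by simp
  then show ?thesis using s tip_props(2)[OF True] by auto
next
  case False
  obtain s where s: "s \<in> gens" "bs v \<le> bs s" using gens_cofinal[OF v] by blast
  have "gr w \<le> gr s" if w: "w \<in> verts M" "bs w = bs v" for w
  proof -
    have "J w = w" using trivial_cluster_stem False w by simp
    then have "gr w = bs w" using stem_iff[OF w(1)] by simp
    then show ?thesis using w s base_le[OF gens_props(1)[OF s(1)]] by simp
  qed
  then show ?thesis using s by blast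
qed

text \<open>An off-stem branch of the cluster with base \<open>b\<close> is folded onto the path below a generator
  \<open>s\<close> or \<open>J s\<close> dominating the cluster; the choice between \<open>s\<close> and \<open>J s\<close> has to be
  made equivariantly, depending on the lowest off-stem vertex of the branch.\<close>

lemma equivariant_folding:
  obtains \<rho> where "\<And>v. v \<in> verts M \<Longrightarrow> \<rho> v \<in> sub_verts"
    and "\<And>v. v \<in> verts M \<Longrightarrow> gr (\<rho> v) = gr v"
    and "\<And>v. v \<in> verts M \<Longrightarrow> \<rho> (D v) = D (\<rho> v)"
    and "\<And>v. v \<in> verts M \<Longrightarrow> \<rho> (J v) = J (\<rho> v)"
proof -
  \<comment> \<open>The choice depends on the base alone, hence agrees for \<open>v\<close>, for
    \<open>J v\<close>, and along the off-stem part of a descending path.\<close>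
  define dom where "dom = (\<lambda>b. SOME s. s \<in> gens \<and> b \<le> bs s \<and> (\<forall>w \<in> verts M. bs w = b \<longrightarrow> gr w \<le> gr s))"
  have dom: "dom (bs v) \<in> gens" "bs v \<le> bs (dom (bs v))" "gr v \<le> gr (dom (bs v))" if "v \<in> verts M" for v
  proof -
    have "\<exists>s. s \<in> gens \<and> bs v \<le> bs s \<and> (\<forall>w \<in> verts M. bs w = bs v \<longrightarrow> gr w \<le> gr s)"
      using gens_dominate_cluster[OF that] by blast
    from someI_ex[OF this]
    show "dom (bs v) \<in> gens" "bs v \<le> bs (dom (bs v))" "gr v \<le> gr (dom (bs v))"
      using that unfolding dom_def by blast+
  qed
  \<comment> \<open>Half of \<open>gr v - bs v\<close> steps lead to the stem, so one step fewer
    gives the lowest off-stem vertex below \<open>v\<close>. On the stem the natural subtraction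
    truncates and \<open>c v\<close> is \<open>v\<close>.\<close>
  define c where "c = (\<lambda>v. (D ^^ (nat ((gr v - bs v) div 2) - 1)) v)"
  \<comment> \<open>The choice is made from the unordered pair, which is the same for
    \<open>v\<close> and \<open>J v\<close>; hence exactly one of the two off-stem branches is
    assigned to \<open>dom\<close> and the other to its mirror image.\<close>
  define side where "side = (\<lambda>v. c v = (SOME x. x \<in> {c v, J (c v)}))"
  define t where "t = (\<lambda>v. if side v then dom (bs v) else J (dom (bs v)))"
  define \<rho> where "\<rho> = (\<lambda>v. (D ^^ nat ((gr (dom (bs v)) - gr v) div 2)) (t v))"
  have t: "t v \<in> gens" "t v \<in> verts M" "gr (t v) = gr (dom (bs v))" "bs (t v) = bs (dom (bs v))"
    if "v \<in> verts M" for v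
    using dom(1)[OF that] gens_props J_gr base_J unfolding t_def by auto
  have n2: "2 * int (nat ((gr (dom (bs v)) - gr v) div 2)) = gr (dom (bs v)) - gr v" if "v \<in> verts M" for v
    using gr_even_diff[OF gens_props(1)[OF dom(1)[OF that]] that] dom(3)[OF that] by simp
  have gr\<rho>: "gr (\<rho> v) = gr v" if "v \<in> verts M" for v
    unfolding \<rho>_def using gr_down_pow[OF t(2)[OF that]] t(3)[OF that] n2[OF that] by simp
  have \<rho>sub: "\<rho> v \<in> sub_verts" if "v \<in> verts M" for v
    unfolding \<rho>_def using sub_verts_closed(3) gens_sub_verts t(1)[OF that] by blast
  have \<rho>stem: "J (\<rho> v) = \<rho> v" if v: "v \<in> verts M" "J v = v" for v
  proof -
    have "bs v = gr v" using stem_iff v by simp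
    then show ?thesis unfolding \<rho>_def
      using stem_iff_le_base[OF t(2)[OF v(1)]] t(3,4)[OF v(1)] n2[OF v(1)] dom(2)[OF v(1)] by simp
  qed
  have off: "\<exists>k. gr v - bs v = 2 * int (Suc k)" if v: "v \<in> verts M" "J v \<noteq> v" for v
  proof -
    obtain k where k: "gr v - bs v = 2 * k" using base_even[OF v(1)] by blast
    then have "k > 0" using base_le[OF v(1)] stem_iff[OF v(1)] v(2) by auto
    then have "gr v - bs v = 2 * int (Suc (nat (k - 1)))" using k by simp
    then show ?thesis by blast
  qed
  have half: "nat (2 * int (Suc k) div 2) - 1 = k" for k by simp
  have \<rho>J: "\<rho> (J v) = J (\<rho> v)" if v: "v \<in> verts M" for v
  proof (cases "J v = v")
    case True then show ?thesis using \<rho>stem[OF v True] by simp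
  next
    case False
    obtain k where k: "gr v - bs v = 2 * int (Suc k)" using off[OF v False] by blast
    have cv: "c v = (D ^^ k) v" unfolding c_def k half ..
    have cJ: "c (J v) = J (c v)" unfolding c_def J_gr[OF v] base_J[OF v] using J_down_pow[OF v] by simp
    have JJ: "J (J (c v)) = c v" using J_involution down_pow_props(1)[OF v] cv by simp
    have ne: "J (c v) \<noteq> c v" unfolding cv using stem_iff_le_base[OF v, of k] k by simp
    define e where "e = (SOME x. x \<in> {c v, J (c v)})"
    have "e \<in> {c v, J (c v)}" unfolding e_def by (rule someI[of _ "c v"]) simp
    moreover have "side v \<longleftrightarrow> c v = e" by (simp add: side_def e_def)
    moreover have "side (J v) \<longleftrightarrow> J (c v) = e"
      unfolding side_def cJ JJ e_def by (simp only: insert_commute)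
    ultimately have side: "side (J v) \<longleftrightarrow> \<not> side v" using ne by auto
    have "t (J v) = J (t v)"
      unfolding t_def side base_J[OF v] using J_involution[OF gens_props(1)[OF dom(1)[OF v]]] by simp
    then show ?thesis unfolding \<rho>_def base_J[OF v] J_gr[OF v] using J_down_pow[OF t(2)[OF v]] by simp
  qed
  have \<rho>D: "\<rho> (D v) = D (\<rho> v)" if v: "v \<in> verts M" for v
  proof (cases "J (D v) = D v")
    \<comment> \<open>At the foot of a branch \<open>v\<close> and \<open>D v\<close> may be folded
      along different generators. Both sides are still the unique stem vertex of their
      degree.\<close>
    case True
    note Dv = down_props(3)[OF v]
    have D\<rho>: "D (\<rho> v) = (D ^^ Suc (nat ((gr (dom (bs v)) - gr v) div 2))) (t v)" by (simp add: \<rho>_def)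
    have "gr (D v) = bs (D v)" using stem_iff[OF Dv] True by simp
    moreover have "bs (D v) \<le> bs v" using base_down_pow[OF v, of 1] by simp
    ultimately have "gr v - 2 \<le> bs (t v)" using dom(2)[OF v] t(4)[OF v] gr_down[OF v] by simp
    then have "J (D (\<rho> v)) = D (\<rho> v)"
      unfolding D\<rho> stem_iff_le_base[OF t(2)[OF v]] t(3)[OF v] of_nat_Suc distrib_left n2[OF v] by simp
    moreover have "gr (\<rho> (D v)) = gr (D (\<rho> v))"
      using gr\<rho>[OF Dv] gr\<rho>[OF v] gr_down v sub_verts_closed(1)[OF \<rho>sub[OF v]] by simp
    ultimately show ?thesis
      using stem_unique \<rho>stem[OF Dv True] sub_verts_closed(1) sub_verts_closed(2) \<rho>sub v Dv by blast
  next
    case False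
    note Dv = down_props(3)[OF v]
    obtain k where k: "gr (D v) - bs (D v) = 2 * int (Suc k)" using off[OF Dv False] by blast
    have b: "bs (D v) = bs v" using base_down_pow[OF v, of 1] k gr_down[OF v] by (auto simp: min_def split: if_splits)
    have k': "gr v - bs v = 2 * int (Suc (Suc k))" using k b gr_down[OF v] by simp
    have "c (D v) = c v" unfolding c_def k k' half by (simp add: funpow_swap1)
    then have "t (D v) = t v" unfolding t_def side_def b by simp
    moreover have "nat ((gr (dom (bs v)) - gr (D v)) div 2) = Suc (nat ((gr (dom (bs v)) - gr v) div 2))"
      using gr_down[OF v] dom(3)[OF v] by simp
    ultimately show ?thesis unfolding \<rho>_def b by simp
  qed
  show thesis using that[of \<rho>] \<rho>sub gr\<rho> \<rho>D \<rho>J by blast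
qed

end

section \<open>Endomorphisms of the module of a monotone root\<close>

abbreviation "keys \<equiv> Poly_Mapping.keys"
abbreviation "lookup \<equiv> Poly_Mapping.lookup"

abbreviation vx :: "'v \<Rightarrow> 'v \<Rightarrow>\<^sub>0 bit" where "vx v \<equiv> Poly_Mapping.single v 1"

lemma vertex_map_sum:
  assumes "finite A" "keys x \<subseteq> A"
  shows "vertex_map g x = (\<Sum>v \<in> A. Poly_Mapping.single (g v) (lookup x v))"
  unfolding vertex_map_def using assms
  by (intro sum.mono_neutral_left) (auto simp: in_keys_iff)

lemma vertex_map_zero [simp]: "vertex_map g 0 = 0"
  by (simp add: vertex_map_def)

lemma vertex_map_single [simp]: "vertex_map g (Poly_Mapping.single v c) = Poly_Mapping.single (g v) c"
  by (cases "c = 0") (simp_all add: vertex_map_def)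

lemma vertex_map_add: "vertex_map g (x + y) = vertex_map g x + vertex_map g y"
proof -
  have fin: "finite (keys x \<union> keys y)" by simp
  have "vertex_map g (x + y) = (\<Sum>v \<in> keys x \<union> keys y. Poly_Mapping.single (g v) (lookup (x + y) v))"
    using Poly_Mapping.keys_add by (intro vertex_map_sum fin)
  also have "\<dots> = (\<Sum>v \<in> keys x \<union> keys y. Poly_Mapping.single (g v) (lookup x v) + Poly_Mapping.single (g v) (lookup y v))"
    by (simp only: lookup_add Poly_Mapping.single_add)
  also have "\<dots> = vertex_map g x + vertex_map g y"
    unfolding sum.distrib by (intro arg_cong2[of _ _ _ _ "(+)"] vertex_map_sum[symmetric] fin) auto
  finally show ?thesis .
qed

lemma vertex_map_sum_distrib: "vertex_map g (\<Sum>i \<in> I. f i) = (\<Sum>i \<in> I. vertex_map g (f i))"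
  by (induction I rule: infinite_finite_induct) (simp_all add: vertex_map_add)

lemma vertex_map_compose: "vertex_map f (vertex_map g x) = vertex_map (\<lambda>v. f (g v)) x"
proof -
  have "vertex_map f (vertex_map g x) = (\<Sum>v \<in> keys x. vertex_map f (Poly_Mapping.single (g v) (lookup x v)))"
    by (simp only: vertex_map_def[of g x] vertex_map_sum_distrib)
  then show ?thesis by (simp add: vertex_map_def[of "\<lambda>v. f (g v)"])
qed

lemma vertex_map_cong: "(\<And>v. v \<in> keys x \<Longrightarrow> f v = g v) \<Longrightarrow> vertex_map f x = vertex_map g x"
  unfolding vertex_map_def by (intro sum.cong) auto

lemma keys_vertex_map: "keys (vertex_map g x) \<subseteq> g ` keys x"
proof -
  have "keys (\<Sum>v \<in> A. Poly_Mapping.single (g v) (lookup x v)) \<subseteq> g ` A" if "finite A" for A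
    using that
  proof (induction set: finite)
    case (insert a A)
    let ?s = "Poly_Mapping.single (g a) (lookup x a)" and ?S = "\<Sum>v \<in> A. Poly_Mapping.single (g v) (lookup x v)"
    have "keys (?s + ?S) \<subseteq> keys ?s \<union> keys ?S" by (rule Poly_Mapping.keys_add)
    moreover have "keys ?s \<subseteq> {g a}" by simp
    ultimately show ?case using insert.IH unfolding sum.insert[OF insert.hyps] by blast
  qed simp
  then show ?thesis unfolding vertex_map_def by simp
qed

lemma single_bit: "Poly_Mapping.single v (c :: bit) = (if c = 0 then 0 else vx v)"
  by (cases c) simp_all

lemma bit_add_self': "(x :: 'v \<Rightarrow>\<^sub>0 bit) + x = 0"
  by (rule poly_mapping_eqI) (simp only: lookup_add bit_add_self lookup_zero)

lemma lookup_vx: "lookup (vx v) w = (if v = w then 1 else 0)"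
  by (simp add: lookup_single when_def)

lemma keys_remove:
  fixes x :: "'v \<Rightarrow>\<^sub>0 bit"
  shows "keys (Poly_Mapping.single v (lookup x v) + x) = keys x - {v}"
proof (rule Set.set_eqI)
  fix u
  have eq: "lookup (Poly_Mapping.single v (lookup x v)) u + lookup x u = (if v = u then 0 else lookup x u)"
  proof (cases "v = u")
    case True then show ?thesis by (simp only: lookup_single_eq bit_add_self if_True simp_thms)
  next
    case False then show ?thesis by (simp only: lookup_single_not_eq add_0 if_False simp_thms)
  qed
  show "u \<in> keys (Poly_Mapping.single v (lookup x v) + x) \<longleftrightarrow> u \<in> keys x - {v}"
    unfolding in_keys_iff lookup_add eq Diff_iff by simp
qed

lemma keys_induct [consumes 1, case_names zero add]:
  assumes "keys (x :: 'v \<Rightarrow>\<^sub>0 bit) \<subseteq> A" and "Q 0"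
    and "\<And>v y. v \<in> A \<Longrightarrow> keys y \<subseteq> A \<Longrightarrow> Q y \<Longrightarrow> Q (vx v + y)"
  shows "Q x"
  using assms(1)
proof (induction "card (keys x)" arbitrary: x)
  case 0
  then have "x = 0" by simp
  then show ?case using assms(2) by simp
next
  case (Suc n)
  then obtain v where v: "v \<in> keys x" by fastforce
  let ?y = "vx v + x"
  have lv: "lookup x v = 1" using v by (simp add: in_keys_iff)
  have ky: "keys ?y = keys x - {v}" using keys_remove[of v x] unfolding lv .
  have "n = card (keys ?y)" "keys ?y \<subseteq> A"
    unfolding ky using Suc.hyps(2) Suc.prems v by auto
  then have "Q ?y" by (rule Suc.hyps(1))
  then have "Q (vx v + ?y)" using assms(3) v Suc.prems \<open>keys ?y \<subseteq> A\<close> by blast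
  moreover have "vx v + ?y = x" by (simp only: add.assoc[symmetric] bit_add_self' add_0)
  ultimately show ?case by simp
qed

text \<open>The augmentation: the parity of the number of vertices in the support.\<close>

definition aug :: "('v \<Rightarrow>\<^sub>0 bit) \<Rightarrow> bit" where
  "aug x = (\<Sum>v \<in> keys x. lookup x v)"

lemma aug_add: "aug (x + y) = aug x + aug y"
proof -
  have sup: "aug z = (\<Sum>v \<in> keys x \<union> keys y. lookup z v)" if "keys z \<subseteq> keys x \<union> keys y" for z
    unfolding aug_def using that by (intro sum.mono_neutral_left) (auto simp: in_keys_iff)
  have "aug (x + y) = (\<Sum>v \<in> keys x \<union> keys y. lookup x v + lookup y v)"
    using sup[OF Poly_Mapping.keys_add] by (simp only: lookup_add)
  then show ?thesis unfolding sum.distrib using sup[of x] sup[of y] by simp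
qed

lemma aug_simps [simp]:
  "aug 0 = 0" "aug (Poly_Mapping.single v c) = c" "aug (vertex_map g x) = aug x"
proof -
  show 0: "aug 0 = 0" by (simp add: aug_def)
  show single: "aug (Poly_Mapping.single v c) = c" for v c by (cases "c = 0") (simp_all add: aug_def)
  show "aug (vertex_map g x) = aug x"
    using subset_UNIV
  proof (induction x rule: keys_induct)
    case zero then show ?case by simp
  next
    case (add v y)
    show ?case unfolding vertex_map_add aug_add add(3) vertex_map_single single ..
  qed
qed

lemma vertex_map_inj:
  assumes "inj_on g A" "keys x \<subseteq> A" "keys y \<subseteq> A" "vertex_map g x = vertex_map g y"
  shows "x = y"
proof -
  define h where "h = inv_into A g"
  have id: "vertex_map h (vertex_map g z) = z" if "keys z \<subseteq> A" for z :: "'a \<Rightarrow>\<^sub>0 bit"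
  proof -
    have "vertex_map h (vertex_map g z) = vertex_map (\<lambda>v. v) z"
      unfolding vertex_map_compose h_def using that assms(1) by (intro vertex_map_cong) (auto simp: subset_iff)
    also have "\<dots> = z"
      using subset_UNIV by (rule keys_induct) (simp_all add: vertex_map_add)
    finally show ?thesis .
  qed
  show ?thesis using id[OF assms(2)] id[OF assms(3)] unfolding assms(4) by (rule trans[OF sym])
qed

lemma lookup_vertex_map_inj:
  assumes "inj_on g A" "keys x \<subseteq> A" "v \<in> A"
  shows "lookup (vertex_map g x) (g v) = lookup x v"
  using assms(2)
proof (induction rule: keys_induct)
  case (add w y)
  have "g w = g v \<longleftrightarrow> w = v" using inj_on_eq_iff[OF assms(1)] add(1) assms(3) by blast
  then show ?case unfolding vertex_map_add lookup_add add(3) vertex_map_single lookup_vx by simp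
qed simp

lemma split_off:
  fixes x :: "'v \<Rightarrow>\<^sub>0 bit"
  obtains y where "x = Poly_Mapping.single v (lookup x v) + y" "keys y = keys x - {v}"
proof -
  have "x = Poly_Mapping.single v (lookup x v) + (Poly_Mapping.single v (lookup x v) + x)"
    by (simp only: add.assoc[symmetric] bit_add_self' add_0)
  then show thesis using that keys_remove[of v x] by blast
qed

lemma split_off2:
  fixes x :: "'v \<Rightarrow>\<^sub>0 bit"
  assumes "v \<noteq> w"
  obtains y where "x = Poly_Mapping.single v (lookup x v) + Poly_Mapping.single w (lookup x w) + y"
    "keys y = keys x - {v, w}"
proof -
  obtain z where z: "x = Poly_Mapping.single v (lookup x v) + z" "keys z = keys x - {v}" by (rule split_off)
  obtain y where y: "z = Poly_Mapping.single w (lookup z w) + y" "keys y = keys z - {w}" by (rule split_off)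
  have "lookup x w = lookup z w"
    using assms arg_cong[OF z(1), of "\<lambda>x. lookup x w"] by (simp only: lookup_add lookup_single when_def) simp
  then have "x = Poly_Mapping.single v (lookup x v) + Poly_Mapping.single w (lookup x w) + y"
    using z(1) y(1) by (simp only: add.assoc)
  moreover have "keys y = keys x - {v, w}" using y(2) z(2) by blast
  ultimately show thesis by (rule that)
qed

text \<open>\<open>J\<close> acts freely on the support, so the vertices there come in pairs; the
  induction removes one pair at a time.\<close>

lemma aug_invariant:
  assumes "\<And>v. v \<in> keys x \<Longrightarrow> J (J v) = v" "\<And>v. v \<in> keys x \<Longrightarrow> J v \<noteq> v" "vertex_map J x = x"
  shows "aug x = 0"
  using assms
proof (induction "card (keys x)" arbitrary: x rule: less_induct)
  case less
  show ?case
  proof (cases "keys x = {}")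
    case True
    then have "x = 0" by simp
    then show ?thesis by simp
  next
    case False
    then obtain v where v: "v \<in> keys x" by blast
    have inj: "inj_on J (keys x)" by (rule inj_on_inverseI[of _ J]) (rule less.prems(1))
    have "lookup x (J v) = lookup x v"
      using lookup_vertex_map_inj[OF inj subset_refl v] less.prems(3) by simp
    then have l: "lookup x v = 1" "lookup x (J v) = 1" using v by (simp_all add: in_keys_iff)
    then have Jv: "J v \<in> keys x" by (simp add: in_keys_iff)
    obtain y where y: "x = Poly_Mapping.single v (lookup x v) + Poly_Mapping.single (J v) (lookup x (J v)) + y"
      "keys y = keys x - {v, J v}"
      using split_off2 less.prems(2)[OF v] by metis
    note y1 = y(1)[unfolded l]
    have "vertex_map J x = vx v + vx (J v) + vertex_map J y"
      by (subst y1) (simp only: vertex_map_add vertex_map_single less.prems(1)[OF v] add.commute)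
    from trans[OF sym[OF this] trans[OF less.prems(3) y1]]
    have inv: "vertex_map J y = y" by (simp only: add_left_cancel)
    have "card (keys y) < card (keys x)" unfolding y(2) using v by (intro psubset_card_mono) auto
    then have "aug y = 0" using less.hyps[of y] less.prems(1,2) inv y(2) by blast
    moreover have "aug x = 1 + 1 + aug y" by (subst y1) (simp only: aug_add aug_simps)
    ultimately show ?thesis by (simp only: bit_add_self add_0)
  qed
qed

text \<open>All vertices of one degree eventually merge with \<open>u\<close>, and then only their
  number modulo two is left.\<close>

lemma (in degree_graded_root) vertex_map_down_eventually:
  assumes x: "keys x \<subseteq> {v \<in> verts M. gr v = gr u}" and u: "u \<in> verts M"
  shows "\<exists>N. \<forall>n \<ge> N. vertex_map (D ^^ n) x = Poly_Mapping.single ((D ^^ n) u) (aug x)"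
  using x
proof (induction rule: keys_induct)
  case zero then show ?case by simp
next
  case (add v y)
  then obtain N where N: "\<forall>n \<ge> N. vertex_map (D ^^ n) y = Poly_Mapping.single ((D ^^ n) u) (aug y)" by blast
  obtain N' where N': "\<And>n. n \<ge> N' \<Longrightarrow> (D ^^ n) v = (D ^^ n) u"
    using gr_merge[of v u] add(1) u by blast
  have "vertex_map (D ^^ n) (vx v + y) = Poly_Mapping.single ((D ^^ n) u) (aug (vx v + y))" if "n \<ge> max N N'" for n
  proof -
    have "vertex_map (D ^^ n) y = Poly_Mapping.single ((D ^^ n) u) (aug y)" "(D ^^ n) v = (D ^^ n) u"
      using that N N' by auto
    then show ?thesis
      by (simp only: vertex_map_add vertex_map_single aug_add aug_simps Poly_Mapping.single_add)
  qed
  then show ?case by blast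
qed

context tipped_root
begin

text \<open>For \<open>v\<close> off the stem, it suffices to treat the tip \<open>t\<close> above \<open>v\<close>. Pushed down to
  the base of \<open>t\<close>, the element \<open>G t\<close> becomes \<open>J\<close>-invariant, and pushing down is injective on the
  vertices with smaller base; so the part of \<open>G t\<close> outside \<open>{t, J t}\<close> is \<open>J\<close>-invariant, hence even.\<close>

lemma equivariant_leading_terms:
  assumes supp: "\<And>v. v \<in> sub_verts \<Longrightarrow> keys (G (vx v)) \<subseteq> {w \<in> sub_verts. gr w = gr v}"
    and G_D: "\<And>v. v \<in> sub_verts \<Longrightarrow> G (vx (D v)) = vertex_map D (G (vx v))"
    and G_J: "\<And>v. v \<in> sub_verts \<Longrightarrow> G (vx (J v)) = vertex_map J (G (vx v))"
    and G_aug: "\<And>v. v \<in> sub_verts \<Longrightarrow> aug (G (vx v)) = 1"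
    and v: "v \<in> sub_verts"
  shows "w \<in> keys (G (vx v)) \<Longrightarrow> bs w < bs v \<or> w = v \<or> w = J v"
    and "J v = v \<Longrightarrow> lookup (G (vx v)) v = 1"
    and "J v \<noteq> v \<Longrightarrow> lookup (G (vx v)) v + lookup (G (vx v)) (J v) = 1"
proof -
  have G_Dn: "G (vx ((D ^^ n) u)) = vertex_map (D ^^ n) (G (vx u))" if u: "u \<in> sub_verts" for n u
  proof (induction n)
    case 0
    have "vertex_map (\<lambda>v. v) z = z" for z :: "'v \<Rightarrow>\<^sub>0 bit"
      using subset_UNIV by (rule keys_induct) (simp_all add: vertex_map_add)
    then show ?case by (simp add: id_def)
  next
    case (Suc n)
    then show ?case using G_D[OF sub_verts_closed(3)[OF u], of n] by (simp add: vertex_map_compose comp_def)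
  qed
  have JJ: "J (J w) = w" if "w \<in> sub_verts" for w using J_involution sub_verts_closed(1)[OF that] by simp
  have "(\<forall>w \<in> keys (G (vx v)). bs w < bs v \<or> w = v \<or> w = J v) \<and>
    (if J v = v then lookup (G (vx v)) v = 1 else lookup (G (vx v)) v + lookup (G (vx v)) (J v) = 1)"
  proof (cases "J v = v")
    case True
    define A where "A = G (vx v)"
    have A: "w \<in> sub_verts" "gr w = gr v" if "w \<in> keys A" for w using that supp[OF v] unfolding A_def by auto
    have vv: "v \<in> verts M" and gv: "gr v = bs v" using sub_verts_closed(1)[OF v] stem_iff True by auto
    have stem: "w = v" if "w \<in> keys A" "J w = w" for w
      using stem_unique[OF _ vv that(2) True] A[OF that(1)] sub_verts_closed(1) by blast
    \<comment> \<open>On the stem the base equals the degree, so any other vertex of this degree,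
      being off the stem, has a smaller base.\<close>
    have lead: "bs w < bs v \<or> w = v" if "w \<in> keys A" for w
    proof (cases "J w = w")
      case False
      then show ?thesis using A[OF that] stem_iff[of w] base_le[of w] sub_verts_closed(1) gv by force
    qed (use stem that in blast)
    obtain B where B: "A = Poly_Mapping.single v (lookup A v) + B" "keys B = keys A - {v}" by (rule split_off)
    have "vertex_map J A = A" using G_J[OF v] True by (simp add: A_def)
    then have "Poly_Mapping.single v (lookup A v) + vertex_map J B = Poly_Mapping.single v (lookup A v) + B"
      using B(1) True by (metis vertex_map_add vertex_map_single)
    then have "vertex_map J B = B" by (simp only: add_left_cancel)
    then have "aug B = 0" using A stem JJ B(2) by (intro aug_invariant[of B J]) auto
    then have "aug A = lookup A v" by (subst B(1)) (simp only: aug_add aug_simps add_0_right)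
    then have "lookup A v = 1" using G_aug[OF v] by (simp add: A_def)
    then show ?thesis using True lead unfolding A_def by auto
  next
    case False
    obtain n t where t: "t \<in> sub_verts" "v = (D ^^ n) t" "J t \<noteq> t" "bs t = bs v"
      and top: "\<And>w. w \<in> sub_verts \<Longrightarrow> gr w = gr t \<Longrightarrow> bs w < bs t \<or> w = t \<or> w = J t"
      using sub_verts_tip[OF v False] by blast
    have tv: "t \<in> verts M" using sub_verts_closed(1)[OF t(1)] .
    define A where "A = G (vx t)"
    have A: "w \<in> sub_verts" "gr w = gr t" if "w \<in> keys A" for w using that supp[OF t(1)] unfolding A_def by auto
    define a b where "a = lookup A t" and "b = lookup A (J t)"
    obtain B where B: "A = Poly_Mapping.single t a + Poly_Mapping.single (J t) b + B" "keys B = keys A - {t, J t}"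
      unfolding a_def b_def using t(3) by (metis split_off2)
    have Bk: "w \<in> sub_verts" "gr w = gr t" "bs w < bs t" if "w \<in> keys B" for w
      using that B(2) A top by blast+
    \<comment> \<open>After \<open>m\<close> steps \<open>t\<close> and \<open>J t\<close> arrive
      together at the stem, so their coefficients enter only through \<open>a + b\<close>.\<close>
    obtain m where m: "gr t - 2 * int m = bs t"
    proof -
      obtain k where "gr t - bs t = 2 * k" using base_even[OF tv] by blast
      then show thesis using that[of "nat k"] base_le[OF tv] by simp
    qed
    have stemm: "J ((D ^^ m) t) = (D ^^ m) t" using stem_iff_le_base[OF tv] m by simp
    define X where "X = {w \<in> sub_verts. gr w = gr t \<and> bs w < bs t}"
    \<comment> \<open>The \<open>m\<close> steps do not change the base of a vertex in
      \<open>X\<close>, and base and degree determine it up to \<open>J\<close>. A collision of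
      \<open>w\<close> with \<open>J w\<close> would mean that \<open>w\<close> has already reached
      the stem.\<close>
    have inj: "inj_on (D ^^ m) X"
    proof (rule inj_onI)
      fix w w' assume w: "w \<in> X" "w' \<in> X" and eq: "(D ^^ m) w = (D ^^ m) w'"
      have wv: "w \<in> verts M" "w' \<in> verts M" using w sub_verts_closed(1) by (auto simp: X_def)
      have "bs ((D ^^ m) w) = bs w" "bs ((D ^^ m) w') = bs w'"
        using base_down_pow wv w m by (simp_all add: X_def)
      then have "w' = w \<or> w' = J w" using sub_verts_unique[of w w'] w eq by (simp add: X_def)
      moreover have "w' \<noteq> J w"
      proof
        assume "w' = J w"
        then have "J ((D ^^ m) w) = (D ^^ m) w" using eq J_down_pow[OF wv(1)] by simp
        then show False using stem_iff_le_base[OF wv(1), of m] w(1) m by (simp add: X_def)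
      qed
      ultimately show "w = w'" by blast
    qed
    have BX: "keys B \<subseteq> X" using Bk by (auto simp: X_def)
    have JBX: "keys (vertex_map J B) \<subseteq> X"
    proof -
      have "J w \<in> X" if "w \<in> keys B" for w
        using Bk[OF that] sub_verts_closed J_gr base_J by (simp add: X_def)
      then show ?thesis using keys_vertex_map[of J B] by blast
    qed
    have DA: "vertex_map (D ^^ m) A = G (vx ((D ^^ m) t))" unfolding A_def G_Dn[OF t(1)] ..
    have "vertex_map J (vertex_map (D ^^ m) A) = vertex_map (D ^^ m) A"
      unfolding DA using G_J[OF sub_verts_closed(3)[OF t(1), of m]] stemm by simp
    moreover have "vertex_map (D ^^ m) A = Poly_Mapping.single ((D ^^ m) t) (a + b) + vertex_map (D ^^ m) B"
      by (subst B(1)) (simp only: vertex_map_add vertex_map_single J_down_pow[OF tv] stemm Poly_Mapping.single_add)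
    ultimately have "Poly_Mapping.single ((D ^^ m) t) (a + b) + vertex_map J (vertex_map (D ^^ m) B)
        = Poly_Mapping.single ((D ^^ m) t) (a + b) + vertex_map (D ^^ m) B"
      by (simp only: vertex_map_add vertex_map_single stemm)
    then have "vertex_map J (vertex_map (D ^^ m) B) = vertex_map (D ^^ m) B" by (simp only: add_left_cancel)
    moreover have "vertex_map (D ^^ m) (vertex_map J B) = vertex_map J (vertex_map (D ^^ m) B)"
      unfolding vertex_map_compose using Bk(1) sub_verts_closed(1) J_down_pow by (intro vertex_map_cong) blast
    ultimately have "vertex_map J B = B" using vertex_map_inj[OF inj JBX BX] by simp
    moreover have "J w \<noteq> w" if "w \<in> keys B" for w
      using Bk[OF that] stem_iff[OF sub_verts_closed(1)[OF Bk(1)[OF that]]] base_le[OF tv] by auto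
    ultimately have "aug B = 0" using Bk(1) JJ by (intro aug_invariant[of B J]) auto
    then have "aug A = a + b" by (subst B(1)) (simp only: aug_add aug_simps add_0_right)
    then have ab: "a + b = 1" using G_aug[OF t(1)] by (simp only: A_def)
    have Gv: "G (vx v) = Poly_Mapping.single v a + Poly_Mapping.single (J v) b + vertex_map (D ^^ n) B"
      unfolding t(2) G_Dn[OF t(1)] A_def[symmetric]
      by (subst B(1)) (simp only: vertex_map_add vertex_map_single J_down_pow[OF tv])
    have low: "bs w < bs v" if "w \<in> keys (vertex_map (D ^^ n) B)" for w
    proof -
      obtain u where u: "u \<in> keys B" "w = (D ^^ n) u" using keys_vertex_map[of "D ^^ n" B] \<open>w \<in> _\<close> by blast
      then show ?thesis using base_down_pow[OF sub_verts_closed(1)[OF Bk(1)[OF u(1)]], of n] Bk(3)[OF u(1)] t(4) by simp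
    qed
    have vv: "v \<in> verts M" using sub_verts_closed(1)[OF v] .
    have "v \<notin> keys (vertex_map (D ^^ n) B)" "J v \<notin> keys (vertex_map (D ^^ n) B)"
      using low[of v] low[of "J v"] base_J[OF vv] by auto
    then have "lookup (vertex_map (D ^^ n) B) v = 0" "lookup (vertex_map (D ^^ n) B) (J v) = 0"
      by (simp_all add: in_keys_iff)
    then have "lookup (G (vx v)) v = a" "lookup (G (vx v)) (J v) = b"
      unfolding Gv lookup_add lookup_single when_def using False by simp_all
    moreover have "bs w < bs v \<or> w = v \<or> w = J v" if "w \<in> keys (G (vx v))" for w
    proof -
      have "w \<in> keys (Poly_Mapping.single v a) \<union> keys (Poly_Mapping.single (J v) b) \<union> keys (vertex_map (D ^^ n) B)"
        using subsetD[OF Poly_Mapping.keys_add that[unfolded Gv]]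
          Poly_Mapping.keys_add[of "Poly_Mapping.single v a" "Poly_Mapping.single (J v) b"] by blast
      then show ?thesis using low[of w] by (auto split: if_splits)
    qed
    ultimately show ?thesis using False ab by simp
  qed
  then show "w \<in> keys (G (vx v)) \<Longrightarrow> bs w < bs v \<or> w = v \<or> w = J v"
    and "J v = v \<Longrightarrow> lookup (G (vx v)) v = 1"
    and "J v \<noteq> v \<Longrightarrow> lookup (G (vx v)) v + lookup (G (vx v)) (J v) = 1"
    by auto
qed

text \<open>Choose \<open>v\<close> of largest base in the support of \<open>x\<close>. By
  triangularity the coefficients of \<open>G x\<close> at \<open>v\<close> and \<open>J v\<close>
  come only from those of \<open>x\<close> at \<open>v\<close> and \<open>J v\<close>. On the stem
  the factor is \<open>1\<close>; off the stem it is the symmetric matrix with diagonal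
  \<open>p\<close> and off-diagonal \<open>q\<close>, which is invertible because
  \<open>p + q = 1\<close>.\<close>

lemma equivariant_endomorphism_injective:
  assumes add: "\<And>x y. keys x \<subseteq> sub_verts \<Longrightarrow> keys y \<subseteq> sub_verts \<Longrightarrow> G (x + y) = G x + G y"
    and supp: "\<And>v. v \<in> sub_verts \<Longrightarrow> keys (G (vx v)) \<subseteq> {w \<in> sub_verts. gr w = gr v}"
    and G_D: "\<And>v. v \<in> sub_verts \<Longrightarrow> G (vx (D v)) = vertex_map D (G (vx v))"
    and G_J: "\<And>v. v \<in> sub_verts \<Longrightarrow> G (vx (J v)) = vertex_map J (G (vx v))"
    and G_aug: "\<And>v. v \<in> sub_verts \<Longrightarrow> aug (G (vx v)) = 1"
    and x: "keys x \<subseteq> sub_verts" "G x = 0"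
  shows "x = 0"
proof (rule ccontr)
  assume "x \<noteq> 0"
  then have ne: "keys x \<noteq> {}" by simp
  note lead = equivariant_leading_terms[of G, OF supp G_D G_J G_aug]
  have G0: "G 0 = 0" using add[of 0 0] by simp
  have "Max (bs ` keys x) \<in> bs ` keys x" using ne by (intro Max_in) auto
  then obtain v where v: "v \<in> keys x" "bs v = Max (bs ` keys x)" by force
  have max: "bs w \<le> bs v" if "w \<in> keys x" for w unfolding v(2) using that by (intro Max_ge) auto
  have vs: "v \<in> sub_verts" using v x by blast
  have Js: "J v \<in> sub_verts" using sub_verts_closed(4)[OF vs] .
  have lv: "lookup x v = 1" using v by (simp add: in_keys_iff)
  have GJ0: "lookup (G y) u = 0"
    if "u = v \<or> u = J v" "keys y \<subseteq> keys x - {v, J v}" for u y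
    using that(2)
  proof (induction rule: keys_induct)
    case zero then show ?case by (simp add: G0)
  next
    case (add w y)
    have w: "w \<in> sub_verts" "w \<in> keys x" "w \<noteq> v" "w \<noteq> J v" using add(1) x by auto
    have "bs u = bs v" using that(1) base_J sub_verts_closed(1)[OF vs] by auto
    moreover have "u \<noteq> w" "u \<noteq> J w"
      using that(1) w J_involution sub_verts_closed(1)[OF w(1)] sub_verts_closed(1)[OF vs] by metis+
    ultimately have "u \<notin> keys (G (vx w))" using lead(1)[OF _ _ _ _ w(1), of u] max[OF w(2)] by force
    then have "lookup (G (vx w)) u = 0" by (simp add: in_keys_iff)
    moreover have "G (vx w + y) = G (vx w) + G y" using add(2) w x by (intro assms(1)) auto
    ultimately show ?case using add(3) by (simp only: lookup_add) simp
  qed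
  show False
  proof (cases "J v = v")
    case True
    obtain y where y: "x = Poly_Mapping.single v (lookup x v) + y" "keys y = keys x - {v}" by (rule split_off)
    have "G x = G (vx v) + G y"
      by (subst y(1)) (use y(2) x vs lv in \<open>auto intro!: add\<close>)
    moreover have "lookup (G y) v = 0" using GJ0[of v y] y(2) True by simp
    moreover have "lookup (G (vx v)) v = 1" using lead(2)[OF _ _ _ _ vs True] by simp
    ultimately have "lookup (G x) v = 1 + 0" by (simp only: lookup_add)
    then show False using x(2) by simp
  next
    case False
    define b where "b = lookup x (J v)"
    obtain y where y: "x = vx v + Poly_Mapping.single (J v) b + y" "keys y = keys x - {v, J v}"
      using split_off2[of v "J v" x] False unfolding b_def lv by metis
    define p q where "p = lookup (G (vx v)) v" and "q = lookup (G (vx v)) (J v)"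
    have pq: "p + q = 1" unfolding p_def q_def using lead(3)[OF _ _ _ _ vs False] by simp
    have inj: "inj_on J (verts M)" using J_involution by (intro inj_on_inverseI[of _ J])
    have kG: "keys (G (vx v)) \<subseteq> verts M" using supp[OF vs] sub_verts_closed(1) by blast
    have vv: "v \<in> verts M" "J v \<in> verts M" using sub_verts_closed(1) vs Js by blast+
    have l1: "lookup (G (vx (J v))) (J v) = p"
      unfolding G_J[OF vs] p_def by (rule lookup_vertex_map_inj[OF inj kG vv(1)])
    have l2: "lookup (G (vx (J v))) v = q"
      using lookup_vertex_map_inj[OF inj kG vv(2)] J_involution[OF vv(1)] unfolding G_J[OF vs] q_def by simp
    have l3: "lookup (G y) v = 0" "lookup (G y) (J v) = 0" using GJ0[of v y] GJ0[of "J v" y] y(2) by simp_all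
    have "G x = G (vx v) + G (Poly_Mapping.single (J v) b) + G y"
    proof -
      have "keys (vx v) \<subseteq> sub_verts" "keys (Poly_Mapping.single (J v) b) \<subseteq> sub_verts" "keys y \<subseteq> sub_verts"
        using vs Js x y(2) by auto
      moreover from this have "keys (vx v + Poly_Mapping.single (J v) b) \<subseteq> sub_verts"
        using Poly_Mapping.keys_add[of "vx v" "Poly_Mapping.single (J v) b"] by blast
      ultimately show ?thesis by (subst y(1)) (simp only: add)
    qed
    then have eq: "G x = G (vx v) + (if b = 0 then 0 else G (vx (J v))) + G y"
      by (subst (asm) single_bit) (simp only: G0 if_distrib[of G])
    have "lookup (G x) v = p + (if b = 0 then 0 else q) + 0"
      "lookup (G x) (J v) = q + (if b = 0 then 0 else p) + 0"
      unfolding eq lookup_add l3 p_def[symmetric] q_def[symmetric]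
      by (cases "b = 0"; simp only: if_True if_False simp_thms lookup_zero l1 l2)+
    then have "0 = p + (if b = 0 then 0 else q) + 0" "0 = q + (if b = 0 then 0 else p) + 0"
      unfolding x(2) lookup_zero by this
    then show False using pq by (cases "b = 0"; cases p; cases q) auto
  qed
qed

end

lemma U_power_monom: "U ^ n = Polynomial.monom 1 n"
  by (simp add: monom_altdef)

lemma Hminus_simps [simp]:
  "carrier (Hminus M gr) = {x. keys x \<subseteq> verts M}" "\<zero>\<^bsub>Hminus M gr\<^esub> = 0"
  "x \<oplus>\<^bsub>Hminus M gr\<^esub> y = x + y"
  "hpart (Hminus M gr) k = {x. keys x \<subseteq> {v \<in> verts M. gr v = k}}"
  by (simp_all add: Hminus_def)

lemma Hminus_U_power: "(U ^ n) \<odot>\<^bsub>Hminus M gr\<^esub> x = vertex_map (down M ^^ n) x"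
proof -
  have "(\<Sum>i \<le> degree (Polynomial.monom (1 :: bit) n). Poly_Mapping.single ((down M ^^ i) v)
      (coeff (Polynomial.monom 1 n) i * c)) = Poly_Mapping.single ((down M ^^ n) v) c" (is "?L v c = _")
    for v and c :: bit
  proof -
    have "?L v c = (\<Sum>i \<le> n. if n = i then Poly_Mapping.single ((down M ^^ n) v) c else 0)"
      by (intro sum.cong) (auto simp: degree_monom_eq)
    then show ?thesis by simp
  qed
  then show ?thesis unfolding U_power_monom Hminus_def vertex_map_def by simp
qed

text \<open>The root module of \<open>M'\<close> is built from its own \<open>down\<close>; on a set
  where the two descents agree the actions are compared here.\<close>

lemma Hminus_restrict_smult:
  assumes "\<And>v. v \<in> W \<Longrightarrow> down M' v = down M v \<and> down M v \<in> W" and "keys x \<subseteq> W"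
  shows "p \<odot>\<^bsub>Hminus M' gr\<^esub> x = p \<odot>\<^bsub>Hminus M gr\<^esub> x"
proof -
  have "(down M' ^^ n) v = (down M ^^ n) v \<and> (down M ^^ n) v \<in> W" if "v \<in> W" for v n
    using that by (induction n) (auto simp: assms(1))
  then show ?thesis unfolding Hminus_def using assms(2) by (auto intro!: sum.cong)
qed

section \<open>Connected homology\<close>

locale root_homology = free_complex C + tipped_root M J\<^sub>0 gr tip
  for C :: "'a chain_cx" (structure) and M :: "'v root_graph" and J\<^sub>0 gr tip +
  fixes \<iota> :: "'a \<Rightarrow> 'a" and \<phi> :: "'a set \<Rightarrow> ('v \<Rightarrow>\<^sub>0 bit)"
  assumes iota: "chain_map C \<iota>"
    and iso: "graded_iso (homology C) (Hminus M gr) \<phi>"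
    and equivariant: "\<And>X. X \<in> carrier (homology C) \<Longrightarrow> \<phi> (homology_map C \<iota> X) = vertex_map J\<^sub>0 (\<phi> X)"
begin

text \<open>The identification of homology with the root module, read on cycles so that most
  arguments avoid cosets.\<close>

definition \<psi> :: "'a \<Rightarrow> ('v \<Rightarrow>\<^sub>0 bit)" where "\<psi> z = \<phi> (cls z)"

abbreviation "HM \<equiv> Hminus M gr"

lemma phi_linear: "graded_linear 0 (homology C) HM \<phi>"
  using iso by (simp add: graded_iso_def)

lemma psi_verts: "z \<in> cycles C \<Longrightarrow> keys (\<psi> z) \<subseteq> verts M"
  using graded_linearD(1)[OF phi_linear homology_cls(1)] by (simp add: \<psi>_def)

lemma psi_add: "z \<in> cycles C \<Longrightarrow> z' \<in> cycles C \<Longrightarrow> \<psi> (z \<oplus> z') = \<psi> z + \<psi> z'"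
  using graded_linearD(2)[OF phi_linear homology_cls(1) homology_cls(1), of z z']
  by (simp add: \<psi>_def homology_cls(2))

lemma psi_smult: "z \<in> cycles C \<Longrightarrow> \<psi> (p \<odot> z) = p \<odot>\<^bsub>HM\<^esub> \<psi> z"
  using graded_linearD(3)[OF phi_linear homology_cls(1), of z p]
  by (simp add: \<psi>_def homology_cls(3))

lemma psi_U_power: "z \<in> cycles C \<Longrightarrow> \<psi> ((U ^ n) \<odot> z) = vertex_map (D ^^ n) (\<psi> z)"
  using psi_smult[of z "U ^ n"] by (simp add: Hminus_U_power)

lemma psi_U: "z \<in> cycles C \<Longrightarrow> \<psi> (U \<odot> z) = vertex_map D (\<psi> z)"
  using psi_U_power[of z 1] by simp

lemma psi_zero: "\<psi> \<zero> = 0"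
  using psi_add[OF cycles_closed(1) cycles_closed(1)] by simp

lemma psi_eq_iff:
  assumes "z \<in> cycles C" "z' \<in> cycles C"
  shows "\<psi> z = \<psi> z' \<longleftrightarrow> z \<oplus> z' \<in> boundaries C"
proof -
  have "inj_on \<phi> (carrier (homology C))" using iso by (auto simp: graded_iso_def bij_betw_def)
  then have "\<psi> z = \<psi> z' \<longleftrightarrow> cls z = cls z'"
    unfolding \<psi>_def using homology_cls(1)[OF assms(1)] homology_cls(1)[OF assms(2)] by (rule inj_on_eq_iff)
  then show ?thesis using homology_cls(5)[OF assms] by simp
qed

lemma psi_zero_iff: "z \<in> cycles C \<Longrightarrow> \<psi> z = 0 \<longleftrightarrow> z \<in> boundaries C"
  using psi_eq_iff[of z \<zero>] cycles_closed(1) psi_zero cyclesD(1)[of z] by simp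

lemma psi_hpart: "z \<in> Zh k \<Longrightarrow> keys (\<psi> z) \<subseteq> {v \<in> verts M. gr v = k}"
  using graded_linearD(4)[OF phi_linear, of "cls z" k] by (simp add: \<psi>_def hpart_homology)

lemma psi_surj:
  assumes "keys m \<subseteq> {v \<in> verts M. gr v = k}" shows "\<exists>z \<in> Zh k. \<psi> z = m"
proof -
  have "\<phi> ` hpart (homology C) k = hpart HM k" using iso by (simp add: graded_iso_def)
  then have "m \<in> \<phi> ` cls ` Zh k" using assms by (simp add: hpart_homology)
  then show ?thesis by (auto simp: \<psi>_def)
qed

lemma psi_iota: "z \<in> cycles C \<Longrightarrow> \<psi> (\<iota> z) = vertex_map J (\<psi> z)"
  using equivariant[OF homology_cls(1)] homology_cls(6)[OF iota] by (simp add: \<psi>_def)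

lemma psi_Bh_iff: "z \<in> Zh k \<Longrightarrow> \<psi> z = 0 \<longleftrightarrow> z \<in> Bh k"
  using psi_zero_iff[OF ZhD(4)] boundaries_Bh[of k] by blast

lemma parity: "\<exists>p. \<forall>k. odd (k - p) \<longrightarrow> Zh k \<subseteq> Bh k"
proof -
  obtain v where v: "v \<in> verts M" using infinite_verts by fastforce
  have "z \<in> Bh k" if "odd (k - gr v)" "z \<in> Zh k" for k z
  proof -
    have "{u \<in> verts M. gr u = k} = {}" using gr_even_diff v that(1) by blast
    then have "keys (\<psi> z) = {}" using psi_hpart[OF that(2)] by blast
    then show ?thesis using psi_Bh_iff[OF that(2)] by simp
  qed
  then show ?thesis by blast
qed

text \<open>Equality on homology suffices because all vertices have degrees of one parity:
  \<open>f \<oplus> g\<close> sends cycles to boundaries, and \<open>null_homotopy\<close>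
  applies.\<close>

lemma homotopic_iff:
  assumes f: "chain_map C f" and g: "chain_map C g"
  shows "homotopic C f g \<longleftrightarrow> (\<forall>z \<in> cycles C. \<psi> (f z) = \<psi> (g z))"
proof
  assume "homotopic C f g"
  then obtain h where h: "graded_linear 1 C C h"
    "\<And>x. x \<in> carrier C \<Longrightarrow> f x \<ominus> g x = d (h x) \<oplus> h (d x)" unfolding homotopic_def by blast
  show "\<forall>z \<in> cycles C. \<psi> (f z) = \<psi> (g z)"
  proof
    fix z assume z: "z \<in> cycles C"
    note zc = cyclesD[OF z]
    have hz: "h z \<in> carrier C" using graded_linearD(1)[OF h(1)] zc by blast
    have "f z \<oplus> g z = d (h z)"
      using h(2)[OF zc(1)] minus_eq_add chain_mapD(1)[OF f zc(1)] chain_mapD(1)[OF g zc(1)] zc(2)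
        graded_linear_zero[OF h(1)] d_simps(1)[OF hz] by simp
    then have "f z \<oplus> g z \<in> boundaries C" using hz by (simp add: boundaries_def)
    then show "\<psi> (f z) = \<psi> (g z)" using psi_eq_iff chain_mapD(7) f g z by blast
  qed
next
  assume eq: "\<forall>z \<in> cycles C. \<psi> (f z) = \<psi> (g z)"
  obtain p where p: "\<And>k. odd (k - p) \<Longrightarrow> Zh k \<subseteq> Bh k" using parity by blast
  have fg: "chain_map C (\<lambda>x. f x \<oplus> g x)" using chain_map_add f g by blast
  have "f z \<oplus> g z \<in> Bh k" if z: "z \<in> Zh k" for k z
  proof -
    have zc: "z \<in> cycles C" by (rule ZhD(4)[OF z])
    have "f z \<oplus> g z \<in> boundaries C"
      using eq zc psi_eq_iff[OF chain_mapD(7)[OF f zc] chain_mapD(7)[OF g zc]] by blast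
    then show ?thesis using chain_mapD(9)[OF fg z] boundaries_Bh[of k] by blast
  qed
  then obtain h where "graded_linear 1 C C h" "\<forall>x \<in> carrier C. f x \<oplus> g x = d (h x) \<oplus> h (d x)"
    using null_homotopy[OF fg _ p] by blast
  then show "homotopic C f g"
    unfolding homotopic_def using minus_eq_add chain_mapD(1)[OF f] chain_mapD(1)[OF g] by auto
qed

text \<open>The concrete meaning of an isomorphism after inverting \<open>U\<close>: the localized
  root module has at most one nonzero element in each degree, so a degree-preserving automorphism of
  it is the identity. The exponent may depend on the cycle.\<close>

definition stably_trivial :: "('a \<Rightarrow> 'a) \<Rightarrow> bool" where
  "stably_trivial f \<longleftrightarrow>
    (\<forall>z \<in> cycles C. \<exists>N. \<forall>n \<ge> N. vertex_map (D ^^ n) (\<psi> (f z)) = vertex_map (D ^^ n) (\<psi> z))"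

section \<open>The localization of the homology\<close>

lemma vertex_map_funpow: "vertex_map (D ^^ (m + n)) x = vertex_map (D ^^ m) (vertex_map (D ^^ n) x)"
  unfolding vertex_map_compose by (simp add: funpow_add comp_def)

abbreviation locH (\<open>\<L>\<close>) where "\<L> \<equiv> loc_rel (homology C)"

lemma psi_loc_rel:
  assumes "z \<in> cycles C" "z' \<in> cycles C"
  shows "((cls z, m), (cls z', n)) \<in> \<L> \<longleftrightarrow>
    (\<exists>k. vertex_map (D ^^ (k + n)) (\<psi> z) = vertex_map (D ^^ (k + m)) (\<psi> z'))"
proof -
  have "(U ^ i) \<odot>\<^bsub>homology C\<^esub> cls z = (U ^ j) \<odot>\<^bsub>homology C\<^esub> cls z' \<longleftrightarrow>
      vertex_map (D ^^ i) (\<psi> z) = vertex_map (D ^^ j) (\<psi> z')" for i j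
    using psi_eq_iff[of "(U ^ i) \<odot> z" "(U ^ j) \<odot> z'"] homology_cls(5)[of "(U ^ i) \<odot> z" "(U ^ j) \<odot> z'"]
      assms cycles_closed(3)
    by (simp add: homology_cls(3) psi_U_power)
  then show ?thesis unfolding loc_rel_def using homology_cls(1) assms by simp
qed

lemma loc_rel_trans:
  assumes "z \<in> cycles C" "z' \<in> cycles C" "z'' \<in> cycles C"
    and 1: "((cls z, m), (cls z', n)) \<in> \<L>"
    and 2: "((cls z', n), (cls z'', q)) \<in> \<L>"
  shows "((cls z, m), (cls z'', q)) \<in> \<L>"
proof -
  obtain k where k: "vertex_map (D ^^ (k + n)) (\<psi> z) = vertex_map (D ^^ (k + m)) (\<psi> z')"
    using 1 psi_loc_rel assms by blast
  obtain l where l: "vertex_map (D ^^ (l + q)) (\<psi> z') = vertex_map (D ^^ (l + n)) (\<psi> z'')"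
    using 2 psi_loc_rel assms by blast
  \<comment> \<open>The witness \<open>l + k + n\<close> arises by multiplying the first relation by
    \<open>U ^ (l + q)\<close> and the second by \<open>U ^ (k + m)\<close>; the middle denominator
    contributes the \<open>n\<close>.\<close>
  have "vertex_map (D ^^ ((l + k + n) + q)) (\<psi> z) = vertex_map (D ^^ (l + q)) (vertex_map (D ^^ (k + n)) (\<psi> z))"
    unfolding vertex_map_funpow[symmetric] by (simp add: ac_simps)
  also have "\<dots> = vertex_map (D ^^ (k + m)) (vertex_map (D ^^ (l + q)) (\<psi> z'))"
    unfolding k vertex_map_funpow[symmetric] by (simp add: ac_simps)
  also have "\<dots> = vertex_map (D ^^ ((l + k + n) + m)) (\<psi> z'')"
    unfolding l vertex_map_funpow[symmetric] by (simp add: ac_simps)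
  finally show ?thesis using psi_loc_rel assms by blast
qed

lemma loc_rel_sym:
  "(a, b) \<in> \<L> \<Longrightarrow> (b, a) \<in> \<L>"
  unfolding loc_rel_def by (auto dest: sym)

lemma loc_relE:
  assumes "(a, b) \<in> \<L>"
  obtains z m z' n where "a = (cls z, m)" "b = (cls z', n)" "z \<in> cycles C" "z' \<in> cycles C"
  using assms unfolding loc_rel_def homology_simps(1) by auto

lemma loc_rel_equiv: "equiv (carrier (homology C) \<times> UNIV) (\<L>)"
proof (rule equivI)
  show "\<L> \<subseteq> (carrier (homology C) \<times> UNIV) \<times> (carrier (homology C) \<times> UNIV)"
    by (auto simp: loc_rel_def)
  show "refl_on (carrier (homology C) \<times> UNIV) (\<L>)"
    by (auto simp: loc_rel_def refl_on_def)
  show "sym (\<L>)" using loc_rel_sym by (auto simp: sym_def)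
  show "trans (\<L>)"
  proof (rule transI)
    fix a b c assume ab: "(a, b) \<in> \<L>" and bc: "(b, c) \<in> \<L>"
    obtain z m z' n where 1: "a = (cls z, m)" "b = (cls z', n)" "z \<in> cycles C" "z' \<in> cycles C"
      using ab by (rule loc_relE)
    obtain y k z'' q where 2: "b = (cls y, k)" "c = (cls z'', q)" "y \<in> cycles C" "z'' \<in> cycles C"
      using bc by (rule loc_relE)
    show "(a, c) \<in> \<L>"
      using loc_rel_trans[OF 1(3,4) 2(4)] ab bc unfolding 1(1,2) 2(2) by blast
  qed
qed

abbreviation locmap where "locmap f \<equiv> loc_map (homology C) (homology_map C f)"

text \<open>\<open>loc_map\<close> saturates the image of a class, so the main point is that
  \<open>f\<close> respects the relation between fractions.\<close>

lemma loc_map_class: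
  assumes f: "chain_map C f" and z: "z \<in> cycles C"
  shows "locmap f (\<L> `` {(cls z, m)}) =
    \<L> `` {(cls (f z), m)}"
proof -
  let ?R = "\<L>"
  have fz: "f z \<in> cycles C" using chain_mapD(7)[OF f z] .
  have f_rel: "((cls (f u), i), (cls (f v), j)) \<in> ?R"
    if u: "u \<in> cycles C" "v \<in> cycles C" and r: "((cls u, i), (cls v, j)) \<in> ?R" for u v i j
  proof -
    obtain k where k: "vertex_map (D ^^ (k + j)) (\<psi> u) = vertex_map (D ^^ (k + i)) (\<psi> v)"
      using psi_loc_rel u r by blast
    let ?a = "(U ^ (k + j)) \<odot> u" and ?b = "(U ^ (k + i)) \<odot> v"
    have ab: "?a \<in> cycles C" "?b \<in> cycles C" using u cycles_closed(3) by blast+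
    have "?a \<oplus> ?b \<in> boundaries C" using k psi_eq_iff[OF ab] u by (simp add: psi_U_power)
    then have "f (?a \<oplus> ?b) \<in> boundaries C" by (rule chain_mapD(8)[OF f])
    then have "f ?a \<oplus> f ?b \<in> boundaries C" using chain_mapD(2)[OF f cyclesD(1)[OF ab(1)] cyclesD(1)[OF ab(2)]] by simp
    then have "\<psi> (f ?a) = \<psi> (f ?b)" using psi_eq_iff[OF chain_mapD(7)[OF f ab(1)] chain_mapD(7)[OF f ab(2)]] by simp
    then have "vertex_map (D ^^ (k + j)) (\<psi> (f u)) = vertex_map (D ^^ (k + i)) (\<psi> (f v))"
      using chain_mapD(3)[OF f cyclesD(1)[OF u(1)]] chain_mapD(3)[OF f cyclesD(1)[OF u(2)]]
        psi_U_power chain_mapD(7)[OF f] u by simp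
    then show ?thesis using psi_loc_rel[OF chain_mapD(7)[OF f u(1)] chain_mapD(7)[OF f u(2)]] by blast
  qed
  have refl: "((cls u, i), (cls u, i)) \<in> ?R" if "u \<in> cycles C" for u i
    using psi_loc_rel[OF that that] by blast
  show ?thesis
  proof (intro Set.set_eqI iffI)
    fix c assume "c \<in> locmap f (?R `` {(cls z, m)})"
    then obtain b where b: "b \<in> map_prod (homology_map C f) id ` (?R `` {(cls z, m)})" "(b, c) \<in> ?R"
      unfolding loc_map_def by (elim ImageE) (rule that)
    from b(1) obtain a where a: "((cls z, m), a) \<in> ?R" "b = map_prod (homology_map C f) id a"
      by (elim imageE) (simp only: Image_singleton_iff that)
    obtain w n where w: "a = (cls w, n)" "w \<in> cycles C" using a(1) by (rule loc_relE) (simp only: that)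
    have "((cls (f z), m), (cls (f w), n)) \<in> ?R" using f_rel[OF z w(2)] a(1) w(1) by blast
    moreover have "((cls (f w), n), c) \<in> ?R"
      using b(2) unfolding a(2) w(1) by (simp add: homology_cls(6)[OF f w(2)])
    moreover have "trans ?R" using loc_rel_equiv by (rule equivE)
    ultimately have "((cls (f z), m), c) \<in> ?R" by (rule transD[rotated])
    then show "c \<in> ?R `` {(cls (f z), m)}" by simp
  next
    fix c assume "c \<in> ?R `` {(cls (f z), m)}"
    then have "(map_prod (homology_map C f) id (cls z, m), c) \<in> ?R"
      using homology_cls(6)[OF f z] by simp
    moreover have "(cls z, m) \<in> ?R `` {(cls z, m)}" using refl[OF z, of m] by simp
    ultimately show "c \<in> locmap f (?R `` {(cls z, m)})"
      unfolding loc_map_def by (rule ImageI[OF _ imageI])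
  qed
qed

end

section \<open>Self-local equivalences in terms of the root module\<close>

context root_homology
begin

lemma psi_surj_all:
  assumes "keys m \<subseteq> verts M" shows "\<exists>z \<in> cycles C. \<psi> z = m"
proof -
  have "\<phi> ` carrier (homology C) = carrier HM" using iso by (simp add: graded_iso_def bij_betw_def)
  then have "m \<in> \<phi> ` cls ` cycles C" using assms by (simp add: homology_simps(1))
  then show ?thesis by (auto simp: \<psi>_def)
qed

abbreviation "LH \<equiv> localization (homology C)"

lemma localizationE:
  assumes "c \<in> LH"
  obtains z m where "z \<in> cycles C" "c = \<L> `` {(cls z, m)}"
  using assms unfolding localization_def by (elim quotientE SigmaE homologyE) (simp only: that)

lemma localizationI: "z \<in> cycles C \<Longrightarrow> \<L> `` {(cls z, m)} \<in> LH"
  unfolding localization_def by (intro quotientI SigmaI homology_cls(1)) auto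

lemma class_eq_iff:
  assumes "z \<in> cycles C" "z' \<in> cycles C"
  shows "\<L> `` {(cls z, m)} = \<L> `` {(cls z', n)} \<longleftrightarrow>
    (\<exists>k. vertex_map (D ^^ (k + n)) (\<psi> z) = vertex_map (D ^^ (k + m)) (\<psi> z'))"
  using eq_equiv_class_iff[OF loc_rel_equiv, of "(cls z, m)" "(cls z', n)"] homology_cls(1) assms psi_loc_rel
  by simp

text \<open>Such a map fixes every fraction, since the relation absorbs the power of
  \<open>U\<close> after which \<open>f z\<close> and \<open>z\<close> agree.\<close>

lemma stably_trivial_imp_bij:
  assumes f: "chain_map C f" and triv: "stably_trivial f"
  shows "bij_betw (locmap f) (LH) (LH)"
proof -
  have "locmap f c = id c" if c: "c \<in> LH" for c
  proof -
    obtain z m where z: "z \<in> cycles C" "c = \<L> `` {(cls z, m)}"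
      using c by (rule localizationE)
    obtain N where "\<forall>n \<ge> N. vertex_map (D ^^ n) (\<psi> (f z)) = vertex_map (D ^^ n) (\<psi> z)"
      using triv z(1) unfolding stably_trivial_def by blast
    then have "vertex_map (D ^^ (N + m)) (\<psi> (f z)) = vertex_map (D ^^ (N + m)) (\<psi> z)" by simp
    then have "\<L> `` {(cls (f z), m)} = c"
      unfolding z(2) class_eq_iff[OF chain_mapD(7)[OF f z(1)] z(1)] by blast
    then show ?thesis unfolding z(2) loc_map_class[OF f z(1)] by simp
  qed
  then show ?thesis using bij_betw_cong[of "LH" _ id] by (simp add: bij_betw_id)
qed

lemma funpow_down_additive_mono:
  assumes "vertex_map (D ^^ N) x = vertex_map (D ^^ N) y" "n \<ge> N"
  shows "vertex_map (D ^^ n) x = vertex_map (D ^^ n) y"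
proof -
  have "n = (n - N) + N" using assms(2) by simp
  then show ?thesis using assms(1) vertex_map_funpow by metis
qed

text \<open>Let \<open>z\<close> represent a vertex. If \<open>f z\<close> had even augmentation, a
  power of \<open>U\<close> would kill its class, and the localized map would identify the class of
  \<open>z\<close> with zero; but powers of \<open>U\<close> send a vertex to a vertex. With odd
  augmentation the image of \<open>z\<close> eventually merges with that vertex, and general cycles
  follow by adding vertices.\<close>

lemma bij_imp_stably_trivial:
  assumes f: "chain_map C f"
    and bij: "bij_betw (locmap f) (LH) (LH)"
  shows "stably_trivial f"
proof -
  let ?L = "locmap f"
  have vertex: "\<exists>N. \<forall>n \<ge> N. vertex_map (D ^^ n) (\<psi> (f z)) = vertex_map (D ^^ n) (vx v)"
    if v: "v \<in> verts M" and z: "z \<in> Zh (gr v)" "\<psi> z = vx v" for v z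
  proof -
    have fz: "f z \<in> Zh (gr v)" using chain_mapD(9)[OF f z(1)] .
    obtain N where N: "\<forall>n \<ge> N. vertex_map (D ^^ n) (\<psi> (f z)) = Poly_Mapping.single ((D ^^ n) v) (aug (\<psi> (f z)))"
      using vertex_map_down_eventually[OF psi_hpart[OF fz] v] by blast
    have "aug (\<psi> (f z)) = 1"
    proof (rule ccontr)
      assume "aug (\<psi> (f z)) \<noteq> 1"
      then have "aug (\<psi> (f z)) = 0" by simp
      then have zero: "vertex_map (D ^^ N) (\<psi> (f z)) = 0" using N by simp
      note zc = ZhD(4)[OF z(1)] and fzc = ZhD(4)[OF fz]
      have f0: "f \<zero> = \<zero>" using chain_mapD(5)[OF f] .
      have "?L (\<L> `` {(cls z, 0)}) = ?L (\<L> `` {(cls \<zero>, 0)})"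
        unfolding loc_map_class[OF f zc] loc_map_class[OF f cycles_closed(1)] f0
          class_eq_iff[OF fzc cycles_closed(1)] psi_zero
        using zero by (intro exI[of _ N]) simp
      then have "\<L> `` {(cls z, 0)} = \<L> `` {(cls \<zero>, 0)}"
        using bij_betw_imp_inj_on[OF bij] localizationI[OF zc] localizationI[OF cycles_closed(1)]
        by (simp add: inj_on_eq_iff)
      then obtain k where "vertex_map (D ^^ k) (\<psi> z) = 0"
        unfolding class_eq_iff[OF zc cycles_closed(1)] psi_zero by auto
      then have "lookup (vx ((D ^^ k) v)) ((D ^^ k) v) = lookup 0 ((D ^^ k) v)"
        unfolding z(2) vertex_map_single by (rule arg_cong)
      then show False by simp
    qed
    then show ?thesis using N by auto
  qed
  \<comment> \<open>All representatives of \<open>m\<close> are treated at once, so that the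
    induction step may subtract a chosen cycle \<open>u\<close> for the vertex and apply the
    hypothesis to the rest.\<close>
  have "\<forall>z \<in> cycles C. \<psi> z = m \<longrightarrow> (\<exists>N. vertex_map (D ^^ N) (\<psi> (f z)) = vertex_map (D ^^ N) m)"
    if "keys m \<subseteq> verts M" for m
    using that
  proof (induction rule: keys_induct)
    case zero
    show ?case
    proof (intro ballI impI exI)
      fix z assume z: "z \<in> cycles C" "\<psi> z = 0"
      then have "\<psi> (f z) = 0"
        using psi_zero_iff[OF z(1)] psi_zero_iff[OF chain_mapD(7)[OF f z(1)]] chain_mapD(8)[OF f] by blast
      then show "vertex_map (D ^^ 0) (\<psi> (f z)) = vertex_map (D ^^ 0) 0" by simp
    qed
  next
    case (add v y)
    show ?case
    proof (intro ballI impI)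
      fix z assume z: "z \<in> cycles C" "\<psi> z = vx v + y"
      obtain u where u: "u \<in> Zh (gr v)" "\<psi> u = vx v" using psi_surj[of "vx v" "gr v"] add(1) by auto
      have uc: "u \<in> cycles C" using ZhD(4)[OF u(1)] .
      define w where "w = u \<oplus> z"
      have w: "w \<in> cycles C" "z = u \<oplus> w"
        using uc z(1) cycles_closed(2) cyclesD(1) by (auto simp: w_def)
      have "\<psi> w = vx v + (vx v + y)" unfolding w_def psi_add[OF uc z(1)] u(2) z(2) ..
      also have "\<dots> = y" by (simp only: add.assoc[symmetric] bit_add_self' add_0)
      finally obtain N where N: "vertex_map (D ^^ N) (\<psi> (f w)) = vertex_map (D ^^ N) y" using add(3) w(1) by blast
      obtain N' where N': "\<forall>n \<ge> N'. vertex_map (D ^^ n) (\<psi> (f u)) = vertex_map (D ^^ n) (vx v)"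
        using vertex[OF add(1) u] by blast
      have "\<psi> (f z) = \<psi> (f u) + \<psi> (f w)"
        unfolding w(2) chain_mapD(2)[OF f cyclesD(1)[OF uc] cyclesD(1)[OF w(1)]]
        by (rule psi_add[OF chain_mapD(7)[OF f uc] chain_mapD(7)[OF f w(1)]])
      moreover have "vertex_map (D ^^ (max N N')) (\<psi> (f w)) = vertex_map (D ^^ (max N N')) y"
        by (rule funpow_down_additive_mono[OF N]) simp
      moreover have "vertex_map (D ^^ (max N N')) (\<psi> (f u)) = vertex_map (D ^^ (max N N')) (vx v)" using N' by simp
      ultimately show "\<exists>N. vertex_map (D ^^ N) (\<psi> (f z)) = vertex_map (D ^^ N) (vx v + y)"
        by (intro exI[of _ "max N N'"]) (simp only: vertex_map_add)
    qed
  qed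
  note limit = this
  show ?thesis
    unfolding stably_trivial_def
  proof
    fix z assume z: "z \<in> cycles C"
    obtain N where "vertex_map (D ^^ N) (\<psi> (f z)) = vertex_map (D ^^ N) (\<psi> z)"
      using limit[OF psi_verts[OF z]] z by blast
    then show "\<exists>N. \<forall>n \<ge> N. vertex_map (D ^^ n) (\<psi> (f z)) = vertex_map (D ^^ n) (\<psi> z)"
      using funpow_down_additive_mono by blast
  qed
qed

text \<open>From here on the homotopies and localizations in the definition are replaced by
  conditions on \<open>\<psi>\<close>.\<close>

lemma self_local_iff:
  "self_local_equivalence C \<iota> f \<longleftrightarrow>
    chain_map C f \<and> (\<forall>z \<in> cycles C. \<psi> (f (\<iota> z)) = \<psi> (\<iota> (f z))) \<and> stably_trivial f"
proof -
  have "homotopic C (f \<circ> \<iota>) (\<iota> \<circ> f) \<longleftrightarrow> (\<forall>z \<in> cycles C. \<psi> (f (\<iota> z)) = \<psi> (\<iota> (f z)))" if "chain_map C f"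
    using homotopic_iff[OF chain_map_compose[OF that iota] chain_map_compose[OF iota that]]
    by (simp add: comp_def)
  then show ?thesis
    unfolding self_local_equivalence_def using stably_trivial_imp_bij bij_imp_stably_trivial by blast
qed

lemma self_local_id: "self_local_equivalence C \<iota> (\<lambda>x. x)"
  unfolding self_local_iff stably_trivial_def using chain_map_id by simp

lemma self_local_compose:
  assumes f: "self_local_equivalence C \<iota> f" and g: "self_local_equivalence C \<iota> g"
  shows "self_local_equivalence C \<iota> (\<lambda>x. f (g x))"
proof -
  have cf: "chain_map C f" and cg: "chain_map C g" using f g unfolding self_local_iff by simp_all
  have eq: "\<psi> (f (g (\<iota> z))) = \<psi> (\<iota> (f (g z)))" if z: "z \<in> cycles C" for z
  proof -
    have c: "g (\<iota> z) \<in> cycles C" "\<iota> (g z) \<in> cycles C" "g z \<in> cycles C"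
      using chain_mapD(7)[OF iota] chain_mapD(7)[OF cg] z by simp_all
    have "\<psi> (g (\<iota> z)) = \<psi> (\<iota> (g z))" using g z by (simp add: self_local_iff)
    then have "g (\<iota> z) \<oplus> \<iota> (g z) \<in> boundaries C" using psi_eq_iff c by blast
    then have "f (g (\<iota> z)) \<oplus> f (\<iota> (g z)) \<in> boundaries C"
      unfolding chain_mapD(2)[OF cf cyclesD(1)[OF c(1)] cyclesD(1)[OF c(2)], symmetric]
      by (rule chain_mapD(8)[OF cf])
    then have "\<psi> (f (g (\<iota> z))) = \<psi> (f (\<iota> (g z)))" using psi_eq_iff chain_mapD(7)[OF cf] c by blast
    also have "\<dots> = \<psi> (\<iota> (f (g z)))" using f c(3) by (simp add: self_local_iff)
    finally show ?thesis .
  qed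
  have "stably_trivial (\<lambda>x. f (g x))"
    unfolding stably_trivial_def
  proof
    fix z assume z: "z \<in> cycles C"
    have gz: "g z \<in> cycles C" using chain_mapD(7)[OF cg z] .
    obtain N where N: "\<forall>n \<ge> N. vertex_map (D ^^ n) (\<psi> (g z)) = vertex_map (D ^^ n) (\<psi> z)"
      using g z unfolding self_local_iff stably_trivial_def by blast
    obtain N' where N': "\<forall>n \<ge> N'. vertex_map (D ^^ n) (\<psi> (f (g z))) = vertex_map (D ^^ n) (\<psi> (g z))"
      using f gz unfolding self_local_iff stably_trivial_def by blast
    show "\<exists>N. \<forall>n \<ge> N. vertex_map (D ^^ n) (\<psi> (f (g z))) = vertex_map (D ^^ n) (\<psi> z)"
      using N N' by (intro exI[of _ "max N N'"]) simp
  qed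
  then show ?thesis unfolding self_local_iff using chain_map_compose[OF cf cg] eq by blast
qed

lemma exists_maximal_self_local: "\<exists>f. maximal_self_local_equivalence C \<iota> f"
  unfolding maximal_self_local_equivalence_def kernel_le_def
  using exists_maximal_kernel[of "self_local_equivalence C \<iota>", OF _ self_local_id]
  by (simp add: self_local_iff)

end

lemma finite_bit_supported: "finite A \<Longrightarrow> finite {x :: 'v \<Rightarrow>\<^sub>0 bit. keys x \<subseteq> A}"
proof (rule finite_imageD[of keys])
  assume "finite A"
  then have "finite (Pow A)" by simp
  moreover have "keys ` {x :: 'v \<Rightarrow>\<^sub>0 bit. keys x \<subseteq> A} \<subseteq> Pow A" by blast
  ultimately show "finite (keys ` {x :: 'v \<Rightarrow>\<^sub>0 bit. keys x \<subseteq> A})" by (rule finite_subset[rotated])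
  show "inj_on keys {x :: 'v \<Rightarrow>\<^sub>0 bit. keys x \<subseteq> A}"
  proof (rule inj_onI)
    fix x y :: "'v \<Rightarrow>\<^sub>0 bit" assume eq: "keys x = keys y"
    show "x = y"
    proof (rule poly_mapping_eqI)
      fix v
      have "v \<in> keys x \<longleftrightarrow> v \<in> keys y" using eq by simp
      then show "lookup x v = lookup y v" by (cases "lookup x v"; cases "lookup y v") (simp_all add: in_keys_iff)
    qed
  qed
qed

lemma graded_iso_U_torsion:
  assumes g: "graded_iso N N' g" and zero: "\<zero>\<^bsub>N\<^esub> \<in> carrier N" "g \<zero>\<^bsub>N\<^esub> = \<zero>\<^bsub>N'\<^esub>"
    and smult: "\<And>p x. x \<in> carrier N \<Longrightarrow> p \<odot>\<^bsub>N\<^esub> x \<in> carrier N"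
    and hpart: "\<And>k. hpart N k \<subseteq> carrier N"
  shows "graded_iso (shift_up e (U_torsion N)) (shift_up e (U_torsion N')) g"
proof -
  define T where "T = {x \<in> carrier N. \<exists>n. (U ^ n) \<odot>\<^bsub>N\<^esub> x = \<zero>\<^bsub>N\<^esub>}"
  define T' where "T' = {x \<in> carrier N'. \<exists>n. (U ^ n) \<odot>\<^bsub>N'\<^esub> x = \<zero>\<^bsub>N'\<^esub>}"
  have lin: "graded_linear 0 N N' g" and bij: "bij_betw g (carrier N) (carrier N')"
    and hp: "\<And>k. g ` hpart N k = hpart N' k" using g by (auto simp: graded_iso_def)
  have TT: "g x \<in> T' \<longleftrightarrow> x \<in> T" if x: "x \<in> carrier N" for x
  proof -
    have "(U ^ n) \<odot>\<^bsub>N'\<^esub> g x = \<zero>\<^bsub>N'\<^esub> \<longleftrightarrow> (U ^ n) \<odot>\<^bsub>N\<^esub> x = \<zero>\<^bsub>N\<^esub>" for n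
    proof -
      have "(U ^ n) \<odot>\<^bsub>N'\<^esub> g x = g ((U ^ n) \<odot>\<^bsub>N\<^esub> x)" using graded_linearD(3)[OF lin x] by simp
      then show ?thesis
        using inj_on_eq_iff[OF bij_betw_imp_inj_on[OF bij] smult[OF x, of "U ^ n"] zero(1)] zero(2) by simp
    qed
    then show ?thesis using x graded_linearD(1)[OF lin x] by (simp add: T_def T'_def)
  qed
  have Tc: "T \<subseteq> carrier N" "T' \<subseteq> g ` carrier N"
    using bij by (auto simp: T_def T'_def bij_betw_def)
  have img: "g ` T = T'" using TT Tc by blast
  have hpT: "g ` (hpart N k \<inter> T) = hpart N' k \<inter> T'" for k
  proof (intro equalityI subsetI)
    fix y assume "y \<in> g ` (hpart N k \<inter> T)"
    then obtain x where x: "x \<in> hpart N k" "x \<in> T" "y = g x" by blast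
    have "y \<in> hpart N' k" using imageI[OF x(1), of g] unfolding hp x(3) .
    moreover have "x \<in> carrier N" using x(2) Tc(1) by blast
    ultimately show "y \<in> hpart N' k \<inter> T'" using TT x(2,3) by simp
  next
    fix y assume y: "y \<in> hpart N' k \<inter> T'"
    then have "y \<in> g ` hpart N k" unfolding hp by blast
    then obtain x where x: "x \<in> hpart N k" "y = g x" by blast
    have "x \<in> carrier N" using x(1) hpart by blast
    then have "x \<in> T" using TT y x(2) by simp
    then show "y \<in> g ` (hpart N k \<inter> T)" using x by blast
  qed
  moreover have "bij_betw g T T'" using bij_betw_subset[OF bij Tc(1) img] .
  moreover have "graded_linear 0 (shift_up e (U_torsion N)) (shift_up e (U_torsion N')) g"
  proof -
    have c: "x \<in> carrier N" if "x \<in> T" for x using that Tc(1) by blast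
    have "g \<in> T \<rightarrow> T'" using img by blast
    moreover have "\<forall>k. \<forall>x \<in> hpart N (k - e) \<inter> T. g x \<in> hpart N' (k + 0 - e) \<inter> T'"
      unfolding add_0_right hpT[symmetric] by blast
    ultimately show ?thesis
      using graded_linearD(2,3)[OF lin] c
      unfolding graded_linear_def shift_up_def U_torsion_def submod_def T_def[symmetric] T'_def[symmetric]
      by (intro conjI ballI allI) auto
  qed
  ultimately show ?thesis
    unfolding graded_iso_def by (simp add: shift_up_def U_torsion_def submod_def T_def[symmetric] T'_def[symmetric])
qed

section \<open>Realizing the folding; the image of a maximal map\<close>

context root_homology
begin

lemma cycles_induct [consumes 1, case_names homogeneous add]:
  assumes z: "z \<in> cycles C" and hom: "\<And>k y. y \<in> Zh k \<Longrightarrow> Q y"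
    and add: "\<And>y z. y \<in> cycles C \<Longrightarrow> z \<in> cycles C \<Longrightarrow> Q y \<Longrightarrow> Q z \<Longrightarrow> Q (y \<oplus> z)"
  shows "Q z"
proof -
  note zc = cyclesD[OF z]
  have comp: "hcomp z k \<in> Zh k" for k
  proof (rule ZhI)
    show "hcomp z k \<in> hpart C k" using hcomp_props(1)[OF zc(1)] .
    show "d (hcomp z k) = \<zero>"
      using hcomp_graded_linear[OF d_linear zc(1), of k] zc(2) hcomp_hom[OF hpart_closed(2)[of 0]] by simp
  qed
  have "(\<Oplus>k \<in> S. hcomp z k) \<in> cycles C \<and> Q (\<Oplus>k \<in> S. hcomp z k)" if "finite S" for S
    using that
  proof (induction set: finite)
    case empty then show ?case using cycles_closed(1) hom[OF Zh_closed(1)] by simp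
  next
    case (insert k S)
    have "(\<Oplus>k \<in> insert k S. hcomp z k) = hcomp z k \<oplus> (\<Oplus>k \<in> S. hcomp z k)"
      using insert zc(1) by (intro M.finsum_insert) auto
    then show ?case using insert.IH cycles_closed(2) add ZhD(4)[OF comp] hom[OF comp] by metis
  qed
  then show ?thesis by (subst hcomp_props(3)[OF zc(1)]) (use hcomp_props(2)[OF zc(1)] in blast)
qed

text \<open>The folding \<rho> induces an endomorphism of the homology, which
  \<open>chain_map_lift\<close> realizes on the complex. It commutes with \<open>\<iota>\<close> on
  homology since \<rho> commutes with \<open>J\<close>, and it is local since
  \<open>\<rho> v\<close> and \<open>v\<close> have the same degree and therefore merge.\<close>

lemma folding_self_local:
  obtains p where "self_local_equivalence C \<iota> p"
    and "\<And>z. z \<in> cycles C \<Longrightarrow> keys (\<psi> (p z)) \<subseteq> sub_verts"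
proof (rule equivariant_folding)
  fix \<rho> assume \<rho>: "\<And>v. v \<in> verts M \<Longrightarrow> \<rho> v \<in> sub_verts" "\<And>v. v \<in> verts M \<Longrightarrow> gr (\<rho> v) = gr v"
    "\<And>v. v \<in> verts M \<Longrightarrow> \<rho> (D v) = D (\<rho> v)" "\<And>v. v \<in> verts M \<Longrightarrow> \<rho> (J v) = J (\<rho> v)"
  define Q where "Q = (\<lambda>k. {(z, z'). z \<in> Zh k \<and> z' \<in> Zh k \<and> \<psi> z' = vertex_map \<rho> (\<psi> z)})"
  have swap: "vertex_map \<rho> (vertex_map g x) = vertex_map g (vertex_map \<rho> x)"
    if "\<And>v. v \<in> verts M \<Longrightarrow> \<rho> (g v) = g (\<rho> v)" "keys x \<subseteq> verts M" for g x
    unfolding vertex_map_compose using that by (intro vertex_map_cong) blast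
  have "\<exists>p. chain_map C p \<and> (\<forall>k. \<forall>z \<in> Zh k. (z, p z) \<in> Q k)"
  proof (rule chain_map_lift)
    show "Q k \<subseteq> Zh k \<times> Zh k" for k by (auto simp: Q_def)
    show "(\<zero>, \<zero>) \<in> Q k" for k by (simp add: Q_def Zh_closed(1) psi_zero)
    show "(x \<oplus> x', y \<oplus> y') \<in> Q k" if "(x, y) \<in> Q k" "(x', y') \<in> Q k" for k x y x' y'
    proof -
      have *: "x \<in> Zh k" "y \<in> Zh k" "x' \<in> Zh k" "y' \<in> Zh k" "\<psi> y = vertex_map \<rho> (\<psi> x)" "\<psi> y' = vertex_map \<rho> (\<psi> x')"
        using that by (auto simp: Q_def)
      show ?thesis
        using Zh_closed(2)[OF *(1,3)] Zh_closed(2)[OF *(2,4)] *(5,6)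
          psi_add[OF ZhD(4)[OF *(1)] ZhD(4)[OF *(3)]] psi_add[OF ZhD(4)[OF *(2)] ZhD(4)[OF *(4)]]
        by (simp add: Q_def vertex_map_add)
    qed
    show "(U \<odot> x, U \<odot> y) \<in> Q (k - 2)" if "(x, y) \<in> Q k" for k x y
    proof -
      have *: "x \<in> Zh k" "y \<in> Zh k" "\<psi> y = vertex_map \<rho> (\<psi> x)" using that by (auto simp: Q_def)
      have "vertex_map \<rho> (vertex_map D (\<psi> x)) = vertex_map D (vertex_map \<rho> (\<psi> x))"
        using \<rho>(3) psi_verts[OF ZhD(4)[OF *(1)]] by (rule swap)
      then show ?thesis
        using Zh_closed(3)[OF *(1)] Zh_closed(3)[OF *(2)] *(3) psi_U[OF ZhD(4)[OF *(1)]] psi_U[OF ZhD(4)[OF *(2)]]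
        by (simp add: Q_def)
    qed
    show "Zh k = Domain (Q k)" for k
    proof (intro equalityI subsetI)
      fix z assume z: "z \<in> Zh k"
      have "keys (vertex_map \<rho> (\<psi> z)) \<subseteq> {v \<in> verts M. gr v = k}"
        using keys_vertex_map[of \<rho> "\<psi> z"] psi_hpart[OF z] \<rho>(1,2) sub_verts_closed(1) by force
      then obtain z' where "z' \<in> Zh k" "\<psi> z' = vertex_map \<rho> (\<psi> z)" using psi_surj by blast
      then show "z \<in> Domain (Q k)" using z by (auto simp: Q_def)
    qed (auto simp: Q_def)
    show "z \<in> Bh k" if "(b, z) \<in> Q k" "b \<in> Bh k" for k b z
      using that psi_Bh_iff[of b k] psi_Bh_iff[of z k] by (simp add: Q_def)
  qed
  then obtain p where p: "chain_map C p" "\<And>k z. z \<in> Zh k \<Longrightarrow> \<psi> (p z) = vertex_map \<rho> (\<psi> z)"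
    unfolding Q_def by auto
  have psi_p: "\<psi> (p z) = vertex_map \<rho> (\<psi> z)" if "z \<in> cycles C" for z
    using that
  proof (induction rule: cycles_induct)
    case (homogeneous k y) then show ?case by (rule p(2))
  next
    case (add y z)
    then show ?case
      using chain_mapD(2)[OF p(1) cyclesD(1)[OF add(1)] cyclesD(1)[OF add(2)]] psi_add[OF add(1,2)]
        psi_add[OF chain_mapD(7)[OF p(1) add(1)] chain_mapD(7)[OF p(1) add(2)]]
      by (simp add: vertex_map_add)
  qed
  have fold_stable: "\<exists>N. \<forall>n \<ge> N. vertex_map (D ^^ n) (vertex_map \<rho> x) = vertex_map (D ^^ n) x"
    if "keys x \<subseteq> verts M" for x
    using that
  proof (induction rule: keys_induct)
    case zero then show ?case by simp
  next
    case (add v y)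
    obtain N where N: "\<forall>n \<ge> N. vertex_map (D ^^ n) (vertex_map \<rho> y) = vertex_map (D ^^ n) y" using add by blast
    have \<rho>v: "\<rho> v \<in> verts M" "gr (\<rho> v) = gr v" using \<rho>(1,2) add(1) sub_verts_closed(1) by auto
    obtain N' where N': "\<And>n. n \<ge> N' \<Longrightarrow> (D ^^ n) (\<rho> v) = (D ^^ n) v" using gr_merge[OF \<rho>v(1) add(1) \<rho>v(2)] by blast
    show ?case using N N' by (intro exI[of _ "max N N'"]) (simp add: vertex_map_add)
  qed
  have "\<psi> (p (\<iota> z)) = \<psi> (\<iota> (p z))" if z: "z \<in> cycles C" for z
    unfolding psi_p[OF chain_mapD(7)[OF iota z]] psi_iota[OF z] psi_iota[OF chain_mapD(7)[OF p(1) z]] psi_p[OF z]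
    using \<rho>(4) psi_verts[OF z] by (rule swap)
  moreover have "stably_trivial p"
    unfolding stably_trivial_def using psi_p fold_stable psi_verts by simp
  ultimately have sl: "self_local_equivalence C \<iota> p" unfolding self_local_iff using p(1) by blast
  have sub: "keys (\<psi> (p z)) \<subseteq> sub_verts" if "z \<in> cycles C" for z
    unfolding psi_p[OF that] using keys_vertex_map[of \<rho> "\<psi> z"] psi_verts[OF that] \<rho>(1) by blast
  show thesis by (rule that[OF sl sub])
qed

text \<open>The induced map \<open>G\<close> restricts to an equivariant local endomorphism of the
  subroot module, injective by \<open>equivariant_endomorphism_injective\<close> and then onto in
  each degree by finiteness. It will be applied to \<open>p \<circ> f\<close>.\<close>

lemma subroot_endomorphism_bijective:
  assumes q: "self_local_equivalence C \<iota> q"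
    and sub: "\<And>z. z \<in> cycles C \<Longrightarrow> keys (\<psi> (q z)) \<subseteq> sub_verts"
    and m: "keys m \<subseteq> {v \<in> sub_verts. gr v = k}"
  shows "\<exists>z \<in> Zh k. \<psi> (q z) = m"
proof -
  have cq: "chain_map C q" and triv: "stably_trivial q"
    and qJ: "\<And>z. z \<in> cycles C \<Longrightarrow> \<psi> (q (\<iota> z)) = \<psi> (\<iota> (q z))"
    using q unfolding self_local_iff by simp_all
  have qz: "q z \<in> cycles C" if "z \<in> cycles C" for z using chain_mapD(7)[OF cq that] .
  define G where "G = (\<lambda>m. \<psi> (q (SOME z. z \<in> cycles C \<and> \<psi> z = m)))"
  have G: "G (\<psi> z) = \<psi> (q z)" if z: "z \<in> cycles C" for z
  proof -
    define u where "u = (SOME u. u \<in> cycles C \<and> \<psi> u = \<psi> z)"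
    have u: "u \<in> cycles C" "\<psi> u = \<psi> z"
      using someI[of "\<lambda>u. u \<in> cycles C \<and> \<psi> u = \<psi> z" z] z unfolding u_def by blast+
    have "u \<oplus> z \<in> boundaries C" using psi_eq_iff[OF u(1) z] u(2) by simp
    then have "q u \<oplus> q z \<in> boundaries C"
      unfolding chain_mapD(2)[OF cq cyclesD(1)[OF u(1)] cyclesD(1)[OF z], symmetric] by (rule chain_mapD(8)[OF cq])
    then have "\<psi> (q u) = \<psi> (q z)" using psi_eq_iff[OF qz[OF u(1)] qz[OF z]] by simp
    then show ?thesis unfolding G_def u_def .
  qed
  have sv: "sub_verts \<subseteq> verts M" using sub_verts_closed(1) by blast
  have G_add: "G (x + y) = G x + G y" if xy: "keys x \<subseteq> sub_verts" "keys y \<subseteq> sub_verts" for x y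
  proof -
    obtain u where u: "u \<in> cycles C" "\<psi> u = x" using psi_surj_all[of x] xy sv by blast
    obtain v where v: "v \<in> cycles C" "\<psi> v = y" using psi_surj_all[of y] xy sv by blast
    have "G (x + y) = \<psi> (q (u \<oplus> v))"
      using G[OF cycles_closed(2)[OF u(1) v(1)]] psi_add[OF u(1) v(1)] u v by simp
    also have "\<dots> = \<psi> (q u) + \<psi> (q v)"
      unfolding chain_mapD(2)[OF cq cyclesD(1)[OF u(1)] cyclesD(1)[OF v(1)]] by (rule psi_add[OF qz[OF u(1)] qz[OF v(1)]])
    finally show ?thesis using G[OF u(1)] G[OF v(1)] u v by simp
  qed
  have vertex: "\<exists>z \<in> Zh (gr v). \<psi> z = vx v" if "v \<in> sub_verts" for v
    using psi_surj[of "vx v" "gr v"] that sv by auto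
  have level: "keys (G x) \<subseteq> {v \<in> sub_verts. gr v = j}" if x: "keys x \<subseteq> {v \<in> sub_verts. gr v = j}" for x j
  proof -
    have "keys x \<subseteq> {v \<in> verts M. gr v = j}" using x sv by blast
    then obtain z where z: "z \<in> Zh j" "\<psi> z = x" using psi_surj by blast
    have "G x = \<psi> (q z)" using G[OF ZhD(4)[OF z(1)]] z(2) by simp
    then show ?thesis using sub[OF ZhD(4)[OF z(1)]] psi_hpart[OF chain_mapD(9)[OF cq z(1)]] by auto
  qed
  have inj: "x = 0" if "keys x \<subseteq> sub_verts" "G x = 0" for x
  proof (rule equivariant_endomorphism_injective[of G x])
    show "G (x + y) = G x + G y" if "keys x \<subseteq> sub_verts" "keys y \<subseteq> sub_verts" for x y by (rule G_add[OF that])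
    show "keys (G (vx v)) \<subseteq> {w \<in> sub_verts. gr w = gr v}" if "v \<in> sub_verts" for v
      using level[of "vx v" "gr v"] that by simp
    fix v assume v: "v \<in> sub_verts"
    obtain z where z: "z \<in> Zh (gr v)" "\<psi> z = vx v" using vertex[OF v] by blast
    have zc: "z \<in> cycles C" using ZhD(4)[OF z(1)] .
    have Gv: "G (vx v) = \<psi> (q z)" using G[OF zc] z(2) by simp
    have "G (vx (D v)) = \<psi> (q (U \<odot> z))" using G[OF cycles_closed(3)[OF zc, of U]] psi_U[OF zc] z(2) by simp
    then show "G (vx (D v)) = vertex_map D (G (vx v))"
      unfolding Gv chain_mapD(3)[OF cq cyclesD(1)[OF zc]] using psi_U[OF qz[OF zc]] by simp
    have "G (vx (J v)) = \<psi> (q (\<iota> z))" using G[OF chain_mapD(7)[OF iota zc]] psi_iota[OF zc] z(2) by simp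
    then show "G (vx (J v)) = vertex_map J (G (vx v))"
      unfolding Gv qJ[OF zc] using psi_iota[OF qz[OF zc]] by simp
    \<comment> \<open>Pushing down does not change the augmentation, so agreement far down the root
      already determines it.\<close>
    obtain N where "\<forall>n \<ge> N. vertex_map (D ^^ n) (\<psi> (q z)) = vertex_map (D ^^ n) (\<psi> z)"
      using triv zc unfolding stably_trivial_def by blast
    then have "aug (vertex_map (D ^^ N) (\<psi> (q z))) = aug (vertex_map (D ^^ N) (vx v))" using z(2) by simp
    then show "aug (G (vx v)) = 1" unfolding Gv by (simp only: aug_simps)
  qed (use that in auto)
  let ?X = "{x :: 'v \<Rightarrow>\<^sub>0 bit. keys x \<subseteq> {v \<in> sub_verts. gr v = k}}"
  have "finite {v \<in> sub_verts. gr v = k}" by (rule finite_subset[OF _ finite_gr_level[of k]]) (use sv in blast)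
  then have "finite ?X" by (rule finite_bit_supported)
  moreover have "inj_on G ?X"
  proof (rule inj_onI)
    fix x y assume xy: "x \<in> ?X" "y \<in> ?X" "G x = G y"
    have k: "keys x \<subseteq> sub_verts" "keys y \<subseteq> sub_verts" using xy(1,2) by blast+
    have "G (x + y) = 0" unfolding G_add[OF k] xy(3) by (rule bit_add_self')
    moreover have "keys (x + y) \<subseteq> sub_verts" using Poly_Mapping.keys_add[of x y] k by blast
    ultimately have "x + y = 0" using inj by blast
    then have "x + y + y = y" by simp
    then show "x = y" by (simp only: add.assoc bit_add_self' add_0_right)
  qed
  moreover have "G ` ?X \<subseteq> ?X" using level by blast
  ultimately have "G ` ?X = ?X" by (intro endo_inj_surj)
  moreover have "m \<in> ?X" using m by (rule CollectI)
  ultimately have "m \<in> G ` ?X" by (simp only:)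
  then obtain x where x: "x \<in> ?X" "G x = m" by (elim imageE) (simp only: that)
  have "keys x \<subseteq> {v \<in> verts M. gr v = k}" using x(1) sv by blast
  then obtain z where z: "z \<in> Zh k" "\<psi> z = x" using psi_surj by blast
  then have "\<psi> (q z) = m" using G[OF ZhD(4)[OF z(1)]] x(2) by simp
  then show ?thesis using z(1) by blast
qed

lemma image_homology_iso:
  assumes max: "maximal_self_local_equivalence C \<iota> f"
  shows "graded_isomorphic (HF_conn C f) (shift_up 1 (U_torsion (Hminus (monotone_subroot M J\<^sub>0 gr tip) gr)))"
proof (rule folding_self_local)
  fix p assume p: "self_local_equivalence C \<iota> p"
    and p_sub: "\<And>z. z \<in> cycles C \<Longrightarrow> keys (\<psi> (p z)) \<subseteq> sub_verts"
  have f: "self_local_equivalence C \<iota> f" using max unfolding maximal_self_local_equivalence_def by blast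
  have cf: "chain_map C f" and cp: "chain_map C p" using f p unfolding self_local_iff by simp_all
  note fD = chain_mapD[OF cf] and pD = chain_mapD[OF cp]
  define W where "W = f ` carrier C"
  define B where "B = d ` W"
  define Z where "Z = {x \<in> W. d x = \<zero>}"
  have Wc: "W \<subseteq> carrier C" using fD(1) by (auto simp: W_def)
  have W_zero: "\<zero> \<in> W" using fD(5) M.zero_closed unfolding W_def by (metis image_eqI)
  have W_add: "x \<oplus> y \<in> W" if xy: "x \<in> W" "y \<in> W" for x y
  proof -
    obtain a b where "a \<in> carrier C" "b \<in> carrier C" "x = f a" "y = f b" using xy by (auto simp: W_def)
    then have "x \<oplus> y = f (a \<oplus> b)" "a \<oplus> b \<in> carrier C" using fD(2) by simp_all
    then show ?thesis unfolding W_def by blast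
  qed
  have W_smult: "r \<odot> x \<in> W" if x: "x \<in> W" for r x
  proof -
    obtain a where a: "a \<in> carrier C" "x = f a" using x by (auto simp: W_def)
    then have "r \<odot> x = f (r \<odot> a)" using fD(3) by simp
    then show ?thesis using a(1) unfolding W_def by blast
  qed
  have W_d: "d x \<in> W" if x: "x \<in> W" for x
  proof -
    obtain a where a: "a \<in> carrier C" "x = f a" using x by (auto simp: W_def)
    then have "d x = f (d a)" using fD(4) by simp
    then show ?thesis using d_simps(1)[OF a(1)] unfolding W_def by blast
  qed
  have fW: "f x \<in> W" if "x \<in> carrier C" for x using that by (simp add: W_def)
  have B_sub: "subspace B"
    unfolding subspace_def
  proof (intro conjI ballI allI)
    show "B \<subseteq> carrier C" unfolding B_def using W_d Wc by blast
    show "\<zero> \<in> B" unfolding B_def using W_zero d_simps(4) by (metis image_eqI)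
    fix x assume "x \<in> B"
    then obtain a where a: "a \<in> W" "x = d a" by (auto simp: B_def)
    have ac: "a \<in> carrier C" using a Wc by blast
    have "r \<odot> x = d (r \<odot> a)" for r using d_simps(3)[OF ac] a by simp
    then show "r \<odot> x \<in> B" for r unfolding B_def using W_smult[OF a(1)] by blast
    fix y assume "y \<in> B"
    then obtain b where b: "b \<in> W" "y = d b" by (auto simp: B_def)
    have bc: "b \<in> carrier C" using b Wc by blast
    have "x \<oplus> y = d (a \<oplus> b)" using d_simps(2)[OF ac bc] a b by simp
    then show "x \<oplus> y \<in> B" unfolding B_def using W_add[OF a(1) b(1)] by blast
  qed
  have Zc: "x \<in> cycles C" "x \<in> carrier C" "x \<in> W" "d x = \<zero>" if "x \<in> Z" for x
    using that Wc by (auto simp: Z_def cycles_def)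
  have Z_add: "x \<oplus> y \<in> Z" if xy: "x \<in> Z" "y \<in> Z" for x y
    using W_add[OF Zc(3)[OF xy(1)] Zc(3)[OF xy(2)]] cyclesD(2)[OF cycles_closed(2)[OF Zc(1)[OF xy(1)] Zc(1)[OF xy(2)]]]
    by (simp add: Z_def)
  have Z_smult: "r \<odot> x \<in> Z" if x: "x \<in> Z" for r x
    using W_smult[OF Zc(3)[OF x]] cyclesD(2)[OF cycles_closed(3)[OF Zc(1)[OF x]]] by (simp add: Z_def)

  have fpf: "self_local_equivalence C \<iota> (\<lambda>x. f (p (f x)))"
    using self_local_compose[OF f self_local_compose[OF p f]] .
  have "kernel_le C f (\<lambda>x. f (p (f x)))"
    unfolding kernel_le_def by (auto simp: a_kernel_iff fD(5) pD(5))
  then have ker: "kernel_le C (\<lambda>x. f (p (f x))) f"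
    using max fpf unfolding maximal_self_local_equivalence_def by blast
  have fp_inj: "w = \<zero>" if w: "w \<in> f ` carrier C" "f (p w) = \<zero>" for w
  proof -
    obtain a where a: "a \<in> carrier C" "w = f a" using w(1) by blast
    have "a \<in> a_kernel C C (\<lambda>x. f (p (f x)))" using a w(2) by (simp add: a_kernel_iff)
    then have "a \<in> a_kernel C C f" using ker unfolding kernel_le_def by blast
    then show ?thesis using a by (simp add: a_kernel_iff)
  qed
  define \<alpha> where "\<alpha> = (\<lambda>x. \<psi> (p x))"
  have pZ: "p x \<in> cycles C" if "x \<in> Z" for x using pD(7)[OF Zc(1)[OF that]] .
  have \<alpha>_add: "\<alpha> (x \<oplus> y) = \<alpha> x + \<alpha> y" if xy: "x \<in> Z" "y \<in> Z" for x y
    unfolding \<alpha>_def pD(2)[OF Zc(2)[OF xy(1)] Zc(2)[OF xy(2)]] by (rule psi_add[OF pZ[OF xy(1)] pZ[OF xy(2)]])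
  have \<alpha>_smult: "\<alpha> (r \<odot> x) = r \<odot>\<^bsub>HM\<^esub> \<alpha> x" if x: "x \<in> Z" for r x
    unfolding \<alpha>_def pD(3)[OF Zc(2)[OF x]] by (rule psi_smult[OF pZ[OF x]])
  have \<alpha>_sub: "keys (\<alpha> x) \<subseteq> sub_verts" if "x \<in> Z" for x unfolding \<alpha>_def by (rule p_sub[OF Zc(1)[OF that]])
  have \<alpha>_zero_iff: "\<alpha> x = 0 \<longleftrightarrow> x \<in> B" if x: "x \<in> Z" for x
  proof
    assume "\<alpha> x = 0"
    then have "p x \<in> boundaries C" using psi_zero_iff[OF pZ[OF x]] by (simp add: \<alpha>_def)
    then obtain y where y: "y \<in> carrier C" "p x = d y" by (auto simp: boundaries_def)
    \<comment> \<open>The chain \<open>y\<close> need not lie in \<open>W\<close>, but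
      \<open>f y\<close> does and can be written as \<open>f (p w)\<close>. Then \<open>x\<close>
      and \<open>d w\<close> have the same image under \<open>f \<circ> p\<close>, which is
      injective on \<open>W\<close>.\<close>
    have fy: "f y \<in> f ` carrier C" using y(1) by blast
    obtain w where w: "w \<in> f ` carrier C" "f y = f (p w)" using surj_on_image[OF cf cp fp_inj fy] by blast
    have wW: "w \<in> W" using w(1) by (simp add: W_def)
    have wc: "w \<in> carrier C" using wW Wc by blast
    have "f (p x) = d (f (p w))" using y w(2) fD(4)[OF y(1)] by simp
    also have "\<dots> = f (p (d w))" using fD(4) pD(4) pD(1) wc by simp
    finally have eq: "f (p x) = f (p (d w))" .
    have dw: "d w \<in> carrier C" by (rule d_simps(1)[OF wc])
    have "f (p (x \<oplus> d w)) = f (p x) \<oplus> f (p (d w))"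
      unfolding pD(2)[OF Zc(2)[OF x] dw] by (rule fD(2)[OF pD(1)[OF Zc(2)[OF x]] pD(1)[OF dw]])
    then have "f (p (x \<oplus> d w)) = \<zero>"
      unfolding eq using add_self[OF fD(1)[OF pD(1)[OF dw]]] by (rule trans)
    moreover have "x \<oplus> d w \<in> f ` carrier C" using W_add[OF Zc(3)[OF x] W_d[OF wW]] by (simp add: W_def)
    ultimately have "x \<oplus> d w = \<zero>" using fp_inj by blast
    then have "x = d w" using add_eq_zero_iff[OF Zc(2)[OF x] d_simps(1)[OF wc]] by blast
    then show "x \<in> B" using wW by (simp add: B_def)
  next
    assume "x \<in> B"
    then obtain w where w: "w \<in> W" "x = d w" by (auto simp: B_def)
    then have "p x \<in> boundaries C" using pD(8) Wc by (auto simp: boundaries_def)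
    then show "\<alpha> x = 0" using psi_zero_iff[OF pZ[OF x]] by (simp add: \<alpha>_def)
  qed
  have \<alpha>_hpart: "keys (\<alpha> x) \<subseteq> {v \<in> sub_verts. gr v = k}" if x: "x \<in> hpart C k" "x \<in> Z" for x k
    using psi_hpart[OF pD(9)[OF ZhI[OF x(1) Zc(4)[OF x(2)]]]] \<alpha>_sub[OF x(2)] unfolding \<alpha>_def by blast
  \<comment> \<open>\<open>p \<circ> f\<close> already reaches everything in the subroot module, and
    applying \<open>f\<close> moves the cycle found there into \<open>W\<close>.\<close>
  have \<alpha>_surj: "\<exists>x \<in> hpart C k \<inter> Z. \<alpha> x = m" if m: "keys m \<subseteq> {v \<in> sub_verts. gr v = k}" for m k
  proof -
    have "\<exists>z \<in> Zh k. \<psi> (p (f z)) = m"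
      by (rule subroot_endomorphism_bijective[OF self_local_compose[OF p f] p_sub[OF fD(7)] m])
    then obtain z where z: "z \<in> Zh k" "\<psi> (p (f z)) = m" by blast
    have "f z \<in> Zh k" using fD(9)[OF z(1)] .
    then have "f z \<in> hpart C k \<inter> Z" using ZhD[of "f z" k] fW[OF ZhD(2)[OF z(1)]] by (simp add: Z_def)
    then show ?thesis using z(2) unfolding \<alpha>_def by blast
  qed

  \<comment> \<open>The equivalence \<open>\<alpha>_zero_iff\<close> serves twice: one direction
    makes \<theta> independent of the representative, the other makes it injective.\<close>
  define \<theta> where "\<theta> = (\<lambda>X. \<alpha> (SOME x. x \<in> Z \<and> X = B +> x))"
  have \<theta>: "\<theta> (B +> x) = \<alpha> x" if x: "x \<in> Z" for x
  proof -
    define y where "y = (SOME y. y \<in> Z \<and> B +> x = B +> y)"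
    have y: "y \<in> Z" "B +> x = B +> y"
      using someI[of "\<lambda>y. y \<in> Z \<and> B +> x = B +> y" x] x unfolding y_def by blast+
    have "x \<oplus> y \<in> B" using coset_eq_iff[OF B_sub Zc(2)[OF x] Zc(2)[OF y(1)]] y(2) by blast
    then have "\<alpha> x + \<alpha> y = 0" using \<alpha>_zero_iff[OF Z_add[OF x y(1)]] \<alpha>_add[OF x y(1)] by simp
    then have "\<alpha> x + \<alpha> y + \<alpha> y = \<alpha> y" by simp
    then have "\<alpha> x = \<alpha> y" by (simp only: add.assoc bit_add_self' add_0_right)
    then show ?thesis unfolding \<theta>_def y_def[symmetric] by simp
  qed
  let ?H = "homology (submod C W)" and ?H' = "Hminus (monotone_subroot M J\<^sub>0 gr tip) gr"
  have H: "carrier ?H = (\<lambda>z. B +> z) ` Z" "\<And>X Y. X \<oplus>\<^bsub>?H\<^esub> Y = X <+>\<^bsub>C\<^esub> Y"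
    "\<And>r X. r \<odot>\<^bsub>?H\<^esub> X = B <+>\<^bsub>C\<^esub> ((\<lambda>x. r \<odot> x) ` X)" "\<zero>\<^bsub>?H\<^esub> = B"
    "\<And>k. hpart ?H k = (\<lambda>z. B +> z) ` (hpart C k \<inter> Z)"
    unfolding B_def Z_def by (rule homology_submod_simps)+
  have H_smult: "r \<odot>\<^bsub>?H\<^esub> (B +> x) = B +> (r \<odot> x)" if "x \<in> Z" for r x
    unfolding H(3) by (rule coset_smult[OF B_sub Zc(2)[OF that]])
  have H_add: "(B +> x) \<oplus>\<^bsub>?H\<^esub> (B +> y) = B +> (x \<oplus> y)" if "x \<in> Z" "y \<in> Z" for x y
    unfolding H(2) by (rule coset_add[OF B_sub Zc(2)[OF that(1)] Zc(2)[OF that(2)]])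
  have verts': "verts (monotone_subroot M J\<^sub>0 gr tip) = sub_verts"
    unfolding monotone_subroot_eq by (simp add: restrict_root_def)
  have smult': "r \<odot>\<^bsub>?H'\<^esub> x = r \<odot>\<^bsub>HM\<^esub> x" if "keys x \<subseteq> sub_verts" for r x
    unfolding monotone_subroot_eq
    by (rule Hminus_restrict_smult[OF _ that]) (use down_restrict_root[OF sub_verts_graded_root] in auto)
  have zeroZ: "\<zero> \<in> Z" using W_zero by (simp add: Z_def d_simps)
  have iso: "graded_iso ?H ?H' \<theta>"
    unfolding graded_iso_def
  proof (intro conjI allI)
    show "graded_linear 0 ?H ?H' \<theta>"
      unfolding graded_linear_def
    proof (intro conjI ballI allI)
      show "\<theta> \<in> carrier ?H \<rightarrow> carrier ?H'" unfolding H(1) using \<theta> subsetD[OF \<alpha>_sub] by (auto simp: verts')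
      fix X assume "X \<in> carrier ?H"
      then obtain x where x: "x \<in> Z" "X = B +> x" unfolding H(1) by blast
      show "\<theta> (r \<odot>\<^bsub>?H\<^esub> X) = r \<odot>\<^bsub>?H'\<^esub> \<theta> X" for r
        unfolding x(2) H_smult[OF x(1)] \<theta>[OF Z_smult[OF x(1)]] \<theta>[OF x(1)] smult'[OF \<alpha>_sub[OF x(1)]] by (rule \<alpha>_smult[OF x(1)])
      fix Y assume "Y \<in> carrier ?H"
      then obtain y where y: "y \<in> Z" "Y = B +> y" unfolding H(1) by blast
      show "\<theta> (X \<oplus>\<^bsub>?H\<^esub> Y) = \<theta> X \<oplus>\<^bsub>?H'\<^esub> \<theta> Y"
        unfolding x(2) y(2) H_add[OF x(1) y(1)] \<theta>[OF Z_add[OF x(1) y(1)]] \<theta>[OF x(1)] \<theta>[OF y(1)]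
        by (simp add: \<alpha>_add[OF x(1) y(1)])
    next
      fix k X assume "X \<in> hpart ?H k"
      then obtain x where x: "x \<in> hpart C k" "x \<in> Z" "X = B +> x" unfolding H(5) by blast
      show "\<theta> X \<in> hpart ?H' (k + 0)" unfolding x(3) \<theta>[OF x(2)] using \<alpha>_hpart[OF x(1,2)] by (simp add: verts')
    qed
    have hom: "hpart ?H' k \<subseteq> \<theta> ` hpart ?H k" for k
    proof
      fix m assume "m \<in> hpart ?H' k"
      then have "keys m \<subseteq> {v \<in> sub_verts. gr v = k}" by (simp add: verts')
      then obtain x where x: "x \<in> hpart C k \<inter> Z" "\<alpha> x = m" using \<alpha>_surj by blast
      then have "m = \<theta> (B +> x)" using \<theta> by simp
      then show "m \<in> \<theta> ` hpart ?H k" unfolding H(5) using x(1) by blast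
    qed
    show "\<theta> ` hpart ?H k = hpart ?H' k" for k
    proof (intro equalityI hom subsetI)
      fix m assume "m \<in> \<theta> ` hpart ?H k"
      then obtain x where x: "x \<in> hpart C k" "x \<in> Z" "m = \<theta> (B +> x)" unfolding H(5) by blast
      then show "m \<in> hpart ?H' k" using \<alpha>_hpart[OF x(1,2)] \<theta> by (simp add: verts')
    qed
    have onto: "\<exists>x \<in> Z. \<alpha> x = m" if "keys m \<subseteq> sub_verts" for m
      using that
    proof (induction rule: keys_induct)
      case zero
      have "\<alpha> \<zero> = 0" using \<alpha>_zero_iff[OF zeroZ] B_sub unfolding subspace_def by blast
      then show ?case using zeroZ by blast
    next
      case (add v y)
      obtain x where x: "x \<in> Z" "\<alpha> x = y" using add by blast
      obtain u where u: "u \<in> hpart C (gr v) \<inter> Z" "\<alpha> u = vx v" using \<alpha>_surj[of "vx v" "gr v"] add(1) by auto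
      then show ?case using x \<alpha>_add[of u x] Z_add[of u x] by (intro bexI[of _ "u \<oplus> x"]) auto
    qed
    show "bij_betw \<theta> (carrier ?H) (carrier ?H')"
      unfolding bij_betw_def
    proof
      show "inj_on \<theta> (carrier ?H)"
      proof (rule inj_onI)
        fix X Y assume XY: "X \<in> carrier ?H" "Y \<in> carrier ?H" "\<theta> X = \<theta> Y"
        obtain x where x: "x \<in> Z" "X = B +> x" using XY(1) unfolding H(1) by blast
        obtain y where y: "y \<in> Z" "Y = B +> y" using XY(2) unfolding H(1) by blast
        have "\<alpha> x = \<alpha> y" using XY(3) \<theta> x y by simp
        then have "\<alpha> (x \<oplus> y) = 0" unfolding \<alpha>_add[OF x(1) y(1)] by (simp only: bit_add_self')
        then have "x \<oplus> y \<in> B" using \<alpha>_zero_iff[OF Z_add[OF x(1) y(1)]] by blast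
        then show "X = Y" unfolding x(2) y(2) using coset_eq_iff[OF B_sub Zc(2)[OF x(1)] Zc(2)[OF y(1)]] by blast
      qed
      show "\<theta> ` carrier ?H = carrier ?H'"
      proof (intro equalityI subsetI)
        fix m assume "m \<in> \<theta> ` carrier ?H"
        then obtain x where "x \<in> Z" "m = \<theta> (B +> x)" unfolding H(1) by blast
        then show "m \<in> carrier ?H'" using \<theta> \<alpha>_sub[of x] by (simp add: verts')
      next
        fix m assume "m \<in> carrier ?H'"
        then obtain x where x: "x \<in> Z" "\<alpha> x = m" using onto[of m] by (auto simp: verts')
        then have "m = \<theta> (B +> x)" using \<theta> by simp
        then show "m \<in> \<theta> ` carrier ?H" unfolding H(1) using x(1) by blast
      qed
    qed
  qed
  have BZ: "B = B +> \<zero>" using coset_zero[OF B_sub] by simp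
  have "graded_iso (shift_up 1 (U_torsion ?H)) (shift_up 1 (U_torsion ?H')) \<theta>"
  proof (rule graded_iso_U_torsion[OF iso])
    show "\<zero>\<^bsub>?H\<^esub> \<in> carrier ?H" unfolding H(1,4) by (subst BZ) (use zeroZ in blast)
    have "\<theta> B = \<alpha> \<zero>" using \<theta>[OF zeroZ] BZ by simp
    then show "\<theta> \<zero>\<^bsub>?H\<^esub> = \<zero>\<^bsub>?H'\<^esub>"
      using \<alpha>_zero_iff[OF zeroZ] B_sub unfolding subspace_def H(4) by simp
    show "r \<odot>\<^bsub>?H\<^esub> X \<in> carrier ?H" if "X \<in> carrier ?H" for r X
      using that H_smult Z_smult unfolding H(1) by auto
    show "hpart ?H k \<subseteq> carrier ?H" for k unfolding H(1,5) by blast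
  qed
  then show ?thesis unfolding graded_isomorphic_def HF_conn_def W_def[symmetric] by blast
qed

end

theorem theorem1p16:
  fixes CFm :: "'a chain_cx" and \<iota> :: "'a \<Rightarrow> 'a"
    and M :: "'v root_graph" and J\<^sub>0 :: "'v \<Rightarrow> 'v"
    and gr :: "'v \<Rightarrow> int" and tip :: "int \<Rightarrow> 'v"
    and \<phi> :: "'a set \<Rightarrow> ('v \<Rightarrow>\<^sub>0 bit)"
  assumes "iota_complex CFm \<iota>"
    and "symmetric_graded_root M J\<^sub>0"
    and "degree_function M gr"
    and "graded_iso (homology CFm) (Hminus M gr) \<phi>"
    and "\<forall>x \<in> carrier (homology CFm). \<phi> (homology_map CFm \<iota> x) = vertex_map J\<^sub>0 (\<phi> x)"
    and "tip_choice M J\<^sub>0 gr tip"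
  shows "(\<exists>f. maximal_self_local_equivalence CFm \<iota> f) \<and>
    (\<forall>f. maximal_self_local_equivalence CFm \<iota> f \<longrightarrow>
      graded_isomorphic (HF_conn CFm f)
        (shift_up 1 (U_torsion (Hminus (monotone_subroot M J\<^sub>0 gr tip) gr))))"
proof -
  interpret symmetric_graded_root M J\<^sub>0 by fact
  interpret root_homology CFm M J\<^sub>0 gr tip \<iota> \<phi>
    using assms by unfold_locales (auto simp: iota_complex_def)
  show ?thesis using exists_maximal_self_local image_homology_iso by blast
qed

end
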